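(* Let $\lambda$ be a frequency and $(G,\beta)$ a $\lambda$-Dirichlet group with normalized Haar measure $m$. Then the map $$\mathcal{B}\colon H_1^\lambda(G)\to M_\lambda(G),\qquad f\mapsto f\,dm,$$ is an onto isometry preserving the Fourier coefficients.
   Context: A frequency is a strictly increasing sequence $\lambda=(\lambda_n)_{n\ge1}$ of non-negative real numbers tending to $\infty$. A Dirichlet group is a pair $(G,\beta)$ of a compact abelian group $G$ and a continuous homomorphism $\beta\colon\mathbb{R}\to G$ with dense range. It is a $\lambda$-Dirichlet group if for every $n$ there is a (necessarily unique) character $h_{\lambda_n}\in\widehat{G}$ with $h_{\lambda_n}(\beta(t))=e^{-i\lambda_n t}$ for all $t\in\mathbb{R}$. For $f\in L_1(G)$ and $\gamma\in\widehat G$, $\widehat{f}(\gamma)=\int_G f\overline{\gamma}\,dm$. $H_1^\lambda(G)$ is the space of all $f\in L_1(G)$ such that $\widehat f(\gamma)\ne0$ only if $\gamma=h_{\lambda_n}$ for some $n$. $M(G)$ is the Banach space of all bounded regular complex Borel measures on $G$ with the total variation norm, $\widehat\mu(\gamma)=\int_G\overline\gamma\,d\mu$, and $M_\lambda(G)$ is the subspace of all $\mu\in M(G)$ such that $\widehat\mu(\gamma)\ne0$ only if $\gamma=h_{\lambda_n}$ for some $n$. *)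

theory Defs
  imports "HOL-Analysis.Analysis"
begin

section \<open>Frequencies, characters and Dirichlet groups\<close>

text \<open>A frequency $(\lambda_n)_{n \ge 1}$ is indexed by all natural numbers, starting at 0.\<close>

definition frequency :: "(nat \<Rightarrow> real) \<Rightarrow> bool" where
  "frequency lam \<longleftrightarrow> strict_mono lam \<and> (\<forall>n. 0 \<le> lam n) \<and> filterlim lam at_top sequentially"

text \<open>Groups are written additively. As usual, a compact group is understood to be Hausdorff;
  this is the sort constraint \<^class>\<open>t2_space\<close>.\<close>

definition dirichlet_group :: "(real \<Rightarrow> 'g::{topological_ab_group_add,t2_space}) \<Rightarrow> bool" where
  "dirichlet_group \<beta> \<longleftrightarrow>
     compact (UNIV :: 'g set) \<and>
     (\<forall>s t. \<beta> (s + t) = \<beta> s + \<beta> t) \<and> continuous_on UNIV \<beta> \<and> closure (range \<beta>) = UNIV"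

definition characters :: "('g::{topological_ab_group_add,t2_space} \<Rightarrow> complex) set" where
  "characters = {\<gamma>. continuous_on UNIV \<gamma> \<and> (\<forall>x. cmod (\<gamma> x) = 1) \<and> (\<forall>x y. \<gamma> (x + y) = \<gamma> x * \<gamma> y)}"

definition extends_exp ::
  "(real \<Rightarrow> 'g::{topological_ab_group_add,t2_space}) \<Rightarrow> real \<Rightarrow> ('g \<Rightarrow> complex) \<Rightarrow> bool" where
  "extends_exp \<beta> l h \<longleftrightarrow> h \<in> characters \<and> (\<forall>t. h (\<beta> t) = exp (- (\<i> * of_real (l * t))))"

definition lambda_dirichlet_group ::
  "(nat \<Rightarrow> real) \<Rightarrow> (real \<Rightarrow> 'g::{topological_ab_group_add,t2_space}) \<Rightarrow> bool" where
  "lambda_dirichlet_group lam \<beta> \<longleftrightarrow> dirichlet_group \<beta> \<and> (\<forall>n. \<exists>h. extends_exp \<beta> (lam n) h)"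

text \<open>The character \<open>h\<^sub>l\<close>; it is unique because \<open>\<beta>\<close> has dense range.\<close>

definition h_char ::
  "(real \<Rightarrow> 'g::{topological_ab_group_add,t2_space}) \<Rightarrow> real \<Rightarrow> 'g \<Rightarrow> complex" where
  "h_char \<beta> l = (THE h. extends_exp \<beta> l h)"


section \<open>Normalized Haar measure\<close>

definition borel_regular :: "('g::topological_space set \<Rightarrow> ennreal) \<Rightarrow> bool" where
  "borel_regular \<nu> \<longleftrightarrow> (\<forall>A\<in>sets borel.
     \<nu> A = (SUP K\<in>{K. compact K \<and> K \<subseteq> A}. \<nu> K) \<and>
     \<nu> A = (INF U\<in>{U. open U \<and> A \<subseteq> U}. \<nu> U))"

definition normalized_haar :: "'g::{topological_ab_group_add,t2_space} measure \<Rightarrow> bool" where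
  "normalized_haar m \<longleftrightarrow>
     sets m = sets borel \<and> emeasure m UNIV = 1 \<and>
     (\<forall>x. \<forall>A\<in>sets borel. emeasure m ((\<lambda>y. x + y) ` A) = emeasure m A) \<and>
     borel_regular (emeasure m)"


section \<open>The spaces \<open>L\<^sub>1(G)\<close> and \<open>H\<^sub>1\<^sup>\<lambda>(G)\<close>\<close>

text \<open>Elements of \<open>L\<^sub>1\<close> are classes of integrable functions modulo equality almost everywhere.
  Norm, vector space operations and Fourier coefficients are computed on a representative;
  none of them depends on its choice.\<close>

definition L1_rel :: "'g measure \<Rightarrow> (('g \<Rightarrow> complex) \<times> ('g \<Rightarrow> complex)) set" where
  "L1_rel m = {(f, g). integrable m f \<and> integrable m g \<and> (AE x in m. f x = g x)}"

definition L1 :: "'g measure \<Rightarrow> ('g \<Rightarrow> complex) set set" where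
  "L1 m = {f. integrable m f} // L1_rel m"

definition L1_class :: "'g measure \<Rightarrow> ('g \<Rightarrow> complex) \<Rightarrow> ('g \<Rightarrow> complex) set" where
  "L1_class m f = L1_rel m `` {f}"

definition rep :: "('g \<Rightarrow> complex) set \<Rightarrow> 'g \<Rightarrow> complex" where
  "rep F = (SOME f. f \<in> F)"

definition L1_add ::
  "'g measure \<Rightarrow> ('g \<Rightarrow> complex) set \<Rightarrow> ('g \<Rightarrow> complex) set \<Rightarrow> ('g \<Rightarrow> complex) set" where
  "L1_add m F G = L1_class m (\<lambda>x. rep F x + rep G x)"

definition L1_scale ::
  "'g measure \<Rightarrow> complex \<Rightarrow> ('g \<Rightarrow> complex) set \<Rightarrow> ('g \<Rightarrow> complex) set" where
  "L1_scale m c F = L1_class m (\<lambda>x. c * rep F x)"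

definition L1_norm :: "'g measure \<Rightarrow> ('g \<Rightarrow> complex) set \<Rightarrow> real" where
  "L1_norm m F = (LINT x|m. cmod (rep F x))"

definition L1_fourier ::
  "'g measure \<Rightarrow> ('g \<Rightarrow> complex) set \<Rightarrow> ('g \<Rightarrow> complex) \<Rightarrow> complex" where
  "L1_fourier m F \<gamma> = (LINT x|m. rep F x * cnj (\<gamma> x))"

definition H1 ::
  "(nat \<Rightarrow> real) \<Rightarrow> (real \<Rightarrow> 'g::{topological_ab_group_add,t2_space}) \<Rightarrow> 'g measure
     \<Rightarrow> ('g \<Rightarrow> complex) set set" where
  "H1 lam \<beta> m = {F \<in> L1 m. \<forall>\<gamma>\<in>characters.
     L1_fourier m F \<gamma> \<noteq> 0 \<longrightarrow> (\<exists>n. \<gamma> = h_char \<beta> (lam n))}"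


section \<open>The spaces \<open>M(G)\<close> and \<open>M\<^sub>\<lambda>(G)\<close>\<close>

text \<open>A complex Borel measure is a set function that is countably additive on the Borel sets; it
  is required to vanish on all other sets, so that equality of measures is equality of functions.\<close>

definition complex_borel_measure :: "('g::topological_space set \<Rightarrow> complex) \<Rightarrow> bool" where
  "complex_borel_measure \<mu> \<longleftrightarrow>
     (\<forall>A. range A \<subseteq> sets borel \<longrightarrow> disjoint_family A \<longrightarrow>
        (\<lambda>n::nat. \<mu> (A n)) sums \<mu> (\<Union>n. A n)) \<and>
     (\<forall>E. E \<notin> sets borel \<longrightarrow> \<mu> E = 0)"

definition total_variation :: "('g::topological_space set \<Rightarrow> complex) \<Rightarrow> 'g set \<Rightarrow> ennreal" where
  "total_variation \<mu> E =
     (SUP A\<in>{A :: nat \<Rightarrow> 'g set. range A \<subseteq> sets borel \<and> disjoint_family A \<and> (\<Union>n. A n) = E}.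
        \<Sum>n. ennreal (cmod (\<mu> (A n))))"

definition M :: "('g::topological_space set \<Rightarrow> complex) set" where
  "M = {\<mu>. complex_borel_measure \<mu> \<and> total_variation \<mu> UNIV < \<infinity> \<and>
           borel_regular (total_variation \<mu>)}"

definition M_norm :: "('g::topological_space set \<Rightarrow> complex) \<Rightarrow> real" where
  "M_norm \<mu> = enn2real (total_variation \<mu> UNIV)"

text \<open>The positive variation of a finite signed measure: since \<^const>\<open>ennreal\<close> sends negative
  reals to 0 and the empty set is admitted, it is $\nu^+(E) = \sup \{\nu(A) \mid A \subseteq E\}$.
  The negative variation is \<open>pos_variation (\<lambda>A. - \<nu> A)\<close>, and integration against a complex measure
  is defined through the Jordan decompositions of its real and imaginary parts.\<close>

definition pos_variation :: "('g::topological_space set \<Rightarrow> real) \<Rightarrow> 'g measure" where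
  "pos_variation \<nu> = measure_of UNIV (sets borel)
     (\<lambda>E. SUP A\<in>{A \<in> sets borel. A \<subseteq> E}. ennreal (\<nu> A))"

definition signed_integral ::
  "('g::topological_space set \<Rightarrow> real) \<Rightarrow> ('g \<Rightarrow> complex) \<Rightarrow> complex" where
  "signed_integral \<nu> f =
     (LINT x|pos_variation \<nu>. f x) - (LINT x|pos_variation (\<lambda>A. - \<nu> A). f x)"

definition complex_measure_integral ::
  "('g::topological_space set \<Rightarrow> complex) \<Rightarrow> ('g \<Rightarrow> complex) \<Rightarrow> complex" where
  "complex_measure_integral \<mu> f =
     signed_integral (\<lambda>A. Re (\<mu> A)) f + \<i> * signed_integral (\<lambda>A. Im (\<mu> A)) f"

definition M_fourier ::
  "('g::topological_space set \<Rightarrow> complex) \<Rightarrow> ('g \<Rightarrow> complex) \<Rightarrow> complex" where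
  "M_fourier \<mu> \<gamma> = complex_measure_integral \<mu> (\<lambda>x. cnj (\<gamma> x))"

definition M_lambda ::
  "(nat \<Rightarrow> real) \<Rightarrow> (real \<Rightarrow> 'g::{topological_ab_group_add,t2_space})
     \<Rightarrow> ('g set \<Rightarrow> complex) set" where
  "M_lambda lam \<beta> = {\<mu> \<in> M. \<forall>\<gamma>\<in>characters.
     M_fourier \<mu> \<gamma> \<noteq> 0 \<longrightarrow> (\<exists>n. \<gamma> = h_char \<beta> (lam n))}"


section \<open>The map \<open>f \<mapsto> f dm\<close>\<close>

definition dens_measure ::
  "'g::topological_space measure \<Rightarrow> ('g \<Rightarrow> complex) set \<Rightarrow> 'g set \<Rightarrow> complex" where
  "dens_measure m F = (\<lambda>A. if A \<in> sets borel then (LINT x:A|m. rep F x) else 0)"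

end

theory Submission imports Defs
begin

text \<open>
  That the map preserves norms and Fourier coefficients is measure theory: if \<open>\<mu>\<close> has the
  density \<open>k\<close> with respect to a finite measure \<open>\<rho>\<close>, then its total variation has the density
  \<open>\<bar>k\<bar>\<close> (\<open>total_variation_density\<close>) and integration against \<open>\<mu>\<close> is integration of \<open>k\<close> times
  the integrand (\<open>complex_measure_integral_density\<close>). The substance is surjectivity, a theorem of
  F. and M. Riesz type: every \<open>\<mu>\<close> in \<open>M_lambda\<close> is absolutely continuous with respect to Haar
  measure \<open>m\<close>.

  Choose one finite measure \<open>\<rho>\<close> with \<open>m = w \<rho>\<close> and \<open>\<mu> = k \<rho>\<close>; the singular part of \<open>\<mu>\<close> is the
  restriction of \<open>k \<rho>\<close> to \<open>{w = 0}\<close>. Identify a character \<open>\<gamma>\<close> with its frequency, the real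
  \<open>l\<close> such that \<open>\<gamma> (\<beta> t) = exp (- i l t)\<close>, and call a trigonometric polynomial analytic if its
  frequencies are nonnegative. Let \<open>K\<close> be a compact subset of \<open>{w = 0}\<close>. Since \<open>m K = 0\<close>, some
  trigonometric polynomial \<open>u \<ge> 0\<close> is large on \<open>K\<close> and has small mean; it is the real part of an
  analytic \<open>P\<close> with real mean (\<open>peak_polynomial\<close>). The function \<open>g = exp (- P)\<close> satisfies
  \<open>\<bar>g\<bar> = exp (- u) \<le> 1\<close>, is small on \<open>K\<close>, and has mean \<open>exp (- \<integral> u dm)\<close>, because the mean is
  multiplicative on analytic functions. This mean is nearly 1, so \<open>g\<close> is close to 1 in \<open>L\<^sub>2(m)\<close>.
  Letting \<open>K\<close> exhaust the singular part, multiplication by \<open>g\<close> tends to the removal of the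
  singular part. But multiplication by \<open>g\<close> respects every lower bound on the spectrum, hence the
  singular part of \<open>\<mu>\<close> inherits such a bound from \<open>\<mu>\<close> (\<open>singular_part_annihilates\<close>).

  Since \<open>\<lambda>\<^sub>n\<close> tends to infinity, only finitely many coefficients of \<open>\<mu>\<close> lie below a given bound, and
  subtracting the corresponding trigonometric polynomial changes the absolutely continuous part
  only. So the spectrum of the singular part lies above every bound, that is, it is empty, and the
  singular part vanishes (\<open>M_lambda_density\<close>).

  The construction of \<open>u\<close> and the last step need many characters: they must separate the points
  of \<open>G\<close>. This is the theorem of Peter and Weyl for compact abelian groups. The proof given here
  works with convolution of continuous functions alone: normalized powers of a Hermitian function
  converge uniformly to a convolution idempotent (\<open>top_idempotent\<close>), and a minimal idempotent is a
  multiple of a character (\<open>minimal_idem_character\<close>).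
\<close>

section \<open>Countably additive set functions and the Jordan decomposition\<close>

text \<open>Stated for values in an arbitrary normed space, since it is applied to complex measures as well
  as to their real and imaginary parts.\<close>

definition borel_charge :: "('g::topological_space set \<Rightarrow> 'b::real_normed_vector) \<Rightarrow> bool" where
  "borel_charge \<nu> \<longleftrightarrow> (\<forall>A. range A \<subseteq> sets borel \<longrightarrow> disjoint_family A \<longrightarrow>
        (\<lambda>n::nat. \<nu> (A n)) sums \<nu> (\<Union>n. A n))"

lemma borel_charge_sums:
  assumes "borel_charge \<nu>" "\<And>n::nat. A n \<in> sets borel" "disjoint_family A"
  shows "(\<lambda>n. \<nu> (A n)) sums \<nu> (\<Union>n. A n)"
proof -
  have "range A \<subseteq> sets borel" using assms(2) by (rule image_subsetI)
  with assms(1,3) show ?thesis by (simp only: borel_charge_def)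
qed

lemma borel_charge_bounded_linear:
  assumes "borel_charge \<nu>" "bounded_linear h"
  shows "borel_charge (\<lambda>A. h (\<nu> A))"
  unfolding borel_charge_def
  by (intro allI impI bounded_linear.sums[OF assms(2)])
    (rule assms(1)[unfolded borel_charge_def, rule_format])

lemma borel_charge_empty:
  assumes "borel_charge \<nu>" shows "\<nu> {} = 0"
proof -
  have "summable (\<lambda>n::nat. \<nu> {})"
    using borel_charge_sums[OF assms, of "\<lambda>_. {}"] by (auto simp: disjoint_family_on_def sums_iff)
  then show ?thesis by (simp add: summable_const_iff)
qed

lemma borel_charge_Un:
  assumes "borel_charge \<nu>" "A \<in> sets borel" "B \<in> sets borel" "A \<inter> B = {}"
  shows "\<nu> (A \<union> B) = \<nu> A + \<nu> B"
proof -
  have "(\<lambda>n. \<nu> (binaryset A B n)) sums \<nu> (\<Union>n. binaryset A B n)"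
    using assms by (intro borel_charge_sums) (auto simp: binaryset_def disjoint_family_on_def)
  moreover have "(\<lambda>n. \<nu> (binaryset A B n)) sums (\<nu> A + \<nu> B)"
    by (intro binaryset_sums borel_charge_empty assms)
  ultimately show ?thesis by (simp add: UN_binaryset_eq sums_iff)
qed

lemma ennreal_le_suminf:
  fixes x :: "nat \<Rightarrow> real"
  assumes "x sums s" shows "ennreal s \<le> (\<Sum>n. ennreal (x n))"
proof (rule LIMSEQ_le_const2)
  show "(\<lambda>n. ennreal (\<Sum>i<n. x i)) \<longlonglongrightarrow> ennreal s"
    using assms by (intro tendsto_ennrealI) (simp add: sums_def)
  have "ennreal (\<Sum>i<n. x i) \<le> (\<Sum>n. ennreal (x n))" for n
  proof -
    have "ennreal (\<Sum>i<n. x i) \<le> ennreal (\<Sum>i<n. max 0 (x i))"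
      by (intro ennreal_leI sum_mono) simp
    also have "\<dots> = (\<Sum>i<n. ennreal (max 0 (x i)))" by simp
    also have "\<dots> = (\<Sum>i<n. ennreal (x i))"
      by (intro sum.cong) (auto simp: max_def ennreal_neg)
    also have "\<dots> \<le> (\<Sum>n. ennreal (x n))" by (rule sum_le_suminf) auto
    finally show ?thesis .
  qed
  then show "\<exists>N. \<forall>n\<ge>N. ennreal (\<Sum>i<n. x i) \<le> (\<Sum>n. ennreal (x n))" by blast
qed

text \<open>The set function in the definition of \<open>pos_variation\<close> is a measure: it is countably subadditive
  because each \<open>\<nu> X\<close> splits along a partition, and superadditive because near-optimal subsets of
  disjoint sets can be united.\<close>

lemma emeasure_pos_variation:
  assumes \<nu>: "borel_charge \<nu>" and E: "E \<in> sets borel"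
  shows "emeasure (pos_variation \<nu>) E = (SUP A\<in>{A \<in> sets borel. A \<subseteq> E}. ennreal (\<nu> A))"
proof -
  define P where "P E = (SUP A\<in>{A \<in> sets borel. A \<subseteq> E}. ennreal (\<nu> A))" for E
  have P_ge: "ennreal (\<nu> A) \<le> P E" if "A \<in> sets borel" "A \<subseteq> E" for A E
    unfolding P_def using that by (intro SUP_upper) auto
  have P_empty: "P {} = 0"
    unfolding P_def using borel_charge_empty[OF \<nu>] by (auto simp: bot_ennreal cong: conj_cong)
  have superadditive: "P A + P B \<le> P (A \<union> B)"
    if AB: "A \<inter> B = {}" for A B
  proof -
    \<comment> \<open>A set of negative charge contributes 0 to the sum, and dropping it leaves one of the other two
        bounds.\<close>
    have *: "ennreal (\<nu> X) + ennreal (\<nu> Y) \<le> P (A \<union> B)"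
      if X: "X \<in> sets borel" "X \<subseteq> A" and Y: "Y \<in> sets borel" "Y \<subseteq> B" for X Y
    proof -
      have "\<nu> (X \<union> Y) = \<nu> X + \<nu> Y"
        using X Y AB by (intro borel_charge_Un \<nu>) auto
      moreover have "ennreal (\<nu> X) \<le> P (A \<union> B)" "ennreal (\<nu> Y) \<le> P (A \<union> B)"
        "ennreal (\<nu> (X \<union> Y)) \<le> P (A \<union> B)"
        using X Y by (auto intro!: P_ge)
      ultimately show ?thesis
        by (cases "\<nu> X \<ge> 0"; cases "\<nu> Y \<ge> 0") (auto simp: ennreal_neg)
    qed
    have ne: "{A \<in> sets borel. A \<subseteq> E} \<noteq> {}" for E :: "'a set" by blast
    have "P A + P B = (SUP X\<in>{X \<in> sets borel. X \<subseteq> A}. ennreal (\<nu> X) + P B)"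
      using ennreal_SUP_add_left[OF ne, of "\<lambda>X. ennreal (\<nu> X)"] by (simp add: P_def)
    also have "\<dots> \<le> P (A \<union> B)"
    proof (rule SUP_least)
      fix X assume X: "X \<in> {X \<in> sets borel. X \<subseteq> A}"
      have "ennreal (\<nu> X) + P B = (SUP Y\<in>{Y \<in> sets borel. Y \<subseteq> B}. ennreal (\<nu> X) + ennreal (\<nu> Y))"
        using ennreal_SUP_add_right[OF ne, of "ennreal (\<nu> X)" "\<lambda>X. ennreal (\<nu> X)"]
        by (simp add: P_def)
      also have "\<dots> \<le> P (A \<union> B)" using X * by (auto intro!: SUP_least)
      finally show "ennreal (\<nu> X) + P B \<le> P (A \<union> B)" .
    qed
    finally show ?thesis .
  qed
  have P_mono: "P A \<le> P B" if "A \<subseteq> B" for A B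
    unfolding P_def using that by (intro SUP_subset_mono) auto
  have ca: "countably_additive (sets borel) P"
    unfolding countably_additive_def
  proof (intro allI impI)
    fix A :: "nat \<Rightarrow> 'a set"
    assume A: "range A \<subseteq> sets borel" "disjoint_family A" "(\<Union>i. A i) \<in> sets borel"
    have le: "P (\<Union>i. A i) \<le> (\<Sum>i. P (A i))"
    proof (subst P_def, rule SUP_least)
      fix X assume X: "X \<in> {B \<in> sets borel. B \<subseteq> (\<Union>i. A i)}"
      have "(\<lambda>i. \<nu> (X \<inter> A i)) sums \<nu> (\<Union>i. X \<inter> A i)"
        using A X by (intro borel_charge_sums \<nu>) (auto simp: disjoint_family_on_def)
      also have "(\<Union>i. X \<inter> A i) = X" using X by auto
      finally have "ennreal (\<nu> X) \<le> (\<Sum>i. ennreal (\<nu> (X \<inter> A i)))" by (rule ennreal_le_suminf)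
      also have "\<dots> \<le> (\<Sum>i. P (A i))"
        using A X by (intro suminf_le P_ge) auto
      finally show "ennreal (\<nu> X) \<le> (\<Sum>i. P (A i))" .
    qed
    have fin: "(\<Sum>i<n. P (A i)) \<le> P (\<Union>i<n. A i)" for n
    proof (induction n)
      case (Suc n)
      have "(\<Sum>i<Suc n. P (A i)) \<le> P (\<Union>i<n. A i) + P (A n)"
        using Suc by (simp add: add_right_mono)
      also have "\<dots> \<le> P ((\<Union>i<n. A i) \<union> A n)"
      proof (rule superadditive)
        have "A i \<inter> A n = {}" if "i < n" for i
          using A(2) that by (intro disjoint_family_onD[of A UNIV]) auto
        then show "(\<Union>i<n. A i) \<inter> A n = {}" by blast
      qed
      also have "(\<Union>i<n. A i) \<union> A n = (\<Union>i<Suc n. A i)" by (auto simp: less_Suc_eq)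
      finally show ?case .
    qed simp
    have ge: "(\<Sum>i. P (A i)) \<le> P (\<Union>i. A i)"
      unfolding suminf_eq_SUP by (intro SUP_least order.trans[OF fin] P_mono) auto
    from le ge show "(\<Sum>i. P (A i)) = P (\<Union>i. A i)" by (rule antisym[rotated])
  qed
  have "emeasure (pos_variation \<nu>) E = P E"
    unfolding pos_variation_def
  proof (subst emeasure_measure_of_sigma)
    show "sigma_algebra UNIV (sets borel)"
      using sets.sigma_algebra_axioms[of borel] by simp
    show "positive (sets borel) (\<lambda>E. SUP A\<in>{A \<in> sets borel. A \<subseteq> E}. ennreal (\<nu> A))"
      using P_empty by (simp add: positive_def P_def)
    show "countably_additive (sets borel) (\<lambda>E. SUP A\<in>{A \<in> sets borel. A \<subseteq> E}. ennreal (\<nu> A))"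
      using ca unfolding P_def .
  qed (simp_all add: P_def E)
  then show ?thesis by (simp add: P_def)
qed

lemma sets_pos_variation [simp, measurable_cong]: "sets (pos_variation \<nu>) = sets borel"
  unfolding pos_variation_def using sets.sigma_sets_eq[of borel] by simp

lemma space_pos_variation [simp]: "space (pos_variation \<nu>) = UNIV"
  unfolding pos_variation_def by simp

lemma finite_measure_pos_variation:
  assumes "borel_charge \<nu>" and "\<And>A. A \<in> sets borel \<Longrightarrow> \<nu> A \<le> C"
  shows "finite_measure (pos_variation \<nu>)"
proof
  have "emeasure (pos_variation \<nu>) UNIV \<le> ennreal C"
    using assms(2)
    by (subst emeasure_pos_variation[OF assms(1)]) (auto intro!: SUP_least ennreal_leI)
  then show "emeasure (pos_variation \<nu>) (space (pos_variation \<nu>)) \<noteq> \<infinity>"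
    by (auto simp: top_unique)
qed

text \<open>A subset \<open>A\<close> of \<open>E\<close> is nearly optimal for \<open>\<nu>\<close> exactly if \<open>E - A\<close> is nearly optimal for \<open>- \<nu>\<close>.
  This gives one inequality, and the other follows by exchanging \<open>\<nu>\<close> and \<open>- \<nu>\<close>.\<close>

lemma jordan_decomposition:
  assumes \<nu>: "borel_charge \<nu>" and bdd: "\<And>A. A \<in> sets borel \<Longrightarrow> \<bar>\<nu> A\<bar> \<le> C"
    and E: "E \<in> sets borel"
  shows "\<nu> E = measure (pos_variation \<nu>) E - measure (pos_variation (\<lambda>A. - \<nu> A)) E"
proof -
  have half: "measure (pos_variation \<nu>) E - \<nu> E \<le> measure (pos_variation (\<lambda>A. - \<nu> A)) E"
    if \<nu>: "borel_charge \<nu>" and bdd: "\<And>A. A \<in> sets borel \<Longrightarrow> \<bar>\<nu> A\<bar> \<le> C" for \<nu>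
  proof -
    have neg: "borel_charge (\<lambda>A. - \<nu> A)"
      by (rule borel_charge_bounded_linear[OF \<nu>]) (rule bounded_linear_minus[OF bounded_linear_ident])
    interpret Q: finite_measure "pos_variation (\<lambda>A. - \<nu> A)"
      using bdd by (intro finite_measure_pos_variation[OF neg, of C]) (auto simp: abs_le_iff)
    have Q_ge: "- \<nu> A \<le> measure (pos_variation (\<lambda>A. - \<nu> A)) E" if "A \<in> sets borel" "A \<subseteq> E" for A
    proof -
      have "ennreal (- \<nu> A) \<le> emeasure (pos_variation (\<lambda>A. - \<nu> A)) E"
        unfolding emeasure_pos_variation[OF neg E] using that by (intro SUP_upper) auto
      then show ?thesis by (simp add: Q.emeasure_eq_measure)
    qed
    have "emeasure (pos_variation \<nu>) E \<le> ennreal (\<nu> E + measure (pos_variation (\<lambda>A. - \<nu> A)) E)"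
      unfolding emeasure_pos_variation[OF \<nu> E]
    proof (intro SUP_least ennreal_leI)
      fix A assume A: "A \<in> {A \<in> sets borel. A \<subseteq> E}"
      then have "\<nu> E = \<nu> A + \<nu> (E - A)"
        using borel_charge_Un[OF \<nu>, of A "E - A"] E by (auto simp: Un_absorb1)
      moreover have "- \<nu> (E - A) \<le> measure (pos_variation (\<lambda>A. - \<nu> A)) E"
        using A E by (intro Q_ge) auto
      ultimately show "\<nu> A \<le> \<nu> E + measure (pos_variation (\<lambda>A. - \<nu> A)) E" by linarith
    qed
    then have "measure (pos_variation \<nu>) E \<le> \<nu> E + measure (pos_variation (\<lambda>A. - \<nu> A)) E"
      unfolding measure_def[of "pos_variation \<nu>"] using Q_ge[of E] E by (intro enn2real_leI) auto
    then show ?thesis by linarith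
  qed
  have neg: "borel_charge (\<lambda>A. - \<nu> A)"
    by (rule borel_charge_bounded_linear[OF \<nu>]) (rule bounded_linear_minus[OF bounded_linear_ident])
  have "measure (pos_variation \<nu>) E - \<nu> E \<le> measure (pos_variation (\<lambda>A. - \<nu> A)) E"
    by (rule half[OF \<nu> bdd])
  moreover have "measure (pos_variation (\<lambda>A. - \<nu> A)) E + \<nu> E \<le> measure (pos_variation \<nu>) E"
    using half[OF neg] bdd by simp
  ultimately show ?thesis by linarith
qed

text \<open>Adding measures provides a common dominating measure for the variations of a complex measure and
  Haar measure.\<close>

lemma finite_measure_sum_ex:
  fixes P Q :: "'g::topological_space measure"
  assumes "finite_measure P" "finite_measure Q" "sets P = sets borel" "sets Q = sets borel"
  obtains R where "finite_measure R" "sets R = sets borel"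
    "\<And>A. A \<in> sets borel \<Longrightarrow> emeasure R A = emeasure P A + emeasure Q A"
proof
  define R where "R = measure_of UNIV (sets borel) (\<lambda>A. emeasure P A + emeasure Q A)"
  show sets: "sets R = sets borel"
    unfolding R_def using sets.sigma_sets_eq[of borel] by simp
  have space: "space R = UNIV" by (simp add: R_def)
  have [simp]: "space P = UNIV" "space Q = UNIV"
    using assms(3,4) by (auto dest: sets_eq_imp_space_eq)
  show R: "emeasure R A = emeasure P A + emeasure Q A" if "A \<in> sets borel" for A
    unfolding R_def
  proof (rule emeasure_measure_of_sigma)
    show "sigma_algebra UNIV (sets borel)"
      using sets.sigma_algebra_axioms[of borel] by simp
    show "positive (sets borel) (\<lambda>A. emeasure P A + emeasure Q A)" by (simp add: positive_def)
    show "countably_additive (sets borel) (\<lambda>A. emeasure P A + emeasure Q A)"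
      unfolding countably_additive_def
      by (auto simp: suminf_add[symmetric] suminf_emeasure assms)
  qed (use that in auto)
  show "finite_measure R"
    using assms(1,2) R[of UNIV] space
    by (intro finite_measureI) (auto simp: finite_measure.emeasure_eq_measure)
qed

text \<open>The Radon-Nikodym density of a dominated finite measure can be taken real-valued.\<close>

lemma finite_measure_density_ex:
  assumes "finite_measure R" "finite_measure P" "sets P = sets R"
    and "\<And>A. A \<in> sets R \<Longrightarrow> emeasure P A \<le> emeasure R A"
  obtains w :: "'a \<Rightarrow> real" where "\<And>x. 0 \<le> w x" "integrable R w" "P = density R (\<lambda>x. ennreal (w x))"
proof -
  interpret R: finite_measure R by fact
  interpret P: finite_measure P by fact
  have ac: "absolutely_continuous R P"
    using assms(3,4) by (fastforce simp: absolutely_continuous_def null_sets_def)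
  obtain D where D: "D \<in> borel_measurable R" "AE x in R. RN_deriv R P x = ennreal (D x)"
    "\<And>x. 0 \<le> D x"
    using R.real_RN_deriv[OF assms(2) ac assms(3)] by metis
  have "P = density R (RN_deriv R P)"
    using R.density_RN_deriv[OF ac assms(3)] by simp
  also have "\<dots> = density R (\<lambda>x. ennreal (D x))"
    using D by (intro density_cong) auto
  finally have P: "P = density R (\<lambda>x. ennreal (D x))" .
  have "(\<integral>\<^sup>+x. ennreal (D x) \<partial>R) = emeasure P (space R)"
    unfolding P using D(1) by (auto simp: emeasure_density intro!: nn_integral_cong)
  then have "integrable R D"
    using D P.emeasure_finite[of "space R"]
    by (intro integrableI_nonneg) (auto simp: less_top[symmetric])
  with D P that show ?thesis by blast
qed

section \<open>Complex measures with a density\<close>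

lemma measure_density_real:
  assumes "integrable \<rho> w" "\<And>x. 0 \<le> w x" "A \<in> sets \<rho>"
  shows "measure (density \<rho> (\<lambda>x. ennreal (w x))) A = (LINT x:A|\<rho>. w x)"
proof -
  have [measurable]: "w \<in> borel_measurable \<rho>" using assms(1) by simp
  have "emeasure (density \<rho> (\<lambda>x. ennreal (w x))) A = (\<integral>\<^sup>+x. ennreal (indicator A x * w x) \<partial>\<rho>)"
    using assms(3) by (auto simp: emeasure_density intro!: nn_integral_cong split: split_indicator)
  also have "\<dots> = ennreal (\<integral>x. indicator A x * w x \<partial>\<rho>)"
    using assms by (intro nn_integral_eq_integral) (auto intro: integrable_real_mult_indicator simp: mult.commute)
  finally show ?thesis
    using assms(2) by (simp add: measure_def set_lebesgue_integral_def integral_nonneg_AE)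
qed

lemma finite_measure_density_integrable:
  assumes "integrable \<rho> w" "\<And>x. 0 \<le> w x"
  shows "finite_measure (density \<rho> (\<lambda>x. ennreal (w x)))"
proof (rule finite_measureI)
  have [measurable]: "w \<in> borel_measurable \<rho>" using assms(1) by simp
  have "emeasure (density \<rho> (\<lambda>x. ennreal (w x))) (space \<rho>) = (\<integral>\<^sup>+x. ennreal (w x) \<partial>\<rho>)"
    by (auto simp: emeasure_density intro!: nn_integral_cong)
  also have "\<dots> = ennreal (\<integral>x. w x \<partial>\<rho>)"
    using assms by (intro nn_integral_eq_integral) auto
  finally show "emeasure (density \<rho> (\<lambda>x. ennreal (w x))) (space (density \<rho> (\<lambda>x. ennreal (w x)))) \<noteq> \<infinity>"
    by simp
qed

lemma set_integrable_of_integrable: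
  fixes k :: "'g \<Rightarrow> 'b::{banach, second_countable_topology}"
  assumes "integrable \<rho> k" "A \<in> sets \<rho>"
  shows "set_integrable \<rho> A k"
  using assms unfolding set_integrable_def by (intro integrable_mult_indicator)

lemma integrable_mult_bounded:
  fixes k f :: "'g \<Rightarrow> complex"
  assumes k: "integrable \<rho> k" and f: "f \<in> borel_measurable \<rho>" "\<And>x. cmod (f x) \<le> C"
  shows "integrable \<rho> (\<lambda>x. k x * f x)"
proof (rule Bochner_Integration.integrable_bound)
  show "integrable \<rho> (\<lambda>x. C * cmod (k x))" using k by auto
  show "AE x in \<rho>. cmod (k x * f x) \<le> norm (C * cmod (k x))"
  proof (intro AE_I2)
    fix x
    have "cmod (f x) \<le> \<bar>C\<bar>" using f(2)[of x] by linarith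
    then show "cmod (k x * f x) \<le> norm (C * cmod (k x))"
      by (simp add: norm_mult abs_mult mult.commute mult_right_mono)
  qed
qed (use k f(1) in auto)

lemma norm_set_integral_le:
  fixes k :: "'g \<Rightarrow> 'b::{banach, second_countable_topology}"
  assumes "integrable \<rho> k" "A \<in> sets \<rho>"
  shows "norm (LINT x:A|\<rho>. k x) \<le> measure (density \<rho> (\<lambda>x. ennreal (norm (k x)))) A"
proof -
  have "norm (LINT x:A|\<rho>. k x) \<le> (LINT x:A|\<rho>. norm (k x))"
    by (rule set_integral_norm_bound) (rule set_integrable_of_integrable[OF assms])
  also have "\<dots> = measure (density \<rho> (\<lambda>x. ennreal (norm (k x)))) A"
    using assms by (intro measure_density_real[symmetric]) auto
  finally show ?thesis .
qed

lemma borel_charge_density: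
  fixes k :: "'g::topological_space \<Rightarrow> 'b::{banach, second_countable_topology}"
  assumes k: "integrable \<rho> k" and sets: "sets \<rho> = sets borel"
    and \<mu>: "\<And>A. A \<in> sets borel \<Longrightarrow> \<mu> A = (LINT x:A|\<rho>. k x)"
  shows "borel_charge \<mu>"
  unfolding borel_charge_def
proof (intro allI impI)
  fix A :: "nat \<Rightarrow> 'g set"
  assume A: "range A \<subseteq> sets borel" "disjoint_family A"
  then have Ab: "A n \<in> sets borel" for n by auto
  define \<kappa> where "\<kappa> = density \<rho> (\<lambda>x. ennreal (norm (k x)))"
  interpret \<kappa>: finite_measure \<kappa>
    unfolding \<kappa>_def using k by (intro finite_measure_density_integrable) auto
  have "(\<lambda>n. measure \<kappa> (A n)) sums measure \<kappa> (\<Union>n. A n)"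
    using A sets by (intro \<kappa>.finite_measure_UNION) (auto simp: \<kappa>_def)
  then have "summable (\<lambda>n. measure \<kappa> (A n))" by (rule sums_summable)
  then have "summable (\<lambda>n. \<mu> (A n))"
  proof (rule summable_comparison_test'[where N = 0])
    show "norm (\<mu> (A n)) \<le> measure \<kappa> (A n)" for n
      using norm_set_integral_le[OF k, of "A n"] Ab[of n] by (simp add: \<mu> \<kappa>_def sets)
  qed
  moreover have "(\<Sum>n. \<mu> (A n)) = \<mu> (\<Union>n. A n)"
    unfolding \<mu>[OF Ab] \<mu>[OF sets.countable_UN[OF A(1)]]
    using A(2) Ab sets
    by (subst lebesgue_integral_countable_add)
      (auto simp: disjoint_family_on_def intro!: set_integrable_of_integrable k)
  ultimately show "(\<lambda>n. \<mu> (A n)) sums \<mu> (\<Union>n. A n)" by (simp add: sums_iff)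
qed

text \<open>Only the lower bound needs an idea: partition \<open>E\<close> into countably many pieces on each of which
  \<open>k\<close> is within \<open>d\<close> of a constant \<open>z\<close>. On such a piece \<open>A\<close> both \<open>\<integral> \<bar>k\<bar>\<close> and \<open>\<bar>\<integral> k\<bar>\<close> differ from
  \<open>\<bar>z\<bar> \<rho> A\<close> by at most \<open>d \<rho> A\<close>, and the errors add up to at most \<open>2 d \<rho> E\<close>.\<close>

lemma total_variation_density:
  fixes k :: "'g::topological_space \<Rightarrow> complex"
  assumes fin: "finite_measure \<rho>" and k: "integrable \<rho> k" and sets: "sets \<rho> = sets borel"
    and \<mu>: "\<And>A. A \<in> sets borel \<Longrightarrow> \<mu> A = (LINT x:A|\<rho>. k x)" and E: "E \<in> sets borel"
  shows "total_variation \<mu> E = emeasure (density \<rho> (\<lambda>x. ennreal (cmod (k x)))) E"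
proof (rule antisym)
  interpret \<rho>: finite_measure \<rho> by fact
  define \<kappa> where "\<kappa> = density \<rho> (\<lambda>x. ennreal (norm (k x)))"
  interpret \<kappa>: finite_measure \<kappa>
    unfolding \<kappa>_def using k by (intro finite_measure_density_integrable) auto
  have sets\<kappa>: "sets \<kappa> = sets borel" using sets by (simp add: \<kappa>_def)
  have [measurable]: "k \<in> borel_measurable \<rho>" using k by simp
  have space: "space \<rho> = UNIV" using sets_eq_imp_space_eq[OF sets] by simp
  have le: "cmod (\<mu> A) \<le> measure \<kappa> A" if "A \<in> sets borel" for A
    using norm_set_integral_le[OF k, of A] that sets by (simp add: \<mu> \<kappa>_def)
  show "total_variation \<mu> E \<le> emeasure (density \<rho> (\<lambda>x. ennreal (cmod (k x)))) E"
    unfolding total_variation_def \<kappa>_def[symmetric]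
  proof (rule SUP_least, clarify)
    fix A :: "nat \<Rightarrow> 'g set"
    assume A: "range A \<subseteq> sets borel" "disjoint_family A" "E = (\<Union>n. A n)"
    have "(\<Sum>n. ennreal (cmod (\<mu> (A n)))) \<le> (\<Sum>n. emeasure \<kappa> (A n))"
      using A le by (intro suminf_le) (auto simp: \<kappa>.emeasure_eq_measure intro!: ennreal_leI)
    also have "\<dots> = emeasure \<kappa> (\<Union>n. A n)"
      using A sets\<kappa> by (intro suminf_emeasure) auto
    finally show "(\<Sum>n. ennreal (cmod (\<mu> (A n)))) \<le> emeasure \<kappa> (\<Union>n. A n)" .
  qed
  show "emeasure (density \<rho> (\<lambda>x. ennreal (cmod (k x)))) E \<le> total_variation \<mu> E"
    unfolding \<kappa>_def[symmetric]
  proof (rule ennreal_le_epsilon)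
    fix e :: real assume e: "0 < e"
    define d where "d = e / (2 * (measure \<rho> UNIV + 1))"
    have d: "d > 0" using e by (simp add: d_def add_nonneg_pos)
    obtain D :: "complex set" where D: "countable D" "\<And>X. open X \<Longrightarrow> X \<noteq> {} \<Longrightarrow> \<exists>z\<in>D. z \<in> X"
      using countable_dense_setE by blast
    have Dne: "D \<noteq> {}" using D(2)[of UNIV] by auto
    define z where "z = from_nat_into D"
    have z: "\<exists>n. cmod (c - z n) < d" for c
    proof -
      obtain y where "y \<in> D" "y \<in> ball c d" using D(2)[of "ball c d"] d by auto
      moreover obtain n where "y = z n"
        using \<open>y \<in> D\<close> from_nat_into_surj[OF D(1)] unfolding z_def by metis
      ultimately show ?thesis by (auto simp: dist_norm)
    qed
    define B where "B n = {x. cmod (k x - z n) < d}" for n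
    have B: "B n \<in> sets borel" for n
    proof -
      have "{x \<in> space \<rho>. cmod (k x - z n) < d} \<in> sets \<rho>" by measurable
      then show ?thesis by (simp add: B_def sets space)
    qed
    \<comment> \<open>The balls around a countable dense set cover the plane; their preimages are made disjoint.\<close>
    define A where "A n = E \<inter> disjointed B n" for n
    have Ab: "A n \<in> sets borel" for n
      unfolding A_def using B E by (intro sets.Int sets.range_disjointed_sets[THEN range_subsetD]) auto
    have dis: "disjoint_family A"
      unfolding A_def using disjoint_family_disjointed[of B] by (auto simp: disjoint_family_on_def)
    have UB: "(\<Union>n. B n) = UNIV" using z by (auto simp: B_def)
    have UA: "(\<Union>n. A n) = E"
      unfolding A_def using UN_disjointed_eq[of B] UB by auto
    have AB: "A n \<subseteq> B n" for n unfolding A_def using disjointed_subset[of B n] by auto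
    have step: "measure \<kappa> (A n) \<le> cmod (\<mu> (A n)) + 2 * d * measure \<rho> (A n)" for n
    proof -
      have A\<rho>: "A n \<in> sets \<rho>" using Ab sets by simp
      have ic: "set_integrable \<rho> (A n) (\<lambda>x. c)" for c :: "'b::{banach,second_countable_topology}"
        by (intro set_integrable_of_integrable A\<rho>) auto
      note ik = set_integrable_of_integrable[OF k A\<rho>]
      have const: "(LINT x:A n|\<rho>. c) = measure \<rho> (A n) *\<^sub>R c" for c :: "'b::{banach,second_countable_topology}"
        using A\<rho> \<rho>.emeasure_finite[of "A n"] sets.sets_into_space[OF A\<rho>]
        by (simp add: set_lebesgue_integral_def less_top[symmetric] Int_absorb2)
      have "measure \<kappa> (A n) = (LINT x:A n|\<rho>. cmod (k x))"
        unfolding \<kappa>_def using k A\<rho> by (intro measure_density_real) auto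
      also have "\<dots> \<le> (LINT x:A n|\<rho>. cmod (z n) + d)"
      proof (rule set_integral_mono)
        fix x assume "x \<in> A n"
        then have "cmod (k x - z n) < d" using AB by (auto simp: B_def)
        then show "cmod (k x) \<le> cmod (z n) + d"
          using norm_triangle_sub[of "k x" "z n"] by linarith
      qed (use ik ic in \<open>auto intro: set_integrable_norm\<close>)
      also have "\<dots> = measure \<rho> (A n) * cmod (z n) + d * measure \<rho> (A n)"
        by (simp add: const algebra_simps)
      finally have 1: "measure \<kappa> (A n) \<le> measure \<rho> (A n) * cmod (z n) + d * measure \<rho> (A n)" .
      have "cmod ((LINT x:A n|\<rho>. z n) - \<mu> (A n)) = cmod (LINT x:A n|\<rho>. z n - k x)"
        unfolding \<mu>[OF Ab] by (subst set_integral_diff(2)[OF ic ik]) simp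
      also have "\<dots> \<le> (LINT x:A n|\<rho>. cmod (z n - k x))"
        by (intro set_integral_norm_bound set_integral_diff(1) ic ik)
      also have "\<dots> \<le> (LINT x:A n|\<rho>. d)"
      proof (rule set_integral_mono)
        fix x assume "x \<in> A n"
        then show "cmod (z n - k x) \<le> d" using AB[of n] by (auto simp: B_def norm_minus_commute)
      qed (auto intro!: ic set_integrable_norm set_integral_diff(1) ik)
      also have "\<dots> = d * measure \<rho> (A n)" by (simp add: const)
      finally have 2: "cmod ((LINT x:A n|\<rho>. z n) - \<mu> (A n)) \<le> d * measure \<rho> (A n)" .
      have "measure \<rho> (A n) * cmod (z n) = cmod (LINT x:A n|\<rho>. z n)"
        unfolding const by simp
      with 2 have "measure \<rho> (A n) * cmod (z n) \<le> cmod (\<mu> (A n)) + d * measure \<rho> (A n)"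
        using norm_triangle_sub[of "LINT x:A n|\<rho>. z n" "\<mu> (A n)"] by linarith
      with 1 show ?thesis by (simp add: algebra_simps)
    qed
    have "emeasure \<kappa> E = (\<Sum>n. emeasure \<kappa> (A n))"
      using suminf_emeasure[of A \<kappa>] Ab dis sets\<kappa> UA by (simp add: image_subset_iff)
    also have "\<dots> \<le> (\<Sum>n. ennreal (cmod (\<mu> (A n))) + ennreal (2 * d) * emeasure \<rho> (A n))"
    proof (intro suminf_le allI)
      fix n
      have "emeasure \<kappa> (A n) \<le> ennreal (cmod (\<mu> (A n)) + 2 * d * measure \<rho> (A n))"
        using step by (simp add: \<kappa>.emeasure_eq_measure ennreal_leI)
      also have "\<dots> = ennreal (cmod (\<mu> (A n))) + ennreal (2 * d) * emeasure \<rho> (A n)"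
        using d by (simp add: \<rho>.emeasure_eq_measure ennreal_mult)
      finally show "emeasure \<kappa> (A n) \<le> \<dots>" .
    qed auto
    also have "\<dots> = (\<Sum>n. ennreal (cmod (\<mu> (A n)))) + ennreal (2 * d) * emeasure \<rho> E"
      using suminf_emeasure[of A \<rho>] Ab dis sets UA
      by (subst suminf_add[symmetric]) (simp_all add: image_subset_iff)
    also have "\<dots> \<le> total_variation \<mu> E + ennreal e"
    proof (intro add_mono)
      show "(\<Sum>n. ennreal (cmod (\<mu> (A n)))) \<le> total_variation \<mu> E"
        unfolding total_variation_def using Ab dis UA by (intro SUP_upper) auto
      have "2 * d * measure \<rho> E \<le> 2 * d * (measure \<rho> UNIV + 1)"
        using d \<rho>.bounded_measure[of E] space by (intro mult_left_mono) auto
      also have "\<dots> = e"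
      proof -
        have "measure \<rho> UNIV + 1 > 0" using measure_nonneg[of \<rho> UNIV] by linarith
        then show ?thesis by (simp add: d_def field_simps)
      qed
      finally show "ennreal (2 * d) * emeasure \<rho> E \<le> ennreal e"
        using d by (simp add: \<rho>.emeasure_eq_measure ennreal_mult[symmetric] ennreal_leI)
    qed
    finally show "emeasure \<kappa> E \<le> total_variation \<mu> E + ennreal e" .
  qed
qed

text \<open>The supremum defining the positive variation on \<open>E\<close> is attained at the part of \<open>E\<close> where the
  density is positive.\<close>

lemma pos_variation_density:
  fixes r :: "'g::topological_space \<Rightarrow> real"
  assumes r: "integrable \<rho> r" and sets: "sets \<rho> = sets borel"
    and \<nu>: "\<And>A. A \<in> sets borel \<Longrightarrow> \<nu> A = (LINT x:A|\<rho>. r x)"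
  shows "pos_variation \<nu> = density \<rho> (\<lambda>x. ennreal (max 0 (r x)))"
proof (rule measure_eqI)
  fix E assume "E \<in> sets (pos_variation \<nu>)"
  then have E: "E \<in> sets borel" by simp
  have [measurable]: "r \<in> borel_measurable \<rho>" using r by simp
  have rp: "integrable \<rho> (\<lambda>x. max 0 (r x))" using r by auto
  define Q where "Q = density \<rho> (\<lambda>x. ennreal (max 0 (r x)))"
  interpret Q: finite_measure Q
    unfolding Q_def using rp by (intro finite_measure_density_integrable) auto
  have setsQ: "sets Q = sets borel" using sets by (simp add: Q_def)
  have Q: "measure Q A = (LINT x:A|\<rho>. max 0 (r x))" if "A \<in> sets borel" for A
    unfolding Q_def using rp that sets by (intro measure_density_real) auto
  have "(SUP A\<in>{A \<in> sets borel. A \<subseteq> E}. ennreal (\<nu> A)) = emeasure Q E"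
  proof (rule antisym)
    show "(SUP A\<in>{A \<in> sets borel. A \<subseteq> E}. ennreal (\<nu> A)) \<le> emeasure Q E"
    proof (rule SUP_least)
      fix A assume A: "A \<in> {A \<in> sets borel. A \<subseteq> E}"
      have "\<nu> A \<le> (LINT x:A|\<rho>. max 0 (r x))"
        using A sets r rp by (auto simp: \<nu> intro!: set_integral_mono set_integrable_of_integrable)
      also have "\<dots> = measure Q A" using A by (simp add: Q)
      also have "\<dots> \<le> measure Q E" using A E setsQ by (intro Q.finite_measure_mono) auto
      finally show "ennreal (\<nu> A) \<le> emeasure Q E" by (simp add: Q.emeasure_eq_measure ennreal_leI)
    qed
    have "{x \<in> space \<rho>. 0 < r x} \<in> sets \<rho>" by measurable
    then have A: "{x. 0 < r x} \<in> sets borel"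
      using sets_eq_imp_space_eq[OF sets] sets by simp
    have "measure Q E = (LINT x:E|\<rho>. max 0 (r x))" by (rule Q[OF E])
    also have "\<dots> = (LINT x:E \<inter> {x. 0 < r x}|\<rho>. r x)"
      unfolding set_lebesgue_integral_def
      by (intro Bochner_Integration.integral_cong) (auto split: split_indicator)
    also have "\<dots> = \<nu> (E \<inter> {x. 0 < r x})" using A E by (simp add: \<nu>)
    finally show "emeasure Q E \<le> (SUP A\<in>{A \<in> sets borel. A \<subseteq> E}. ennreal (\<nu> A))"
      unfolding Q.emeasure_eq_measure using A E
      by (intro SUP_upper2[of "E \<inter> {x. 0 < r x}"]) auto
  qed
  then show "emeasure (pos_variation \<nu>) E = emeasure (density \<rho> (\<lambda>x. ennreal (max 0 (r x)))) E"
    using emeasure_pos_variation[OF borel_charge_density[OF r sets \<nu>] E] by (simp add: Q_def)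
qed (use sets in simp)

lemma signed_integral_density:
  fixes r :: "'g::topological_space \<Rightarrow> real"
  assumes r: "integrable \<rho> r" and sets: "sets \<rho> = sets borel"
    and \<nu>: "\<And>A. A \<in> sets borel \<Longrightarrow> \<nu> A = (LINT x:A|\<rho>. r x)"
    and f: "f \<in> borel_measurable borel" "\<And>x. cmod (f x) \<le> C"
  shows "signed_integral \<nu> f = (LINT x|\<rho>. of_real (r x) * f x)"
proof -
  have [measurable]: "r \<in> borel_measurable \<rho>" "f \<in> borel_measurable \<rho>"
    using r f(1) measurable_cong_sets[OF sets refl] by auto
  have neg: "integrable \<rho> (\<lambda>x. - r x)" using r by simp
  have *: "(LINT x|density \<rho> (\<lambda>x. ennreal (max 0 (s x))). f x) = (LINT x|\<rho>. of_real (max 0 (s x)) * f x)"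
    "integrable \<rho> (\<lambda>x. of_real (max 0 (s x)) * f x)"
    if s: "integrable \<rho> s" for s
  proof -
    have [measurable]: "s \<in> borel_measurable \<rho>" using s by simp
    show "(LINT x|density \<rho> (\<lambda>x. ennreal (max 0 (s x))). f x) = (LINT x|\<rho>. of_real (max 0 (s x)) * f x)"
      by (subst integral_density) (auto simp: scaleR_conv_of_real)
    show "integrable \<rho> (\<lambda>x. of_real (max 0 (s x)) * f x)"
      using s by (intro integrable_mult_bounded[where C = C]) (auto intro: f(2))
  qed
  have "signed_integral \<nu> f = (LINT x|\<rho>. of_real (max 0 (r x)) * f x) - (LINT x|\<rho>. of_real (max 0 (- r x)) * f x)"
    unfolding signed_integral_def
    using pos_variation_density[OF r sets \<nu>]
      pos_variation_density[OF neg sets, of "\<lambda>A. - \<nu> A"] \<nu> *[OF r] *[OF neg]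
    by (simp add: set_lebesgue_integral_def)
  also have "\<dots> = (LINT x|\<rho>. of_real (max 0 (r x)) * f x - of_real (max 0 (- r x)) * f x)"
    using *(2)[OF r] *(2)[OF neg] by simp
  also have "\<dots> = (LINT x|\<rho>. of_real (r x) * f x)"
    by (intro Bochner_Integration.integral_cong) (auto simp: max_def)
  finally show ?thesis .
qed

lemma complex_measure_integral_density:
  fixes k :: "'g::topological_space \<Rightarrow> complex"
  assumes k: "integrable \<rho> k" and sets: "sets \<rho> = sets borel"
    and \<mu>: "\<And>A. A \<in> sets borel \<Longrightarrow> \<mu> A = (LINT x:A|\<rho>. k x)"
    and f: "f \<in> borel_measurable borel" "\<And>x. cmod (f x) \<le> C"
  shows "complex_measure_integral \<mu> f = (LINT x|\<rho>. k x * f x)"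
proof -
  have [measurable]: "k \<in> borel_measurable \<rho>" "f \<in> borel_measurable \<rho>"
    using k f(1) measurable_cong_sets[OF sets refl] by auto
  have kRe: "integrable \<rho> (\<lambda>x. Re (k x))" and kIm: "integrable \<rho> (\<lambda>x. Im (k x))"
    using k by auto
  have bd: "integrable \<rho> (\<lambda>x. of_real (s x) * f x)" if s: "integrable \<rho> s" for s :: "'g \<Rightarrow> real"
    using s by (intro integrable_mult_bounded[where C = C]) (auto intro: f(2))
  have "signed_integral (\<lambda>A. Re (\<mu> A)) f = (LINT x|\<rho>. of_real (Re (k x)) * f x)"
    by (rule signed_integral_density[OF kRe sets _ f])
      (use k sets in \<open>simp add: \<mu> set_lebesgue_integral_def integral_Re[symmetric] integrable_mult_indicator\<close>)
  moreover have "signed_integral (\<lambda>A. Im (\<mu> A)) f = (LINT x|\<rho>. of_real (Im (k x)) * f x)"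
    by (rule signed_integral_density[OF kIm sets _ f])
      (use k sets in \<open>simp add: \<mu> set_lebesgue_integral_def integral_Im[symmetric] integrable_mult_indicator\<close>)
  ultimately have "complex_measure_integral \<mu> f
      = (LINT x|\<rho>. of_real (Re (k x)) * f x) + (LINT x|\<rho>. \<i> * (of_real (Im (k x)) * f x))"
    by (simp add: complex_measure_integral_def)
  also have "\<dots> = (LINT x|\<rho>. of_real (Re (k x)) * f x + \<i> * (of_real (Im (k x)) * f x))"
    using bd[OF kRe] bd[OF kIm] by simp
  also have "\<dots> = (LINT x|\<rho>. k x * f x)"
    by (intro Bochner_Integration.integral_cong) (simp_all add: complex_eq_iff algebra_simps)
  finally show ?thesis .
qed

text \<open>The four variations of the real and imaginary parts of \<open>\<mu>\<close> and the measure \<open>m\<close> are dominated by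
  their sum \<open>\<rho>\<close>, so that all of them have densities with respect to it. Referring \<open>m\<close> and \<open>\<mu>\<close> to
  the same \<open>\<rho>\<close> makes the singular part of \<open>\<mu>\<close> the restriction to the zero set of \<open>w\<close>.\<close>

lemma M_density_ex:
  fixes m :: "'g::topological_space measure"
  assumes \<mu>: "\<mu> \<in> M" and m: "finite_measure m" "sets m = sets borel"
  obtains \<rho> w k where "finite_measure \<rho>" "sets \<rho> = sets borel"
    "\<forall>x. 0 \<le> w x" "integrable \<rho> w" "m = density \<rho> (\<lambda>x. ennreal (w x))"
    "integrable \<rho> k" "\<forall>A\<in>sets borel. \<mu> A = (LINT x:A|\<rho>. k x)"
proof -
  have ch: "borel_charge \<mu>"
    using \<mu> unfolding M_def complex_borel_measure_def borel_charge_def by blast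
  define C where "C = enn2real (total_variation \<mu> UNIV)"
  have tv: "total_variation \<mu> UNIV = ennreal C"
    using \<mu> by (simp add: M_def C_def)
  have bdd: "cmod (\<mu> A) \<le> C" if A: "A \<in> sets borel" for A
  proof -
    have "(\<Sum>n\<in>{0}. ennreal (cmod (\<mu> (binaryset A (- A) n))))
        \<le> (\<Sum>n. ennreal (cmod (\<mu> (binaryset A (- A) n))))"
      by (rule sum_le_suminf) auto
    then have "ennreal (cmod (\<mu> A)) \<le> (\<Sum>n. ennreal (cmod (\<mu> (binaryset A (- A) n))))"
      by (simp add: binaryset_def)
    also have "\<dots> \<le> total_variation \<mu> UNIV"
      unfolding total_variation_def
    proof (rule SUP_upper, intro CollectI conjI)
      show "range (binaryset A (- A)) \<subseteq> sets borel"
        using A by (simp add: range_binaryset_eq)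
      show "disjoint_family (binaryset A (- A))"
        by (simp add: disjoint_family_on_def binaryset_def)
      show "(\<Union>n. binaryset A (- A) n) = UNIV" by (simp add: UN_binaryset_eq)
    qed
    finally show ?thesis unfolding tv by (simp add: ennreal_le_iff C_def)
  qed
  have chR: "borel_charge (\<lambda>A. Re (\<mu> A))" "borel_charge (\<lambda>A. Im (\<mu> A))"
    using borel_charge_bounded_linear[OF ch] bounded_linear_Re bounded_linear_Im by auto
  have chN: "borel_charge (\<lambda>A. - Re (\<mu> A))" "borel_charge (\<lambda>A. - Im (\<mu> A))"
    using chR by (auto intro: borel_charge_bounded_linear bounded_linear_minus[OF bounded_linear_ident])
  have b: "\<bar>Re (\<mu> A)\<bar> \<le> C" "\<bar>Im (\<mu> A)\<bar> \<le> C" if "A \<in> sets borel" for A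
    using bdd[OF that] abs_Re_le_cmod[of "\<mu> A"] abs_Im_le_cmod[of "\<mu> A"] by linarith+
  have b': "Re (\<mu> A) \<le> C" "- Re (\<mu> A) \<le> C" "Im (\<mu> A) \<le> C" "- Im (\<mu> A) \<le> C" if "A \<in> sets borel" for A
    using b[OF that] by linarith+
  let ?P1 = "pos_variation (\<lambda>A. Re (\<mu> A))" and ?P2 = "pos_variation (\<lambda>A. - Re (\<mu> A))"
    and ?P3 = "pos_variation (\<lambda>A. Im (\<mu> A))" and ?P4 = "pos_variation (\<lambda>A. - Im (\<mu> A))"
  have f1: "finite_measure ?P1" and f2: "finite_measure ?P2"
    and f3: "finite_measure ?P3" and f4: "finite_measure ?P4"
    using finite_measure_pos_variation[OF chR(1) b'(1)] finite_measure_pos_variation[OF chN(1) b'(2)]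
      finite_measure_pos_variation[OF chR(2) b'(3)] finite_measure_pos_variation[OF chN(2) b'(4)]
    by auto
  obtain R1 where R1: "finite_measure R1" "sets R1 = sets borel"
      "\<And>A. A \<in> sets borel \<Longrightarrow> emeasure R1 A = emeasure ?P1 A + emeasure ?P2 A"
    using finite_measure_sum_ex[OF f1 f2] by auto
  obtain R2 where R2: "finite_measure R2" "sets R2 = sets borel"
      "\<And>A. A \<in> sets borel \<Longrightarrow> emeasure R2 A = emeasure ?P3 A + emeasure ?P4 A"
    using finite_measure_sum_ex[OF f3 f4] by auto
  obtain R3 where R3: "finite_measure R3" "sets R3 = sets borel"
      "\<And>A. A \<in> sets borel \<Longrightarrow> emeasure R3 A = emeasure R1 A + emeasure R2 A"
    using finite_measure_sum_ex[OF R1(1) R2(1) R1(2) R2(2)] by auto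
  obtain \<rho> where \<rho>: "finite_measure \<rho>" "sets \<rho> = sets borel"
      "\<And>A. A \<in> sets borel \<Longrightarrow> emeasure \<rho> A = emeasure R3 A + emeasure m A"
    using finite_measure_sum_ex[OF R3(1) m(1) R3(2) m(2)] by auto
  have le: "emeasure ?P1 A \<le> emeasure \<rho> A" "emeasure ?P2 A \<le> emeasure \<rho> A"
    "emeasure ?P3 A \<le> emeasure \<rho> A" "emeasure ?P4 A \<le> emeasure \<rho> A"
    "emeasure m A \<le> emeasure \<rho> A" if "A \<in> sets \<rho>" for A
    using that \<rho>(2) R1(3) R2(3) R3(3) \<rho>(3)
    by (simp_all add: add_increasing add_increasing2)
  obtain w where w: "\<And>x. 0 \<le> w x" "integrable \<rho> w" "m = density \<rho> (\<lambda>x. ennreal (w x))"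
    using finite_measure_density_ex[OF \<rho>(1) m(1) _ le(5)] m \<rho>(2) by auto
  obtain w1 where w1: "\<And>x. 0 \<le> w1 x" "integrable \<rho> w1" "?P1 = density \<rho> (\<lambda>x. ennreal (w1 x))"
    using finite_measure_density_ex[OF \<rho>(1) f1 _ le(1)] \<rho>(2) by auto
  obtain w2 where w2: "\<And>x. 0 \<le> w2 x" "integrable \<rho> w2" "?P2 = density \<rho> (\<lambda>x. ennreal (w2 x))"
    using finite_measure_density_ex[OF \<rho>(1) f2 _ le(2)] \<rho>(2) by auto
  obtain w3 where w3: "\<And>x. 0 \<le> w3 x" "integrable \<rho> w3" "?P3 = density \<rho> (\<lambda>x. ennreal (w3 x))"
    using finite_measure_density_ex[OF \<rho>(1) f3 _ le(3)] \<rho>(2) by auto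
  obtain w4 where w4: "\<And>x. 0 \<le> w4 x" "integrable \<rho> w4" "?P4 = density \<rho> (\<lambda>x. ennreal (w4 x))"
    using finite_measure_density_ex[OF \<rho>(1) f4 _ le(4)] \<rho>(2) by auto
  define k where "k x = Complex (w1 x - w2 x) (w3 x - w4 x)" for x
  have k_eq: "k x = complex_of_real (w1 x - w2 x) + \<i> * of_real (w3 x - w4 x)" for x
    by (simp add: k_def complex_eq_iff)
  have Re_k: "Re (k x) = w1 x - w2 x" and Im_k: "Im (k x) = w3 x - w4 x" for x
    by (simp_all add: k_def)
  have ik: "integrable \<rho> k"
    unfolding k_eq using w1(2) w2(2) w3(2) w4(2)
    by (intro Bochner_Integration.integrable_add integrable_mult_right integrable_of_real
        Bochner_Integration.integrable_diff)
  have "\<mu> A = (LINT x:A|\<rho>. k x)" if A: "A \<in> sets borel" for A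
  proof -
    have A': "A \<in> sets \<rho>" using A \<rho>(2) by simp
    have "Re (\<mu> A) = (LINT x:A|\<rho>. w1 x) - (LINT x:A|\<rho>. w2 x)"
      using jordan_decomposition[OF chR(1) b(1) A] w1 w2 A'
      by (simp add: measure_density_real)
    moreover have "Im (\<mu> A) = (LINT x:A|\<rho>. w3 x) - (LINT x:A|\<rho>. w4 x)"
      using jordan_decomposition[OF chR(2) b(2) A] w3 w4 A'
      by (simp add: measure_density_real)
    moreover have "Re (LINT x:A|\<rho>. k x) = (LINT x:A|\<rho>. w1 x - w2 x)"
      "Im (LINT x:A|\<rho>. k x) = (LINT x:A|\<rho>. w3 x - w4 x)"
      using ik A' unfolding set_lebesgue_integral_def
      by (simp_all add: integral_Re[symmetric] integral_Im[symmetric] integrable_mult_indicator Re_k Im_k)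
    ultimately show ?thesis
      using w1(2) w2(2) w3(2) w4(2) A'
      by (simp add: complex_eq_iff set_integral_diff(2) set_integrable_of_integrable)
  qed
  with \<rho> w ik that show ?thesis by blast
qed

section \<open>Continuous functions and Haar measure on a compact group\<close>

lemma continuous_on_o:
  "continuous_on UNIV f \<Longrightarrow> continuous_on S h \<Longrightarrow> continuous_on S (\<lambda>x. f (h x))"
  by (rule continuous_on_compose2) auto

lemma urysohn_compact:
  fixes S T :: "'g::t2_space set"
  assumes "compact (UNIV :: 'g set)" "closed S" "closed T" "S \<inter> T = {}"
  obtains f :: "'g \<Rightarrow> real" where "continuous_on UNIV f" "\<And>x. 0 \<le> f x" "\<And>x. f x \<le> 1"
    "\<And>x. x \<in> S \<Longrightarrow> f x = 0" "\<And>x. x \<in> T \<Longrightarrow> f x = 1"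
proof -
  have "Hausdorff_space (euclidean :: 'g topology)"
    by (simp add: Hausdorff_space_def disjnt_def) (metis hausdorff)
  moreover have "compact_space (euclidean :: 'g topology)"
    using assms(1) by (simp add: compact_space_def)
  ultimately have "normal_space (euclidean :: 'g topology)"
    using compact_Hausdorff_or_regular_imp_normal_space by blast
  then obtain f :: "'g \<Rightarrow> real" where f: "continuous_map euclidean (top_of_set {0..1}) f"
      "f ` S \<subseteq> {0}" "f ` T \<subseteq> {1}"
    using Urysohn_lemma[of euclidean S T 0 1] assms by (auto simp: disjnt_def)
  have "continuous_on UNIV f" "\<And>x. f x \<in> {0..1}"
    using f(1) by (auto simp: continuous_map_in_subtopology)
  with f(2,3) that[of f] show ?thesis by (auto simp: image_subset_iff)
qed

lemma continuous_real_separates: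
  fixes x y :: "'g::t2_space"
  assumes "compact (UNIV :: 'g set)" "x \<noteq> y"
  obtains f :: "'g \<Rightarrow> real" where "continuous_on UNIV f" "f x \<noteq> f y"
proof -
  obtain f :: "'g \<Rightarrow> real" where "continuous_on UNIV f"
      "\<And>z. z \<in> {x} \<Longrightarrow> f z = 0" "\<And>z. z \<in> {y} \<Longrightarrow> f z = 1"
    by (rule urysohn_compact[OF assms(1), of "{x}" "{y}"]) (use assms in auto)
  then show ?thesis by (intro that[of f]) auto
qed

text \<open>The group need not be second countable, and then a product may have Borel sets outside the
  product of the Borel \<open>\<sigma>\<close>-algebras. Continuous functions are nevertheless measurable for the
  latter: those which are form an algebra that separates points, hence a uniformly dense one by
  the theorem of Stone and Weierstrass.\<close>

lemma continuous_on_measurable_pair_real: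
  fixes F :: "'g::t2_space \<times> 'h::t2_space \<Rightarrow> real"
  assumes c: "compact (UNIV :: 'g set)" "compact (UNIV :: 'h set)" and F: "continuous_on UNIV F"
  shows "F \<in> borel_measurable (borel \<Otimes>\<^sub>M borel)"
proof -
  let ?P = "\<lambda>f :: 'g \<times> 'h \<Rightarrow> real. continuous_on UNIV f \<and> f \<in> borel_measurable (borel \<Otimes>\<^sub>M borel)"
  have cUNIV: "compact (UNIV :: ('g \<times> 'h) set)"
    using compact_Times[OF c] by simp
  have sep: "\<exists>f. ?P f \<and> f p \<noteq> f q" if "p \<noteq> q" for p q :: "'g \<times> 'h"
  proof (cases "fst p = fst q")
    case False
    then obtain f :: "'g \<Rightarrow> real" where f: "continuous_on UNIV f" "f (fst p) \<noteq> f (fst q)"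
      using continuous_real_separates[OF c(1)] by blast
    have "(\<lambda>z. f (fst z)) \<in> borel_measurable (borel \<Otimes>\<^sub>M borel)"
      using borel_measurable_continuous_onI[OF f(1)] by measurable
    with f show ?thesis
      by (intro exI[of _ "\<lambda>z. f (fst z)"]) (auto intro!: continuous_on_compose2[OF f(1)] continuous_intros)
  next
    case True
    then have "snd p \<noteq> snd q" using that by (auto simp: prod_eq_iff)
    then obtain f :: "'h \<Rightarrow> real" where f: "continuous_on UNIV f" "f (snd p) \<noteq> f (snd q)"
      using continuous_real_separates[OF c(2)] by blast
    have "(\<lambda>z. f (snd z)) \<in> borel_measurable (borel \<Otimes>\<^sub>M borel)"
      using borel_measurable_continuous_onI[OF f(1)] by measurable
    with f show ?thesis
      by (intro exI[of _ "\<lambda>z. f (snd z)"]) (auto intro!: continuous_on_compose2[OF f(1)] continuous_intros)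
  qed
  have "\<exists>g. ?P g \<and> (\<forall>x\<in>UNIV. \<bar>F x - g x\<bar> < inverse (real (Suc n)))" for n
    by (rule Stone_Weierstrass_HOL[OF cUNIV, where P = ?P])
      (use F sep in \<open>auto intro!: continuous_intros borel_measurable_add borel_measurable_times\<close>)
  then obtain g where g: "\<And>n. ?P (g n)" "\<And>n x. \<bar>F x - g n x\<bar> < inverse (real (Suc n))"
    by (metis UNIV_I)
  show ?thesis
  proof (rule borel_measurable_LIMSEQ_real)
    show "(\<lambda>n. g n x) \<longlonglongrightarrow> F x" for x
    proof (rule LIMSEQ_I)
      fix r :: real assume "0 < r"
      then obtain N where "inverse (real (Suc N)) < r" using reals_Archimedean by blast
      then have "norm (g n x - F x) < r" if "n \<ge> N" for n
      proof -
        have "inverse (real (Suc n)) \<le> inverse (real (Suc N))"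
          using that by (intro le_imp_inverse_le) auto
        with g(2)[of x n] \<open>inverse (real (Suc N)) < r\<close>
        have "\<bar>F x - g n x\<bar> < r" by linarith
        then show ?thesis by (simp add: abs_minus_commute)
      qed
      then show "\<exists>no. \<forall>n\<ge>no. norm (g n x - F x) < r" by blast
    qed
  qed (use g in auto)
qed

lemma continuous_on_measurable_pair:
  fixes F :: "'g::t2_space \<times> 'h::t2_space \<Rightarrow> complex"
  assumes "compact (UNIV :: 'g set)" "compact (UNIV :: 'h set)" and F: "continuous_on UNIV F"
  shows "F \<in> borel_measurable (borel \<Otimes>\<^sub>M borel)"
  unfolding borel_measurable_complex_iff
  by (intro conjI continuous_on_measurable_pair_real assms continuous_intros)

lemma continuous_on_compact_bounded:
  fixes f :: "'g::topological_space \<Rightarrow> 'b::real_normed_vector"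
  assumes "compact (UNIV :: 'g set)" "continuous_on UNIV f"
  obtains B where "B > 0" "\<And>x. norm (f x) \<le> B"
proof -
  have "bounded (range f)"
    using assms compact_continuous_image compact_imp_bounded by blast
  then obtain B where "B > 0" "\<And>x. norm (f x) \<le> B"
    unfolding bounded_pos by auto
  then show ?thesis by (rule that)
qed

lemma integrable_continuous_compact:
  fixes f :: "'g::topological_space \<Rightarrow> 'b::{banach, second_countable_topology}"
  assumes "finite_measure \<rho>" "sets \<rho> = sets borel" "compact (UNIV :: 'g set)" "continuous_on UNIV f"
  shows "integrable \<rho> f"
proof -
  interpret finite_measure \<rho> by fact
  obtain B where "\<And>x. norm (f x) \<le> B"
    using continuous_on_compact_bounded[OF assms(3,4)] by blast
  moreover have "f \<in> borel_measurable \<rho>"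
    using borel_measurable_continuous_onI[OF assms(4)] measurable_cong_sets[OF assms(2) refl] by auto
  ultimately show ?thesis by (intro integrable_const_bound[where B = B]) auto
qed

lemma fubini_continuous:
  fixes F :: "'g::t2_space \<times> 'h::t2_space \<Rightarrow> complex"
  assumes "finite_measure \<rho>" "sets \<rho> = sets borel" "compact (UNIV :: 'g set)"
    and "finite_measure \<sigma>" "sets \<sigma> = sets borel" "compact (UNIV :: 'h set)"
    and F: "continuous_on UNIV F"
  shows "(\<integral>x. (\<integral>y. F (x, y) \<partial>\<sigma>) \<partial>\<rho>) = (\<integral>y. (\<integral>x. F (x, y) \<partial>\<rho>) \<partial>\<sigma>)"
proof -
  interpret \<rho>: finite_measure \<rho> by fact
  interpret \<sigma>: finite_measure \<sigma> by fact
  interpret pair_sigma_finite \<rho> \<sigma> ..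
  have "compact (UNIV :: ('g \<times> 'h) set)" using compact_Times[OF assms(3,6)] by simp
  then obtain B where "\<And>z. norm (F z) \<le> B"
    using continuous_on_compact_bounded[OF _ F] by blast
  moreover have "F \<in> borel_measurable (\<rho> \<Otimes>\<^sub>M \<sigma>)"
    using continuous_on_measurable_pair[OF assms(3,6) F]
      measurable_cong_sets[OF sets_pair_measure_cong[OF assms(2,5)] refl] by auto
  moreover have "finite_measure (\<rho> \<Otimes>\<^sub>M \<sigma>)"
    by (rule finite_measure_pair_measure) fact+
  ultimately have "integrable (\<rho> \<Otimes>\<^sub>M \<sigma>) F"
    by (intro finite_measure.integrable_const_bound[where B = B]) auto
  then show ?thesis using Fubini_integral[of "\<lambda>x y. F (x, y)"] by simp
qed

text \<open>By compactness, \<open>F (x, y)\<close> is close to \<open>F (x0, y)\<close> uniformly in \<open>y\<close> for \<open>x\<close> near \<open>x0\<close>.\<close>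

lemma continuous_on_parametric_integral:
  fixes F :: "'g::t2_space \<times> 'h::topological_space \<Rightarrow> complex"
  assumes "finite_measure \<rho>" "sets \<rho> = sets borel" "compact (UNIV :: 'h set)"
    and F: "continuous_on UNIV F"
  shows "continuous_on UNIV (\<lambda>x. \<integral>y. F (x, y) \<partial>\<rho>)"
proof -
  interpret finite_measure \<rho> by fact
  have space: "space \<rho> = UNIV" using sets_eq_imp_space_eq[OF assms(2)] by simp
  have int: "integrable \<rho> (\<lambda>y. F (x, y))" for x
    by (rule integrable_continuous_compact[OF assms(1-3)])
      (auto intro!: continuous_on_compose2[OF F] continuous_intros)
  define \<mu> where "\<mu> = measure \<rho> UNIV"
  have \<mu>: "\<mu> \<ge> 0" by (simp add: \<mu>_def)
  have "isCont (\<lambda>x. \<integral>y. F (x, y) \<partial>\<rho>) x0" for x0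
    unfolding isCont_def
  proof (rule tendstoI)
    fix e :: real assume "0 < e"
    define d where "d = e / (\<mu> + 1)"
    have d: "d > 0" using \<open>0 < e\<close> \<mu> by (simp add: d_def)
    have "continuous_on (UNIV \<times> UNIV) F" using F by simp
    then obtain X0 where X0: "x0 \<in> X0" "open X0"
      "\<forall>x\<in>X0 \<inter> UNIV. \<forall>t\<in>UNIV. dist (F (x, t)) (F (x0, t)) \<le> d"
      using continuous_on_prod_compactE[of UNIV UNIV F x0 d] assms(3) d by blast
    have "dist (\<integral>y. F (x, y) \<partial>\<rho>) (\<integral>y. F (x0, y) \<partial>\<rho>) < e" if x: "x \<in> X0" for x
    proof -
      have "dist (\<integral>y. F (x, y) \<partial>\<rho>) (\<integral>y. F (x0, y) \<partial>\<rho>) = norm (\<integral>y. F (x, y) - F (x0, y) \<partial>\<rho>)"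
        using int by (simp add: dist_norm)
      also have "\<dots> \<le> (\<integral>y. norm (F (x, y) - F (x0, y)) \<partial>\<rho>)" by (rule integral_norm_bound)
      also have "\<dots> \<le> (\<integral>y. d \<partial>\<rho>)"
        using X0(3) x int by (intro integral_mono) (auto simp: dist_norm)
      also have "\<dots> = \<mu> * d" by (simp add: \<mu>_def space)
      also have "\<dots> < (\<mu> + 1) * d" using d by (intro mult_strict_right_mono) auto
      also have "\<dots> = e" using \<mu> by (simp add: d_def)
      finally show ?thesis .
    qed
    then show "\<forall>\<^sub>F x in at x0. dist (\<integral>y. F (x, y) \<partial>\<rho>) (\<integral>y. F (x0, y) \<partial>\<rho>) < e"
      using X0(1,2) unfolding eventually_at_topological by blast
  qed
  then show ?thesis by (simp add: continuous_at_imp_continuous_on)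
qed

locale compact_haar_group =
  fixes m :: "'g::{topological_ab_group_add,t2_space} measure"
  assumes compact_UNIV: "compact (UNIV :: 'g set)" and haar: "normalized_haar m"
begin

lemma sets_m [measurable_cong]: "sets m = sets borel"
  using haar by (simp add: normalized_haar_def)

lemma space_m [simp]: "space m = UNIV"
  using sets_eq_imp_space_eq[OF sets_m] by simp

sublocale m: finite_measure m
  using haar by (intro finite_measureI) (simp add: normalized_haar_def)

lemma measure_UNIV [simp]: "measure m UNIV = 1"
  using haar by (simp add: normalized_haar_def measure_def)

abbreviation "cont \<equiv> (\<lambda>f :: 'g \<Rightarrow> complex. continuous_on UNIV f)"

lemma integrable_cont:
  fixes f :: "'g \<Rightarrow> 'b::{banach, second_countable_topology}"
  shows "continuous_on UNIV f \<Longrightarrow> integrable m f"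
  by (rule integrable_continuous_compact[OF m.finite_measure_axioms sets_m compact_UNIV])

lemma integral_translate:
  fixes f :: "'g \<Rightarrow> 'b::{banach, second_countable_topology}"
  assumes f: "continuous_on UNIV f"
  shows "(\<integral>y. f (a + y) \<partial>m) = (\<integral>y. f y \<partial>m)"
proof -
  have meas: "(\<lambda>y. a + y) \<in> borel_measurable m"
    unfolding measurable_cong_sets[OF sets_m refl]
    by (intro borel_measurable_continuous_onI continuous_intros)
  have "distr m borel (\<lambda>y. a + y) = m"
  proof (rule measure_eqI)
    fix A assume "A \<in> sets (distr m borel (\<lambda>y. a + y))"
    then have A: "A \<in> sets borel" by simp
    have "(\<lambda>y. a + y) -` A = (\<lambda>y. - a + y) ` A"
      by (auto simp: image_iff intro!: bexI[of _ "a + _"])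
    moreover have "emeasure m ((\<lambda>y. - a + y) ` A) = emeasure m A"
      using haar A unfolding normalized_haar_def by blast
    ultimately show "emeasure (distr m borel (\<lambda>y. a + y)) A = emeasure m A"
      using emeasure_distr[OF meas A] by simp
  qed (simp add: sets_m)
  then have "(\<integral>y. f y \<partial>m) = (\<integral>y. f y \<partial>distr m borel (\<lambda>y. a + y))" by simp
  also have "\<dots> = (\<integral>y. f (a + y) \<partial>m)"
    by (intro integral_distr meas borel_measurable_continuous_onI f)
  finally show ?thesis by simp
qed

lemma fubini_cont:
  fixes F :: "'g \<Rightarrow> 'g \<Rightarrow> complex"
  assumes "continuous_on UNIV (\<lambda>z. F (fst z) (snd z))"
  shows "(\<integral>x. (\<integral>y. F x y \<partial>m) \<partial>m) = (\<integral>y. (\<integral>x. F x y \<partial>m) \<partial>m)"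
  using fubini_continuous[OF m.finite_measure_axioms sets_m compact_UNIV
      m.finite_measure_axioms sets_m compact_UNIV assms] by simp

text \<open>Invariance under inversion follows from translation invariance and Fubini, both sides being equal
  to \<open>\<integral>\<integral> f (y - x) dx dy\<close>.\<close>

lemma integral_uminus:
  assumes f: "cont f"
  shows "(\<integral>x. f (- x) \<partial>m) = (\<integral>x. f x \<partial>m)"
proof -
  have "(\<integral>x. f (- x) \<partial>m) = (\<integral>y. (\<integral>x. f (- x) \<partial>m) \<partial>m)" by simp
  also have "\<dots> = (\<integral>y. (\<integral>x. f (y - x) \<partial>m) \<partial>m)"
  proof (rule Bochner_Integration.integral_cong[OF refl])
    fix y
    have "continuous_on UNIV (\<lambda>x. f (- x))"
      by (intro continuous_on_o[OF f] continuous_intros)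
    from integral_translate[OF this, of "- y"]
    show "(\<integral>x. f (- x) \<partial>m) = (\<integral>x. f (y - x) \<partial>m)" by simp
  qed
  also have "\<dots> = (\<integral>x. (\<integral>y. f (y - x) \<partial>m) \<partial>m)"
    by (intro fubini_cont continuous_on_compose2[OF f]) (auto intro!: continuous_intros)
  also have "\<dots> = (\<integral>x. (\<integral>y. f y \<partial>m) \<partial>m)"
    using integral_translate[OF f, of "- _"] by simp
  finally show ?thesis by simp
qed

lemma integral_reflect:
  assumes f: "cont f"
  shows "(\<integral>x. f (a - x) \<partial>m) = (\<integral>x. f x \<partial>m)"
proof -
  have "continuous_on UNIV (\<lambda>x. f (a + x))"
    by (intro continuous_on_o[OF f] continuous_intros)
  from integral_uminus[OF this] show ?thesis
    using integral_translate[OF f, of a] by simp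
qed

text \<open>By compactness, finitely many translates of an open null set would cover the group.\<close>

lemma emeasure_open_pos:
  assumes "open U" "U \<noteq> {}"
  shows "emeasure m U > 0"
proof (rule ccontr)
  assume "\<not> 0 < emeasure m U"
  then have 0: "emeasure m U = 0" by simp
  obtain u where u: "u \<in> U" using assms(2) by blast
  define V where "V x = (\<lambda>y. x + y) ` U" for x
  have openV: "open (V x)" for x
  proof -
    have "V x = (\<lambda>y. - x + y) -` U"
      unfolding V_def by (auto simp: image_iff intro!: bexI[of _ "- x + _"])
    then show ?thesis
      using assms(1) by (auto intro!: open_vimage continuous_intros)
  qed
  have null: "V x \<in> null_sets m" for x
  proof -
    have "emeasure m (V x) = emeasure m U"
      using haar assms(1) unfolding normalized_haar_def V_def by auto
    with 0 openV show ?thesis by (auto simp: null_sets_def sets_m)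
  qed
  have "x \<in> V (x - u)" for x unfolding V_def using u by (intro image_eqI[of _ _ u]) auto
  then have "UNIV \<subseteq> (\<Union>x\<in>UNIV. V x)" by blast
  then obtain C where "finite C" "UNIV \<subseteq> (\<Union>x\<in>C. V x)"
    using compactE_image[OF compact_UNIV, of UNIV V] openV by metis
  moreover have "(\<Union>x\<in>C. V x) \<in> null_sets m"
    using null \<open>finite C\<close> by (intro null_sets.finite_UN) auto
  moreover have "(\<Union>x\<in>C. V x) = UNIV" using \<open>UNIV \<subseteq> (\<Union>x\<in>C. V x)\<close> by (rule top_le)
  ultimately have "UNIV \<in> null_sets m" by simp
  then have "emeasure m UNIV = 0" by (simp add: null_sets_def)
  then show False using haar by (simp add: normalized_haar_def)
qed

lemma integral_norm_sq_pos:
  assumes f: "cont f" and x: "f x \<noteq> 0"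
  shows "(\<integral>x. (cmod (f x))\<^sup>2 \<partial>m) > 0"
proof -
  have c: "continuous_on UNIV (\<lambda>x. (cmod (f x))\<^sup>2)" by (intro continuous_intros f)
  have "(\<integral>x. (cmod (f x))\<^sup>2 \<partial>m) \<noteq> 0"
  proof
    assume "(\<integral>x. (cmod (f x))\<^sup>2 \<partial>m) = 0"
    then have "AE x in m. (cmod (f x))\<^sup>2 = 0"
      using integral_nonneg_eq_0_iff_AE[OF integrable_cont[OF c]] by simp
    then have "AE x in m. f x = 0" by simp
    moreover have op: "open {x. f x \<noteq> 0}"
      using f by (intro open_Collect_neq continuous_intros)
    ultimately have "emeasure m {x. f x \<noteq> 0} = 0"
      using AE_iff_measurable[of "{x. f x \<noteq> 0}" m "\<lambda>x. f x = 0"] sets_m by auto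
    with emeasure_open_pos[OF op] x show False by auto
  qed
  moreover have "(\<integral>x. (cmod (f x))\<^sup>2 \<partial>m) \<ge> 0" by simp
  ultimately show ?thesis by linarith
qed

end

section \<open>Convolution and the top idempotent of a Hermitian function\<close>

text \<open>The ratios \<open>A (i + 1) / A i\<close> increase by log-convexity and are bounded by submultiplicativity.
  Their limit \<open>L\<close> is the right rate: ratios below \<open>L\<close> make \<open>A i / L ^ (i + 1)\<close> decrease, and
  \<open>A i\<close> dominates every product of \<open>i + 1\<close> successive ratios, hence \<open>L ^ (i + 1)\<close>.\<close>

lemma log_convex_submultiplicative:
  fixes A :: "nat \<Rightarrow> real"
  assumes pos: "\<And>i. 0 < A i" and lc: "\<And>i. (A (Suc i))\<^sup>2 \<le> A i * A (Suc (Suc i))"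
    and sub: "\<And>i j. A (Suc (i + j)) \<le> A i * A j"
  obtains L where "0 < L" "decseq (\<lambda>i. A i / L ^ Suc i)" "\<And>i. 1 \<le> A i / L ^ Suc i"
proof -
  define r where "r i = A (Suc i) / A i" for i
  have rA: "A (Suc i) = r i * A i" for i using pos[of i] by (simp add: r_def)
  have r_pos: "0 < r i" for i using pos by (simp add: r_def)
  have inc: "incseq r"
  proof (rule incseq_SucI)
    fix i
    show "r i \<le> r (Suc i)"
      using lc[of i] pos[of i] pos[of "Suc i"] by (simp add: r_def field_simps power2_eq_square)
  qed
  have "r i \<le> A 0" for i
    using sub[of i 0] pos[of i] by (simp add: r_def field_simps)
  then obtain L where L: "r \<longlonglongrightarrow> L" "\<And>i. r i \<le> L"
    using incseq_convergent[OF inc, of "A 0"] by auto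
  have Lpos: "0 < L" using r_pos[of 0] L(2)[of 0] by linarith
  have "decseq (\<lambda>i. A i / L ^ Suc i)"
  proof (rule decseq_SucI)
    fix i
    have "A (Suc i) \<le> L * A i" unfolding rA using L(2)[of i] pos[of i] by (intro mult_right_mono) auto
    then show "A (Suc i) / L ^ Suc (Suc i) \<le> A i / L ^ Suc i"
      using Lpos by (simp add: field_simps)
  qed
  moreover have "1 \<le> A i / L ^ Suc i" for i
  proof -
    have *: "r j ^ Suc i * A j \<le> A (Suc (i + j))" for i j
    proof (induction i)
      case 0
      show ?case by (simp add: rA)
    next
      case (Suc i)
      have "r j ^ Suc (Suc i) * A j = r j * (r j ^ Suc i * A j)" by simp
      also have "\<dots> \<le> r (Suc (i + j)) * A (Suc (i + j))"
        using Suc incseqD[OF inc, of j "Suc (i + j)"] r_pos[of j] pos[of j]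
        by (intro mult_mono) (auto simp: less_imp_le)
      finally show ?case by (simp add: rA)
    qed
    have "r j ^ Suc i \<le> A i" for j
      using order_trans[OF *[of j i] sub[of i j]] pos[of j] by (simp add: mult_le_cancel_right)
    then have "L ^ Suc i \<le> A i"
      by (intro LIMSEQ_le_const2[OF tendsto_power[OF L(1)]]) auto
    then show ?thesis using Lpos by (simp add: field_simps)
  qed
  ultimately show ?thesis using Lpos that by blast
qed

context compact_haar_group
begin

definition conv :: "('g \<Rightarrow> complex) \<Rightarrow> ('g \<Rightarrow> complex) \<Rightarrow> 'g \<Rightarrow> complex" (infixl "\<star>" 70) where
  "f \<star> g = (\<lambda>x. \<integral>y. f (x - y) * g y \<partial>m)"

lemma cont_conv:
  assumes f: "cont f" and g: "cont g" shows "cont (f \<star> g)"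
proof -
  have "continuous_on UNIV (\<lambda>z :: 'g \<times> 'g. f (fst z - snd z) * g (snd z))"
    by (intro continuous_intros continuous_on_o[OF f] continuous_on_o[OF g])
  from continuous_on_parametric_integral[OF m.finite_measure_axioms sets_m compact_UNIV this]
  show ?thesis by (simp add: conv_def)
qed

lemma integrable_conv:
  assumes f: "cont f" and g: "cont g" shows "integrable m (\<lambda>y. f (x - y) * g y)"
  by (intro integrable_cont continuous_intros continuous_on_o[OF f] g)

lemma conv_commute:
  assumes f: "cont f" and g: "cont g" shows "f \<star> g = g \<star> f"
proof
  fix x
  have "cont (\<lambda>y. f y * g (x - y))"
    by (intro continuous_intros continuous_on_o[OF g] f)
  from integral_reflect[OF this, of x] show "(f \<star> g) x = (g \<star> f) x"
    by (simp add: conv_def mult.commute)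
qed

text \<open>Fubini, followed by the translation \<open>z \<mapsto> y + z\<close> in the inner integral.\<close>

lemma conv_assoc:
  assumes f: "cont f" and g: "cont g" and h: "cont h"
  shows "(f \<star> g) \<star> h = f \<star> (g \<star> h)"
proof
  fix x
  have "(f \<star> (g \<star> h)) x = (\<integral>z. (\<integral>y. f (x - z) * g (z - y) * h y \<partial>m) \<partial>m)"
    unfolding conv_def by (simp add: mult.assoc)
  also have "\<dots> = (\<integral>y. (\<integral>z. f (x - z) * g (z - y) * h y \<partial>m) \<partial>m)"
    by (intro fubini_cont continuous_intros continuous_on_o[OF f] continuous_on_o[OF g]
        continuous_on_o[OF h])
  also have "\<dots> = (\<integral>y. (\<integral>z. f (x - y - z) * g z * h y \<partial>m) \<partial>m)"
  proof (rule Bochner_Integration.integral_cong[OF refl])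
    fix y
    have "cont (\<lambda>z. f (x - z) * g (z - y) * h y)"
      by (intro continuous_intros continuous_on_o[OF f] continuous_on_o[OF g])
    from integral_translate[OF this, of y]
    show "(\<integral>z. f (x - z) * g (z - y) * h y \<partial>m) = (\<integral>z. f (x - y - z) * g z * h y \<partial>m)"
      by (simp only: diff_diff_eq add_diff_cancel_left')
  qed
  also have "\<dots> = ((f \<star> g) \<star> h) x"
    unfolding conv_def by simp
  finally show "((f \<star> g) \<star> h) x = (f \<star> (g \<star> h)) x" by simp
qed

lemma conv_add_left:
  assumes "cont f" "cont g" "cont h"
  shows "(\<lambda>x. f x + g x) \<star> h = (\<lambda>x. (f \<star> h) x + (g \<star> h) x)"
  using assms by (simp add: conv_def distrib_right integrable_conv)

lemma conv_scale_left: "(\<lambda>x. c * f x) \<star> h = (\<lambda>x. c * (f \<star> h) x)"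
  by (simp add: conv_def mult.assoc)

lemma conv_scale_right: "f \<star> (\<lambda>x. c * h x) = (\<lambda>x. c * (f \<star> h) x)"
  by (simp add: conv_def mult.left_commute)

lemma conv_add_right:
  assumes "cont f" "cont g" "cont h"
  shows "h \<star> (\<lambda>x. f x + g x) = (\<lambda>x. (h \<star> f) x + (h \<star> g) x)"
  using assms by (simp add: conv_def distrib_left integrable_conv)

lemma conv_diff_right:
  assumes "cont f" "cont g" "cont h"
  shows "h \<star> (\<lambda>x. f x - g x) = (\<lambda>x. (h \<star> f) x - (h \<star> g) x)"
  using assms by (simp add: conv_def right_diff_distrib integrable_conv)

lemma conv_translate_right:
  assumes "cont f" "cont g"
  shows "f \<star> (\<lambda>x. g (x + a)) = (\<lambda>x. (f \<star> g) (x + a))"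
proof -
  have c: "cont (\<lambda>x. g (x + a))" using assms(2) by (intro continuous_on_o[OF assms(2)] continuous_intros)
  have "f \<star> (\<lambda>x. g (x + a)) = (\<lambda>x. g (x + a)) \<star> f" by (rule conv_commute[OF assms(1) c])
  also have "\<dots> = (\<lambda>x. (g \<star> f) (x + a))" by (simp add: conv_def algebra_simps)
  finally show ?thesis by (simp add: conv_commute[OF assms])
qed

lemma conv_tendsto:
  assumes F: "\<And>n. cont (F n)" "\<And>n x. cmod (F n x) \<le> B" "\<And>x. (\<lambda>n. F n x) \<longlonglongrightarrow> f x" "cont f"
    and G: "\<And>n. cont (G n)" "\<And>n x. cmod (G n x) \<le> C" "\<And>x. (\<lambda>n. G n x) \<longlonglongrightarrow> g x" "cont g"
  shows "(\<lambda>n. (F n \<star> G n) x) \<longlonglongrightarrow> (f \<star> g) x"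
  unfolding conv_def
proof (rule integral_dominated_convergence[where w = "\<lambda>_. B * C"])
  have "0 \<le> B" using F(2) norm_ge_zero order_trans by blast
  then show "AE y in m. cmod (F n (x - y) * G n y) \<le> B * C" for n
    using F(2) G(2) by (simp add: norm_mult mult_mono)
  show "AE y in m. (\<lambda>n. F n (x - y) * G n y) \<longlonglongrightarrow> f (x - y) * g y"
    using F(3) G(3) by (intro AE_I2 tendsto_mult)
qed (use integrable_conv F G in auto)

definition nsq :: "('g \<Rightarrow> complex) \<Rightarrow> real" where
  "nsq f = (\<integral>x. (cmod (f x))\<^sup>2 \<partial>m)"

lemma nsq_nonneg: "0 \<le> nsq f" by (simp add: nsq_def)

lemma nsq_reflect:
  assumes f: "cont f" shows "nsq (\<lambda>y. f (x - y)) = nsq f"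
proof -
  have "cont (\<lambda>y. of_real ((cmod (f y))\<^sup>2))" by (intro continuous_intros f)
  from integral_reflect[OF this, of x]
  have "complex_of_real (nsq (\<lambda>y. f (x - y))) = of_real (nsq f)"
    unfolding nsq_def integral_complex_of_real .
  then show ?thesis by simp
qed

text \<open>The minimum of the quadratic polynomial \<open>t \<mapsto> \<integral> (t \<bar>f\<bar> - \<bar>g\<bar>)\<^sup>2\<close> is nonnegative.\<close>

lemma cauchy_schwarz_integral:
  assumes f: "cont f" and g: "cont g"
  shows "(cmod (\<integral>y. f y * g y \<partial>m))\<^sup>2 \<le> nsq f * nsq g"
proof (cases "\<exists>x. f x \<noteq> 0")
  case False
  then show ?thesis by (simp add: nsq_nonneg)
next
  case True
  then have a: "nsq f > 0" using integral_norm_sq_pos[OF f] by (auto simp: nsq_def)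
  define c where "c = (\<integral>y. cmod (f y) * cmod (g y) \<partial>m)"
  define t where "t = c / nsq f"
  have c0: "0 \<le> c" by (simp add: c_def)
  have i: "integrable m (\<lambda>y. (cmod (f y))\<^sup>2)" "integrable m (\<lambda>y. (cmod (g y))\<^sup>2)"
    "integrable m (\<lambda>y. cmod (f y) * cmod (g y))"
    by (intro integrable_cont continuous_intros f g)+
  have "0 \<le> (\<integral>y. (t * cmod (f y) - cmod (g y))\<^sup>2 \<partial>m)" by simp
  also have "(\<lambda>y. (t * cmod (f y) - cmod (g y))\<^sup>2)
      = (\<lambda>y. t\<^sup>2 * (cmod (f y))\<^sup>2 - 2 * t * (cmod (f y) * cmod (g y)) + (cmod (g y))\<^sup>2)"
    by (simp add: power2_diff power_mult_distrib algebra_simps)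
  also have "(\<integral>y. t\<^sup>2 * (cmod (f y))\<^sup>2 - 2 * t * (cmod (f y) * cmod (g y)) + (cmod (g y))\<^sup>2 \<partial>m)
      = t\<^sup>2 * nsq f - 2 * t * c + nsq g"
    using i by (simp add: nsq_def c_def)
  also have "\<dots> = nsq g - c\<^sup>2 / nsq f"
    using a by (simp add: t_def field_simps power2_eq_square)
  finally have "c\<^sup>2 \<le> nsq f * nsq g" using a by (simp add: field_simps)
  moreover have "cmod (\<integral>y. f y * g y \<partial>m) \<le> c"
    unfolding c_def norm_mult[symmetric] by (rule integral_norm_bound)
  ultimately show ?thesis using power_mono[of "cmod (\<integral>y. f y * g y \<partial>m)" c 2] by simp
qed

lemma conv_bound:
  assumes f: "cont f" and g: "cont g"
  shows "(cmod ((f \<star> g) x))\<^sup>2 \<le> nsq f * nsq g"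
proof -
  have "cont (\<lambda>y. f (x - y))" by (intro continuous_on_o[OF f] continuous_intros)
  from cauchy_schwarz_integral[OF this g] show ?thesis
    using nsq_reflect[OF f] by (simp add: conv_def)
qed

lemma nsq_conv:
  assumes f: "cont f" and g: "cont g" shows "nsq (f \<star> g) \<le> nsq f * nsq g"
proof -
  have "nsq (f \<star> g) \<le> (\<integral>x. nsq f * nsq g \<partial>m)"
    unfolding nsq_def[of "f \<star> g"]
    by (intro integral_mono conv_bound f g integrable_cont continuous_intros cont_conv)
  then show ?thesis by simp
qed

text \<open>Convolution with such a function is a self-adjoint operator on \<open>L\<^sub>2(G)\<close>.\<close>

definition herm :: "('g \<Rightarrow> complex) \<Rightarrow> bool" where
  "herm f \<longleftrightarrow> cont f \<and> (\<forall>x. f (- x) = cnj (f x))"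

lemma herm_cont: "herm f \<Longrightarrow> cont f" by (simp add: herm_def)

lemma herm_uminus: "herm f \<Longrightarrow> f (- x) = cnj (f x)" by (simp add: herm_def)

lemma herm_conv:
  assumes f: "herm f" and g: "herm g" shows "herm (f \<star> g)"
  unfolding herm_def
proof (intro conjI allI)
  show "cont (f \<star> g)" using f g by (intro cont_conv herm_cont)
  fix x
  have "cont (\<lambda>y. f (- x - y) * g y)"
    by (intro continuous_intros continuous_on_o[OF herm_cont[OF f]] herm_cont[OF g])
  from integral_uminus[OF this]
  have "(f \<star> g) (- x) = (\<integral>y. f (- (x - y)) * g (- y) \<partial>m)" by (simp add: conv_def)
  also have "\<dots> = (\<integral>y. cnj (f (x - y) * g y) \<partial>m)"
    unfolding herm_uminus[OF f] herm_uminus[OF g] by simp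
  also have "\<dots> = cnj ((f \<star> g) x)" unfolding conv_def by (rule Bochner_Integration.integral_cnj)
  finally show "(f \<star> g) (- x) = cnj ((f \<star> g) x)" .
qed

text \<open>Evaluation at 0 of a convolution square plays the role of the inner product of \<open>f\<close> with
  itself.\<close>

lemma herm_conv_0:
  assumes f: "herm f" shows "(f \<star> f) 0 = of_real (nsq f)"
proof -
  have "(f \<star> f) 0 = (\<integral>y. of_real ((cmod (f y))\<^sup>2) \<partial>m)"
    unfolding conv_def
    by (intro Bochner_Integration.integral_cong refl)
      (simp add: herm_uminus[OF f] complex_norm_square[symmetric] mult.commute del: of_real_power)
  then show ?thesis unfolding nsq_def integral_complex_of_real .
qed

text \<open>The power is shifted: \<open>cpow f n\<close> is the convolution of \<open>n + 1\<close> copies of \<open>f\<close>, as convolution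
  need not have a unit among the continuous functions.\<close>

primrec cpow :: "('g \<Rightarrow> complex) \<Rightarrow> nat \<Rightarrow> 'g \<Rightarrow> complex" where
  "cpow f 0 = f"
| "cpow f (Suc n) = f \<star> cpow f n"

lemma herm_cpow: "herm f \<Longrightarrow> herm (cpow f n)"
  by (induction n) (auto intro: herm_conv)

lemma cont_cpow: "cont f \<Longrightarrow> cont (cpow f n)"
  by (induction n) (auto intro: cont_conv)

lemma cpow_add: "cont f \<Longrightarrow> cpow f i \<star> cpow f j = cpow f (Suc (i + j))"
  by (induction i) (auto simp: conv_assoc cont_cpow)

lemma cpow_absorb: "cont u \<Longrightarrow> cont f \<Longrightarrow> u \<star> f = f \<Longrightarrow> u \<star> cpow f n = cpow f n"
  by (cases n) (auto simp: conv_assoc[symmetric] cont_cpow)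

text \<open>A substitute for the spectral theorem. Convolution with \<open>f\<close> is a compact self-adjoint operator
  \<open>T\<close>; if \<open>L\<close> is the largest eigenvalue of \<open>T\<^sup>2\<close>, then \<open>T\<^sup>2\<^sup>n / L\<^sup>n\<close> converges to the projection onto the
  corresponding eigenspace, and \<open>e\<close> is the convolution kernel of this projection. Convergence is
  shown without any operator theory. The numbers \<open>A i\<close>, the values at 0 of the even powers, are
  log-convex and submultiplicative by the inequality of Cauchy and Schwarz, hence the values
  \<open>c i\<close> of the normalized powers at 0 converge to a limit that is at least 1. Convergence at 0
  implies uniform convergence, because the squared distance of two normalized powers is bounded by
  a second difference of \<open>c\<close>. The last clause says that \<open>e\<close> stays in every ideal \<open>{f. u \<star> f = f}\<close>
  to which \<open>f\<close> belongs.\<close>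

lemma top_idempotent:
  assumes f: "herm f" and x0: "f x0 \<noteq> 0"
  obtains e L where "herm e" "e \<star> e = e" "e 0 \<noteq> 0" "L > 0"
    "f \<star> (f \<star> e) = (\<lambda>x. of_real L * e x)" "\<forall>u. cont u \<longrightarrow> u \<star> f = f \<longrightarrow> u \<star> e = e"
proof -
  have cf: "cont f" by (rule herm_cont[OF f])
  have cc: "cont (cpow f n)" for n by (rule cont_cpow[OF cf])
  define A where "A i = nsq (cpow f i)" for i
  have bound: "(cmod (cpow f (Suc (i + j)) x))\<^sup>2 \<le> A i * A j" for i j x
    unfolding A_def cpow_add[OF cf, symmetric] by (rule conv_bound[OF cc cc])
  have A_eq: "cpow f (Suc (2 * i)) 0 = of_real (A i)" for i
    using herm_conv_0[OF herm_cpow[OF f, of i]] cpow_add[OF cf, of i i]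
    by (simp add: A_def mult_2)
  have A_nn: "0 \<le> A i" for i by (simp add: A_def nsq_nonneg)
  \<comment> \<open>\<open>A (i + 1)\<close> is also the inner product of the two powers with squared norms \<open>A i\<close> and \<open>A (i + 2)\<close>.\<close>
  have lc: "(A (Suc i))\<^sup>2 \<le> A i * A (Suc (Suc i))" for i
  proof -
    have "cpow f (Suc (i + Suc (Suc i))) 0 = of_real (A (Suc i))"
      using A_eq[of "Suc i"] by (simp only: mult_2 add_Suc add_Suc_right)
    with bound[of i "Suc (Suc i)" 0] show ?thesis by (simp only: norm_of_real power2_abs)
  qed
  have sub: "A (Suc (i + j)) \<le> A i * A j" for i j
    unfolding A_def cpow_add[OF cf, symmetric] by (rule nsq_conv[OF cc cc])
  have A_pos_if: "0 < A i" if "cpow f i x \<noteq> 0" for i x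
    using integral_norm_sq_pos[OF cc that] by (simp add: A_def nsq_def)
  have A0: "0 < A 0" using x0 by (intro A_pos_if[of 0 x0]) simp
  have A1: "0 < A 1" using A0 A_eq[of 0] by (intro A_pos_if[of _ 0]) simp
  have pos2: "0 < A i \<and> 0 < A (Suc i)" for i
  proof (induction i)
    case (Suc i)
    then have "0 < A i * A (Suc (Suc i))" using lc[of i] by (auto intro: less_le_trans[of 0 "(A (Suc i))\<^sup>2"])
    with Suc show ?case by (simp add: zero_less_mult_iff)
  qed (use A0 A1 in auto)
  then have pos: "0 < A i" for i by blast
  obtain L where L: "0 < L" "decseq (\<lambda>i. A i / L ^ Suc i)" "\<And>i. 1 \<le> A i / L ^ Suc i"
    using log_convex_submultiplicative[OF pos lc sub] by blast
  define c where "c i = A i / L ^ Suc i" for i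
  obtain l where l: "c \<longlonglongrightarrow> l"
    using decseq_convergent[OF L(2), of 1] L(3) unfolding c_def by blast
  have l1: "1 \<le> l" using L(3) by (intro LIMSEQ_le_const[OF l]) (auto simp: c_def)
  define E where "E n = (\<lambda>x. of_real (1 / L ^ Suc n) * cpow f (Suc (2 * n)) x)" for n
  have cE: "cont (E n)" for n unfolding E_def by (intro continuous_intros cc)
  have E0: "E n 0 = of_real (c n)" for n unfolding E_def A_eq c_def by simp
  have E_bound: "cmod (E n x) \<le> c 0" for n x
  proof -
    have "(cmod (cpow f (Suc (2 * n)) x))\<^sup>2 \<le> (A n)\<^sup>2"
      using bound[of n n x] by (simp add: mult_2 power2_eq_square)
    then have "cmod (cpow f (Suc (2 * n)) x) \<le> A n" using A_nn by (simp add: power2_le_iff_abs_le)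
    then have "cmod (E n x) \<le> c n"
      using L(1) by (simp add: E_def c_def norm_mult norm_divide norm_power divide_right_mono)
    also have "\<dots> \<le> c 0" using decseqD[OF L(2), of 0 n] by (simp add: c_def)
    finally show ?thesis .
  qed
  have diff: "(cmod (E n x - E k x))\<^sup>2 \<le> A 0 / L * (c (2 * n) - 2 * c (n + k) + c (2 * k))" for n k x
  proof -
    define a b where "a = 1 / L ^ Suc n" and "b = 1 / L ^ Suc k"
    \<comment> \<open>One factor \<open>f\<close> is split off, so that a bound on the \<open>L\<^sub>2\<close> norm of \<open>d\<close> becomes a uniform bound
      on \<open>f \<star> d\<close>.\<close>
    define d where "d = (\<lambda>x. of_real a * cpow f (2 * n) x - of_real b * cpow f (2 * k) x)"
    have c1: "cont (\<lambda>x. of_real a * cpow f (2 * n) x)" "cont (\<lambda>x. of_real b * cpow f (2 * k) x)"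
      by (intro continuous_intros cc)+
    have hd: "herm d"
      unfolding herm_def d_def
      using herm_cpow[OF f] by (auto intro!: continuous_intros cc simp: herm_uminus)
    have cd: "cont d" by (rule herm_cont[OF hd])
    have fd: "f \<star> d = (\<lambda>x. E n x - E k x)"
      unfolding d_def conv_diff_right[OF c1 cf] conv_scale_right
      by (simp add: E_def a_def b_def)
    have cadd: "cpow f (2 * i) \<star> cpow f (2 * j) = cpow f (Suc (2 * (i + j)))" for i j
      using cpow_add[OF cf, of "2 * i" "2 * j"] by simp
    have dd: "d \<star> d = (\<lambda>x. of_real (a\<^sup>2) * cpow f (Suc (2 * (n + n))) x
        - 2 * of_real (a * b) * cpow f (Suc (2 * (n + k))) x
        + of_real (b\<^sup>2) * cpow f (Suc (2 * (k + k))) x)"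
    proof -
      have dn: "d \<star> cpow f (2 * i) = (\<lambda>x. of_real a * cpow f (Suc (2 * (n + i))) x
          - of_real b * cpow f (Suc (2 * (k + i))) x)" for i
      proof -
        have "d \<star> cpow f (2 * i) = cpow f (2 * i) \<star> d" by (rule conv_commute[OF cd cc])
        also have "\<dots> = (\<lambda>x. of_real a * cpow f (Suc (2 * (i + n))) x
            - of_real b * cpow f (Suc (2 * (i + k))) x)"
          unfolding d_def conv_diff_right[OF c1 cc] conv_scale_right cadd ..
        finally show ?thesis by (simp add: add.commute)
      qed
      have "d \<star> d = (\<lambda>x. of_real a * (d \<star> cpow f (2 * n)) x - of_real b * (d \<star> cpow f (2 * k)) x)"
        by (subst (2) d_def) (simp only: conv_diff_right[OF c1 cd] conv_scale_right)
      then show ?thesis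
        unfolding dn by (simp add: algebra_simps power2_eq_square add.commute)
    qed
    have "complex_of_real (nsq d) = of_real ((c (2 * n) - 2 * c (n + k) + c (2 * k)) / L)"
    proof -
      have "complex_of_real (nsq d) = (d \<star> d) 0" by (rule herm_conv_0[OF hd, symmetric])
      also have "\<dots> = of_real (a\<^sup>2 * A (n + n) - 2 * (a * b) * A (n + k) + b\<^sup>2 * A (k + k))"
        unfolding dd A_eq by simp
      also have "a\<^sup>2 * A (n + n) - 2 * (a * b) * A (n + k) + b\<^sup>2 * A (k + k)
          = (c (2 * n) - 2 * c (n + k) + c (2 * k)) / L"
      proof -
        have "a\<^sup>2 * A (n + n) = c (2 * n) / L" "b\<^sup>2 * A (k + k) = c (2 * k) / L"
          "a * b * A (n + k) = c (n + k) / L"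
          unfolding mult_2
          by (simp_all add: a_def b_def c_def power_add power2_eq_square mult_ac)
        then show ?thesis by (simp add: diff_divide_distrib add_divide_distrib mult.assoc)
      qed
      finally show ?thesis .
    qed
    then have "nsq d = (c (2 * n) - 2 * c (n + k) + c (2 * k)) / L" by (simp only: of_real_eq_iff)
    moreover have "(cmod ((f \<star> d) x))\<^sup>2 \<le> A 0 * nsq d"
      using conv_bound[OF cf cd, of x] by (simp add: A_def)
    ultimately show ?thesis unfolding fd by simp
  qed
  have "uniformly_Cauchy_on UNIV E"
  proof (rule uniformly_Cauchy_onI)
    fix r :: real assume r: "0 < r"
    \<comment> \<open>Chosen so that \<open>A 0 / L * (4 * s) < r\<^sup>2\<close>, where \<open>4 * s\<close> bounds a second difference of
      numbers within \<open>s\<close> of \<open>l\<close>.\<close>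
    define s where "s = r\<^sup>2 * L / (4 * A 0 + 4)"
    have s: "0 < s" using r L(1) A0 by (simp add: s_def)
    obtain N where N: "\<And>n. n \<ge> N \<Longrightarrow> \<bar>c n - l\<bar> < s"
      using LIMSEQ_D[OF l s] by (auto simp: real_norm_def)
    have "dist (E n x) (E k x) < r" if "n \<ge> N" "k \<ge> N" for n k x
    proof -
      have "c (2 * n) - 2 * c (n + k) + c (2 * k) \<le> 4 * s"
        using N[of "2 * n"] N[of "n + k"] N[of "2 * k"] that by linarith
      then have "A 0 / L * (c (2 * n) - 2 * c (n + k) + c (2 * k)) \<le> A 0 / L * (4 * s)"
        using A0 L(1) by (intro mult_left_mono) auto
      with diff[of n x k] have "(cmod (E n x - E k x))\<^sup>2 \<le> A 0 / L * (4 * s)" by linarith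
      also have "\<dots> = r\<^sup>2 * (A 0 / (A 0 + 1))"
        using L(1) A0 by (simp add: s_def field_simps)
      also have "\<dots> < r\<^sup>2 * 1" using A0 r by (intro mult_strict_left_mono) (auto simp: field_simps)
      finally show ?thesis using r by (simp add: dist_norm power2_less_imp_less)
    qed
    then show "\<exists>N. \<forall>x\<in>UNIV. \<forall>n\<ge>N. \<forall>k\<ge>N. dist (E n x) (E k x) < r" by blast
  qed
  then have "uniformly_convergent_on UNIV E" by (rule Cauchy_uniformly_convergent)
  then obtain e where e: "uniform_limit UNIV E e sequentially"
    unfolding uniformly_convergent_on_def by blast
  have ce: "cont e"
    using uniform_limit_theorem[OF _ e] cE by simp
  have lim: "(\<lambda>n. E n x) \<longlonglongrightarrow> e x" for x
    using tendsto_uniform_limitI[OF e] by simp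
  have limS: "(\<lambda>n. E (g n) x) \<longlonglongrightarrow> e x" if "strict_mono g" for g x
    using LIMSEQ_subseq_LIMSEQ[OF lim that] by (simp add: o_def)
  have e0: "e 0 = of_real l"
    using lim[of 0] l unfolding E0 by (metis LIMSEQ_unique tendsto_of_real)
  have EE: "E n \<star> E n = E (Suc (2 * n))" for n
    unfolding E_def conv_scale_left conv_scale_right cpow_add[OF cf] mult_2
    by (simp add: power_add mult_ac)
  have fE: "f \<star> (f \<star> E n) = (\<lambda>x. of_real L * E (Suc n) x)" for n
    using L(1) unfolding E_def conv_scale_right mult_2 by simp
  have bdd: "(\<lambda>n. (u \<star> E n) x) \<longlonglongrightarrow> (u \<star> e) x" if u: "cont u" for u x
  proof -
    obtain B where "\<And>x. cmod (u x) \<le> B" using continuous_on_compact_bounded[OF compact_UNIV u] by blast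
    then show ?thesis
      by (intro conv_tendsto[where F = "\<lambda>_. u" and B = B and C = "c 0"]) (auto simp: u cE E_bound lim ce)
  qed
  show ?thesis
  proof (rule that)
    have "e (- x) = cnj (e x)" for x
    proof -
      have "(\<lambda>n. E n (- x)) = (\<lambda>n. cnj (E n x))"
        unfolding E_def herm_uminus[OF herm_cpow[OF f]] by simp
      with lim[of "- x"] tendsto_cnj[OF lim[of x]] show ?thesis by (metis LIMSEQ_unique)
    qed
    then show "herm e" using ce by (simp add: herm_def)
    show "e \<star> e = e"
    proof
      fix x
      have "(\<lambda>n. (E n \<star> E n) x) \<longlonglongrightarrow> (e \<star> e) x"
        by (rule conv_tendsto[where B = "c 0" and C = "c 0"]) (auto simp: cE E_bound lim ce)
      moreover have "(\<lambda>n. (E n \<star> E n) x) \<longlonglongrightarrow> e x"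
        unfolding EE by (rule limS) (auto simp: strict_mono_def)
      ultimately show "(e \<star> e) x = e x" by (rule LIMSEQ_unique)
    qed
    show "e 0 \<noteq> 0" using e0 l1 by auto
    show "L > 0" by (rule L(1))
    show "f \<star> (f \<star> e) = (\<lambda>x. of_real L * e x)"
    proof
      fix x
      have "(\<lambda>n. ((f \<star> f) \<star> E n) x) \<longlonglongrightarrow> ((f \<star> f) \<star> e) x"
        by (intro bdd cont_conv cf)
      then have "(\<lambda>n. (f \<star> (f \<star> E n)) x) \<longlonglongrightarrow> (f \<star> (f \<star> e)) x"
        by (simp add: conv_assoc cf cE ce)
      moreover have "(\<lambda>n. (f \<star> (f \<star> E n)) x) \<longlonglongrightarrow> of_real L * e x"
        unfolding fE by (intro tendsto_intros limS) (auto simp: strict_mono_def)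
      ultimately show "(f \<star> (f \<star> e)) x = of_real L * e x" by (rule LIMSEQ_unique)
    qed
    show "\<forall>u. cont u \<longrightarrow> u \<star> f = f \<longrightarrow> u \<star> e = e"
    proof (intro allI impI)
      fix u assume u: "cont u" "u \<star> f = f"
      have uE: "u \<star> E n = E n" for n
        unfolding E_def conv_scale_right cpow_absorb[OF u(1) cf u(2)] ..
      show "u \<star> e = e"
      proof
        fix x
        have "(\<lambda>n. E n x) \<longlonglongrightarrow> (u \<star> e) x" using bdd[OF u(1), of x] unfolding uE .
        then show "(u \<star> e) x = e x" using lim by (rule LIMSEQ_unique)
      qed
    qed
  qed
qed

end

section \<open>Characters separate points\<close>

lemma characters_cont: "\<gamma> \<in> characters \<Longrightarrow> continuous_on UNIV \<gamma>"
  by (simp add: characters_def)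

lemma characters_norm: "\<gamma> \<in> characters \<Longrightarrow> cmod (\<gamma> x) = 1"
  by (simp add: characters_def)

lemma characters_add: "\<gamma> \<in> characters \<Longrightarrow> \<gamma> (x + y) = \<gamma> x * \<gamma> y"
  by (simp add: characters_def)

lemma characters_nonzero: "\<gamma> \<in> characters \<Longrightarrow> \<gamma> x \<noteq> 0"
  using characters_norm[of \<gamma> x] by auto

lemma characters_0: assumes "\<gamma> \<in> characters" shows "\<gamma> 0 = 1"
  using characters_add[OF assms, of 0 0] characters_nonzero[OF assms, of 0] by simp

lemma characters_uminus: assumes \<gamma>: "\<gamma> \<in> characters" shows "\<gamma> (- x) = cnj (\<gamma> x)"
proof -
  have "\<gamma> x * \<gamma> (- x) = 1" using characters_add[OF \<gamma>, of x "- x"] characters_0[OF \<gamma>] by simp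
  moreover have "\<gamma> x * cnj (\<gamma> x) = 1"
    using characters_norm[OF \<gamma>, of x] complex_norm_square[of "\<gamma> x"] by simp
  ultimately have "\<gamma> x * \<gamma> (- x) = \<gamma> x * cnj (\<gamma> x)" by simp
  then show ?thesis using characters_nonzero[OF \<gamma>, of x] by simp
qed

lemma characters_diff: "\<gamma> \<in> characters \<Longrightarrow> \<gamma> (x - y) = \<gamma> x * cnj (\<gamma> y)"
  using characters_add[of \<gamma> x "- y"] by (simp add: characters_uminus)

lemma characters_one: "(\<lambda>_. 1) \<in> characters"
  by (simp add: characters_def)

lemma characters_mult: "\<gamma> \<in> characters \<Longrightarrow> \<eta> \<in> characters \<Longrightarrow> (\<lambda>x. \<gamma> x * \<eta> x) \<in> characters"
  by (auto simp: characters_def norm_mult intro!: continuous_intros)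

lemma characters_cnj: "\<gamma> \<in> characters \<Longrightarrow> (\<lambda>x. cnj (\<gamma> x)) \<in> characters"
  by (auto simp: characters_def intro!: continuous_intros)

context compact_haar_group
begin

definition idem :: "('g \<Rightarrow> complex) \<Rightarrow> bool" where
  "idem e \<longleftrightarrow> herm e \<and> e \<star> e = e \<and> (\<exists>x. e x \<noteq> 0)"

text \<open>Minimal for the order in which \<open>f\<close> lies below \<open>e\<close> if \<open>e \<star> f = f\<close>, the inclusion of the ranges
  of the corresponding projections.\<close>

definition minimal_idem :: "('g \<Rightarrow> complex) \<Rightarrow> bool" where
  "minimal_idem e \<longleftrightarrow> idem e \<and> (\<forall>f. idem f \<longrightarrow> e \<star> f = f \<longrightarrow> f = e)"

text \<open>The value at 0 is the dimension of the range of the corresponding projection; that it is at least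
  1 makes descending chains of idempotents stop.\<close>

lemma idem_0: assumes "idem e" shows "e 0 = of_real (nsq e)" "1 \<le> nsq e"
proof -
  have c: "cont e" using assms by (simp add: idem_def herm_cont)
  show "e 0 = of_real (nsq e)"
    using herm_conv_0[of e] assms by (simp add: idem_def)
  have "nsq e > 0" using integral_norm_sq_pos[OF c] assms by (auto simp: idem_def nsq_def)
  moreover have "nsq e \<le> nsq e * nsq e" using nsq_conv[OF c c] assms by (simp add: idem_def)
  ultimately show "1 \<le> nsq e" by (simp add: mult_le_cancel_left1)
qed

text \<open>If \<open>f\<close> lies strictly below \<open>e\<close>, then \<open>e - f\<close> is again an idempotent, so that the value at 0
  drops by at least 1 when passing from \<open>e\<close> to \<open>f\<close>.\<close>

lemma minimal_idem_exists: "idem e \<Longrightarrow> \<exists>f. minimal_idem f \<and> e \<star> f = f"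
proof (induction "nat \<lfloor>nsq e\<rfloor>" arbitrary: e rule: less_induct)
  case (less e)
  note e = \<open>idem e\<close>
  show ?case
  proof (cases "minimal_idem e")
    case True
    then show ?thesis using e by (auto simp: idem_def)
  next
    case False
    then obtain f where f: "idem f" "e \<star> f = f" "f \<noteq> e"
      using e by (auto simp: minimal_idem_def)
    define d where "d = (\<lambda>x. e x - f x)"
    have he: "herm e" "herm f" using e f by (auto simp: idem_def)
    note c = he[THEN herm_cont]
    have hd: "herm d" using he by (auto simp: herm_def d_def intro!: continuous_intros)
    note cd = herm_cont[OF hd]
    have "e \<star> d = d"
      using e f(2) by (simp add: d_def conv_diff_right[OF c c(1)] idem_def)
    moreover have "f \<star> d = (\<lambda>_. 0)"
      using f conv_commute[OF c] by (simp add: d_def conv_diff_right[OF c c(2)] idem_def)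
    moreover have "d \<star> d = (\<lambda>x. (d \<star> e) x - (d \<star> f) x)"
      by (subst (2) d_def) (rule conv_diff_right[OF c cd])
    ultimately have "d \<star> d = d"
      using conv_commute[OF c(1) cd] conv_commute[OF c(2) cd] by simp
    moreover have "\<exists>x. d x \<noteq> 0" using f(3) by (auto simp: d_def)
    ultimately have d: "idem d" using hd by (simp add: idem_def)
    have "e 0 = f 0 + d 0" by (simp add: d_def)
    then have "complex_of_real (nsq e) = of_real (nsq f + nsq d)"
      using idem_0(1)[OF e] idem_0(1)[OF f(1)] idem_0(1)[OF d] by simp
    then have "nsq e = nsq f + nsq d" by (simp only: of_real_eq_iff)
    then have "nsq f + 1 \<le> nsq e" "1 \<le> nsq f" using idem_0(2)[OF d] idem_0(2)[OF f(1)] by auto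
    then have "nat \<lfloor>nsq f\<rfloor> < nat \<lfloor>nsq e\<rfloor>" by linarith
    then obtain g where g: "minimal_idem g" "f \<star> g = g"
      using less.hyps f(1) by blast
    have "cont g" using g by (simp add: minimal_idem_def idem_def herm_cont)
    then have "e \<star> g = g" using conv_assoc[OF c] f(2) g(2) by metis
    with g show ?thesis by blast
  qed
qed

text \<open>For Hermitian \<open>g\<close> below \<open>e\<close>, the top idempotent of \<open>g\<close> lies below \<open>e\<close> and therefore equals \<open>e\<close>,
  so that \<open>g \<star> g\<close> is a multiple of \<open>e\<close>. Applying this to \<open>f\<close> and to \<open>f + e\<close> and polarizing gives
  the claim for \<open>f\<close> itself.\<close>

lemma minimal_idem_scalar:
  assumes e: "minimal_idem e" and f: "herm f" "e \<star> f = f"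
  obtains c where "f = (\<lambda>x. c * e x)"
proof -
  have he: "herm e" "e \<star> e = e" using e by (auto simp: minimal_idem_def idem_def)
  note ce = herm_cont[OF he(1)] and cf = herm_cont[OF f(1)]
  have sq: "\<exists>c. g \<star> g = (\<lambda>x. c * e x)" if g: "herm g" "e \<star> g = g" for g
  proof (cases "\<exists>x. g x \<noteq> 0")
    case False
    then have "g = (\<lambda>_. 0)" by auto
    then show ?thesis by (intro exI[of _ 0]) (simp add: conv_def)
  next
    case True
    then obtain x0 where x0: "g x0 \<noteq> 0" by blast
    obtain i L where i: "herm i" "i \<star> i = i" "i 0 \<noteq> 0" "0 < L"
      "g \<star> (g \<star> i) = (\<lambda>x. of_real L * i x)" "\<forall>u. cont u \<longrightarrow> u \<star> g = g \<longrightarrow> u \<star> i = i"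
      using top_idempotent[OF g(1) x0] by blast
    have "e \<star> i = i" using i(6) ce g(2) by blast
    moreover have "idem i" using i by (auto simp: idem_def)
    ultimately have "i = e" using e by (simp add: minimal_idem_def)
    moreover have "g \<star> e = g" using conv_commute[OF ce herm_cont[OF g(1)]] g(2) by simp
    ultimately show ?thesis using i(5) by auto
  qed
  define s where "s = (\<lambda>x. f x + e x)"
  have cs: "cont s" unfolding s_def by (intro continuous_intros ce cf)
  have "herm s" using he(1) f(1) cs by (simp add: herm_def s_def)
  moreover have "e \<star> s = s" unfolding s_def conv_add_right[OF cf ce ce] f(2) he(2) ..
  ultimately obtain c' where c': "s \<star> s = (\<lambda>x. c' * e x)" using sq by blast
  obtain c where c: "f \<star> f = (\<lambda>x. c * e x)" using sq f by blast
  have fe: "f \<star> e = f" using conv_commute[OF ce cf] f(2) by simp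
  have "s \<star> s = (\<lambda>x. (s \<star> f) x + (s \<star> e) x)"
    by (subst (2) s_def) (rule conv_add_right[OF cf ce cs])
  also have "s \<star> f = (\<lambda>x. (f \<star> f) x + (e \<star> f) x)" unfolding s_def by (rule conv_add_left[OF cf ce cf])
  also have "s \<star> e = (\<lambda>x. (f \<star> e) x + (e \<star> e) x)" unfolding s_def by (rule conv_add_left[OF cf ce ce])
  finally have "c' * e x = c * e x + f x + (f x + e x)" for x
    unfolding c' c f(2) fe he(2) by meson
  then have "f x = (c' - c - 1) / 2 * e x" for x by (simp add: field_simps)
  then show ?thesis using that by blast
qed

text \<open>The translates of \<open>e\<close> lie below \<open>e\<close>. They are not Hermitian, but they are linear combinations of
  the Hermitian functions \<open>e (x + a) + e (x - a)\<close> and \<open>i (e (x + a) - e (x - a))\<close>, which are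
  multiples of \<open>e\<close>. So translation multiplies \<open>e\<close> by a scalar, and \<open>e / e 0\<close> is multiplicative.\<close>

lemma minimal_idem_character:
  assumes e: "minimal_idem e"
  obtains \<gamma> c where "\<gamma> \<in> characters" "c \<noteq> 0" "e = (\<lambda>x. c * \<gamma> x)"
proof -
  have i: "idem e" using e by (simp add: minimal_idem_def)
  have he: "herm e" "e \<star> e = e" using i by (auto simp: idem_def)
  note ce = herm_cont[OF he(1)]
  have e0: "e 0 \<noteq> 0" using idem_0[OF i] by auto
  have tr: "cont (\<lambda>x. e (x + a))" for a by (intro continuous_on_o[OF ce] continuous_intros)
  have etr: "e \<star> (\<lambda>x. e (x + a)) = (\<lambda>x. e (x + a))" for a
    using conv_translate_right[OF ce ce] he(2) by simp
  have mult: "e (x + a) * e 0 = e x * e a" for x a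
  proof -
    define u where "u = (\<lambda>x. e (x + a) + e (x + - a))"
    define v where "v = (\<lambda>x. \<i> * e (x + a) + (- \<i>) * e (x + - a))"
    have neg: "e (- x + a) = cnj (e (x + - a))" "e (- x + - a) = cnj (e (x + a))" for x
      using herm_uminus[OF he(1), of "x + - a"] herm_uminus[OF he(1), of "x + a"]
      by (simp_all add: add.commute)
    have cu: "cont u" "cont v" unfolding u_def v_def by (intro continuous_intros tr)+
    have "herm u" using cu neg unfolding herm_def by (simp add: u_def)
    moreover have "e \<star> u = u"
      unfolding u_def conv_add_right[OF tr tr ce] etr ..
    ultimately obtain c1 where c1: "u = (\<lambda>x. c1 * e x)" using minimal_idem_scalar[OF e] by blast
    have "herm v" using cu neg unfolding herm_def by (simp add: v_def)
    moreover have "e \<star> v = v"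
    proof -
      have "cont (\<lambda>x. \<i> * e (x + a))" "cont (\<lambda>x. - \<i> * e (x + - a))"
        by (intro continuous_intros tr)+
      from conv_add_right[OF this ce] show ?thesis unfolding v_def conv_scale_right etr .
    qed
    ultimately obtain c2 where c2: "v = (\<lambda>x. c2 * e x)" using minimal_idem_scalar[OF e] by blast
    define \<kappa> where "\<kappa> = (c1 - \<i> * c2) / 2"
    have "e (y + a) = \<kappa> * e y" for y
    proof -
      have "2 * e (y + a) = u y - \<i> * v y" by (simp add: u_def v_def algebra_simps)
      also have "\<dots> = 2 * (\<kappa> * e y)" by (simp add: c1 c2 \<kappa>_def algebra_simps)
      finally show ?thesis by simp
    qed
    from this[of x] this[of 0] show ?thesis by simp
  qed
  define \<gamma> where "\<gamma> x = e x / e 0" for x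
  have \<gamma>_add: "\<gamma> (x + y) = \<gamma> x * \<gamma> y" for x y
    using mult[of x y] e0 by (simp add: \<gamma>_def field_simps)
  have le: "cmod (\<gamma> x) \<le> 1" for x
  proof -
    have "(cmod (e x))\<^sup>2 \<le> (nsq e)\<^sup>2"
      using conv_bound[OF ce ce, of x] he(2) by (simp add: power2_eq_square)
    then have "cmod (e x) \<le> nsq e" using nsq_nonneg[of e] by (simp add: power2_le_iff_abs_le)
    then show ?thesis using idem_0[OF i] by (simp add: \<gamma>_def norm_divide)
  qed
  have "cmod (\<gamma> x) = 1" for x
  proof -
    have "\<gamma> x * \<gamma> (- x) = 1" using \<gamma>_add[of x "- x"] e0 by (simp add: \<gamma>_def)
    then have "cmod (\<gamma> x) * cmod (\<gamma> (- x)) = 1" by (metis norm_mult norm_one)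
    moreover have "cmod (\<gamma> x) * cmod (\<gamma> (- x)) \<le> cmod (\<gamma> x) * 1"
      by (intro mult_left_mono le) auto
    ultimately show ?thesis using le[of x] by simp
  qed
  moreover have "cont \<gamma>" unfolding \<gamma>_def by (intro continuous_intros ce) (use e0 in auto)
  ultimately have "\<gamma> \<in> characters" using \<gamma>_add by (simp add: characters_def)
  moreover have "e = (\<lambda>x. e 0 * \<gamma> x)" using e0 by (simp add: \<gamma>_def)
  ultimately show ?thesis using that e0 by blast
qed

lemma conv_character:
  assumes "cont f" "\<gamma> \<in> characters"
  shows "f \<star> \<gamma> = (\<lambda>x. (\<integral>y. f y * cnj (\<gamma> y) \<partial>m) * \<gamma> x)"
  unfolding conv_commute[OF assms(1) characters_cont[OF assms(2)]]
  by (simp add: conv_def characters_diff[OF assms(2)] ac_simps)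

text \<open>A minimal idempotent below the top idempotent of \<open>f\<close> is a multiple of a character \<open>\<gamma>\<close>, and
  convolving twice with \<open>f\<close> multiplies \<open>\<gamma>\<close> by \<open>L > 0\<close>, the square of the Fourier coefficient.\<close>

lemma fourier_nonzero_herm:
  assumes f: "herm f" "f x \<noteq> 0"
  shows "\<exists>\<gamma>\<in>characters. (\<integral>y. f y * cnj (\<gamma> y) \<partial>m) \<noteq> 0"
proof -
  have cf: "cont f" by (rule herm_cont[OF f(1)])
  obtain i L where i: "herm i" "i \<star> i = i" "i 0 \<noteq> 0" "0 < L"
      "f \<star> (f \<star> i) = (\<lambda>x. of_real L * i x)"
    using top_idempotent[OF f] by blast
  have ci: "cont i" by (rule herm_cont[OF i(1)])
  have "idem i" using i by (auto simp: idem_def)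
  then obtain e where e: "minimal_idem e" "i \<star> e = e" using minimal_idem_exists by blast
  have ce: "cont e" using e by (simp add: minimal_idem_def idem_def herm_cont)
  have "f \<star> (f \<star> e) = (f \<star> (f \<star> i)) \<star> e"
    using e(2) by (simp add: conv_assoc cf ci ce cont_conv)
  then have ffe: "f \<star> (f \<star> e) = (\<lambda>x. of_real L * e x)"
    unfolding i(5) conv_scale_left e(2) .
  obtain \<gamma> c where \<gamma>: "\<gamma> \<in> characters" "c \<noteq> 0" "e = (\<lambda>x. c * \<gamma> x)"
    using minimal_idem_character[OF e(1)] by blast
  define z where "z = (\<integral>y. f y * cnj (\<gamma> y) \<partial>m)"
  have "f \<star> (f \<star> e) = (\<lambda>x. c * (z * (z * \<gamma> x)))"
    unfolding \<gamma>(3) conv_scale_right conv_character[OF cf \<gamma>(1)] z_def ..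
  from fun_cong[OF this, of 0] fun_cong[OF ffe, of 0] have "z \<noteq> 0"
    using \<gamma>(2,3) i(4) characters_0[OF \<gamma>(1)] by auto
  with \<gamma>(1) show ?thesis by (auto simp: z_def)
qed

text \<open>Reduction to the Hermitian function \<open>f \<star> f'\<close> with \<open>f' x = cnj (f (- x))\<close>, whose value at 0 is the
  squared norm of \<open>f\<close>.\<close>

lemma fourier_nonzero:
  assumes f: "cont f" "f x \<noteq> 0"
  shows "\<exists>\<gamma>\<in>characters. (\<integral>y. f y * cnj (\<gamma> y) \<partial>m) \<noteq> 0"
proof -
  define f' where "f' = (\<lambda>x. cnj (f (- x)))"
  have cf': "cont f'" unfolding f'_def by (intro continuous_intros continuous_on_o[OF f(1)])
  have "(f \<star> f') (- x) = cnj ((f \<star> f') x)" for x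
  proof -
    have c: "cont (\<lambda>y. f (y - x) * cnj (f y))"
      by (intro continuous_intros continuous_on_o[OF f(1)] f(1))
    have "(f \<star> f') (- x) = (\<integral>y. f (y - x) * cnj (f y) \<partial>m)"
    proof -
      have "cont (\<lambda>y. f (- x - y) * f' y)"
        by (intro continuous_intros continuous_on_o[OF f(1)] cf')
      from integral_uminus[OF this] show ?thesis by (simp add: conv_def f'_def)
    qed
    also have "\<dots> = (\<integral>y. cnj (f (x - y) * f' y) \<partial>m)"
      using integral_reflect[OF c, of x] by (simp add: f'_def mult.commute)
    also have "\<dots> = cnj ((f \<star> f') x)"
      unfolding conv_def by (rule Bochner_Integration.integral_cnj)
    finally show ?thesis .
  qed
  then have h: "herm (f \<star> f')" using cont_conv[OF f(1) cf'] by (simp add: herm_def)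
  have "(f \<star> f') 0 = (\<integral>y. of_real ((cmod (f (0 - y)))\<^sup>2) \<partial>m)"
    by (simp add: conv_def f'_def complex_norm_square del: of_real_power)
  also have "\<dots> = of_real (nsq (\<lambda>y. f (0 - y)))" unfolding nsq_def integral_complex_of_real ..
  also have "\<dots> = of_real (nsq f)" by (simp only: nsq_reflect[OF f(1)])
  finally have "(f \<star> f') 0 \<noteq> 0" using integral_norm_sq_pos[of f x] f by (simp add: nsq_def)
  from fourier_nonzero_herm[OF h this] obtain \<gamma> where
    \<gamma>: "\<gamma> \<in> characters" "(\<integral>y. (f \<star> f') y * cnj (\<gamma> y) \<partial>m) \<noteq> 0" by blast
  have cc: "cont \<gamma>" by (rule characters_cont[OF \<gamma>(1)])
  have "(f \<star> f') \<star> \<gamma> = f \<star> (f' \<star> \<gamma>)" by (rule conv_assoc[OF f(1) cf' cc])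
  from fun_cong[OF this, of 0]
  have "(\<integral>y. (f \<star> f') y * cnj (\<gamma> y) \<partial>m)
      = (\<integral>y. f' y * cnj (\<gamma> y) \<partial>m) * (\<integral>y. f y * cnj (\<gamma> y) \<partial>m)"
    unfolding conv_character[OF cf' \<gamma>(1)] conv_character[OF cont_conv[OF f(1) cf'] \<gamma>(1)]
      conv_scale_right conv_character[OF f(1) \<gamma>(1)] characters_0[OF \<gamma>(1)] by simp
  with \<gamma> show ?thesis by auto
qed

text \<open>If all characters took the value 1 at \<open>a\<close>, then a continuous function and its translate
  by \<open>a\<close> would have the same Fourier coefficients.\<close>

lemma characters_separate:
  fixes a :: 'g
  assumes "a \<noteq> 0" shows "\<exists>\<gamma>\<in>characters. \<gamma> a \<noteq> 1"
proof (rule ccontr)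
  assume "\<not> ?thesis"
  then have 1: "\<gamma> a = 1" if "\<gamma> \<in> characters" for \<gamma> using that by blast
  obtain f :: "'g \<Rightarrow> real" where f: "continuous_on UNIV f" "f 0 \<noteq> f a"
    using continuous_real_separates[OF compact_UNIV] assms by metis
  define F where "F x = complex_of_real (f x)" for x
  have F: "cont F" unfolding F_def by (intro continuous_intros f)
  define g where "g x = F x - F (a + x)" for x
  have g: "cont g" unfolding g_def by (intro continuous_intros F continuous_on_o[OF F])
  have "g 0 \<noteq> 0" using f(2) by (simp add: g_def F_def)
  then obtain \<gamma> where \<gamma>: "\<gamma> \<in> characters" "(\<integral>y. g y * cnj (\<gamma> y) \<partial>m) \<noteq> 0"
    using fourier_nonzero[OF g] by blast
  have c: "cont (\<lambda>y. F y * cnj (\<gamma> y))"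
    by (intro continuous_intros F characters_cont[OF \<gamma>(1)])
  have c2: "cont (\<lambda>y. F (a + y) * cnj (\<gamma> y))"
    by (intro continuous_intros continuous_on_o[OF F] characters_cont[OF \<gamma>(1)])
  have "(\<integral>y. F y * cnj (\<gamma> y) \<partial>m) = (\<integral>y. F (a + y) * cnj (\<gamma> (a + y)) \<partial>m)"
    using integral_translate[OF c, of a] by simp
  then have "(\<integral>y. F y * cnj (\<gamma> y) \<partial>m) = (\<integral>y. F (a + y) * cnj (\<gamma> y) \<partial>m)"
    by (simp add: characters_add[OF \<gamma>(1)] 1[OF \<gamma>(1)])
  then have "(\<integral>y. g y * cnj (\<gamma> y) \<partial>m) = 0"
    unfolding g_def left_diff_distrib
    by (subst Bochner_Integration.integral_diff) (auto intro: integrable_cont c c2)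
  with \<gamma>(2) show False by simp
qed

lemma integral_character:
  assumes \<gamma>: "\<gamma> \<in> characters" "\<gamma> \<noteq> (\<lambda>_. 1)" shows "(\<integral>x. \<gamma> x \<partial>m) = 0"
proof -
  obtain a where a: "\<gamma> a \<noteq> 1" using \<gamma>(2) by auto
  have "(\<integral>x. \<gamma> x \<partial>m) = \<gamma> a * (\<integral>x. \<gamma> x \<partial>m)"
    using integral_translate[OF characters_cont[OF \<gamma>(1)], of a] by (simp add: characters_add[OF \<gamma>(1)])
  then show ?thesis using a by (metis mult_cancel_right1)
qed

end

text \<open>Trigonometric polynomials with frequencies in a set \<open>S\<close> of characters.\<close>

inductive_set trig :: "('g \<Rightarrow> complex) set \<Rightarrow> ('g \<Rightarrow> complex) set" for S where
  char: "\<gamma> \<in> S \<Longrightarrow> (\<lambda>x. c * \<gamma> x) \<in> trig S"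
| add: "P \<in> trig S \<Longrightarrow> Q \<in> trig S \<Longrightarrow> (\<lambda>x. P x + Q x) \<in> trig S"

lemma trig_cont:
  "P \<in> trig S \<Longrightarrow> (\<And>\<gamma>. \<gamma> \<in> S \<Longrightarrow> continuous_on UNIV \<gamma>) \<Longrightarrow> continuous_on UNIV P"
  by (induction rule: trig.induct) (auto intro!: continuous_intros)

lemma trig_mult:
  assumes "P \<in> trig S" "Q \<in> trig T" "\<And>\<gamma> \<eta>. \<gamma> \<in> S \<Longrightarrow> \<eta> \<in> T \<Longrightarrow> (\<lambda>x. \<gamma> x * \<eta> x) \<in> U"
  shows "(\<lambda>x. P x * Q x) \<in> trig U"
  using assms(1)
proof (induction rule: trig.induct)
  case (char \<gamma> c)
  show ?case using assms(2)
  proof (induction rule: trig.induct)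
    case (char \<eta> d)
    show ?case
      using trig.char[OF assms(3)[OF \<open>\<gamma> \<in> S\<close> \<open>\<eta> \<in> T\<close>], of "c * d"] by (simp add: ac_simps)
  next
    case (add P Q)
    then show ?case using trig.add[of "\<lambda>x. c * \<gamma> x * P x" U "\<lambda>x. c * \<gamma> x * Q x"]
      by (simp add: distrib_left)
  qed
next
  case (add P P')
  then show ?case using trig.add[of "\<lambda>x. P x * Q x" U "\<lambda>x. P' x * Q x"]
    by (simp add: distrib_right)
qed

lemma trig_scale: "P \<in> trig S \<Longrightarrow> (\<lambda>x. c * P x) \<in> trig S"
proof (induction rule: trig.induct)
  case (char \<gamma> d)
  then show ?case using trig.char[of \<gamma> S "c * d"] by (simp add: mult.assoc)
next
  case (add P Q)
  then show ?case using trig.add[of "\<lambda>x. c * P x" S "\<lambda>x. c * Q x"] by (simp add: distrib_left)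
qed

lemma trig_cnj:
  "P \<in> trig S \<Longrightarrow> (\<And>\<gamma>. \<gamma> \<in> S \<Longrightarrow> (\<lambda>x. cnj (\<gamma> x)) \<in> S) \<Longrightarrow> (\<lambda>x. cnj (P x)) \<in> trig S"
proof (induction rule: trig.induct)
  case (char \<gamma> c)
  then show ?case using trig.char[of "\<lambda>x. cnj (\<gamma> x)" S "cnj c"] by simp
next
  case (add P Q)
  then show ?case using trig.add[of "\<lambda>x. cnj (P x)" S "\<lambda>x. cnj (Q x)"] by simp
qed

context compact_haar_group
begin

lemma trig_dense:
  fixes v :: "'g \<Rightarrow> real"
  assumes v: "continuous_on UNIV v" and "\<epsilon> > 0"
  obtains Q where "Q \<in> trig characters" "\<And>x. \<bar>v x - Re (Q x)\<bar> < \<epsilon>"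
proof -
  let ?P = "\<lambda>f :: 'g \<Rightarrow> real. \<exists>Q\<in>trig characters. f = (\<lambda>x. Re (Q x))"
  have "\<exists>g. ?P g \<and> (\<forall>x\<in>UNIV. \<bar>v x - g x\<bar> < \<epsilon>)"
  proof (rule Stone_Weierstrass_HOL[OF compact_UNIV, where P = ?P])
    show "?P (\<lambda>x. c)" for c
      using trig.char[OF characters_one, of "of_real c"] by (intro bexI) auto
    show "continuous_on UNIV f" if "?P f" for f
      using that trig_cont[of _ characters] characters_cont by (auto intro!: continuous_intros)
    show "?P (\<lambda>x. f x + g x)" if fg: "?P f \<and> ?P g" for f g
    proof -
      obtain P Q where "P \<in> trig characters" "Q \<in> trig characters" "f = (\<lambda>x. Re (P x))" "g = (\<lambda>x. Re (Q x))"
        using fg by blast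
      then show ?thesis by (intro bexI[of _ "\<lambda>x. P x + Q x"]) (auto intro: trig.add)
    qed
    show "?P (\<lambda>x. f x * g x)" if fg: "?P f \<and> ?P g" for f g
    proof -
      obtain P Q where PQ: "P \<in> trig characters" "Q \<in> trig characters" "f = (\<lambda>x. Re (P x))" "g = (\<lambda>x. Re (Q x))"
        using fg by blast
      have "(\<lambda>x. (1 / 2) * (P x * Q x)) \<in> trig characters"
        "(\<lambda>x. (1 / 2) * (P x * cnj (Q x))) \<in> trig characters"
        by (intro trig_scale trig_mult[of _ characters _ characters] trig_cnj PQ
            characters_mult characters_cnj; assumption)+
      from trig.add[OF this] show ?thesis
        by (rule rev_bexI) (simp add: PQ(3,4) field_simps)
    qed
    show "\<exists>f. ?P f \<and> f x \<noteq> f y" if xy: "x \<in> UNIV \<and> y \<in> UNIV \<and> x \<noteq> y" for x y :: 'g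
    proof -
      obtain \<gamma> where \<gamma>: "\<gamma> \<in> characters" "\<gamma> (x - y) \<noteq> 1"
        using characters_separate[of "x - y"] xy by auto
      have "\<gamma> x \<noteq> \<gamma> y"
      proof
        assume "\<gamma> x = \<gamma> y"
        then have "\<gamma> (x - y) = \<gamma> y * cnj (\<gamma> y)" by (simp add: characters_diff[OF \<gamma>(1)])
        also have "\<dots> = 1" using characters_norm[OF \<gamma>(1), of y] complex_norm_square[of "\<gamma> y"] by simp
        finally show False using \<gamma>(2) by simp
      qed
      then consider "Re (\<gamma> x) \<noteq> Re (\<gamma> y)" | "Re (- \<i> * \<gamma> x) \<noteq> Re (- \<i> * \<gamma> y)"
        by (auto simp: complex_eq_iff)
      then obtain c where c: "Re (c * \<gamma> x) \<noteq> Re (c * \<gamma> y)"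
      proof cases
        case 1
        then show ?thesis using that[of 1] by simp
      next
        case 2
        then show ?thesis by (rule that)
      qed
      have "?P (\<lambda>x. Re (c * \<gamma> x))" by (rule bexI[OF refl trig.char[OF \<gamma>(1)]])
      with c show ?thesis by (intro exI[of _ "\<lambda>x. Re (c * \<gamma> x)"] conjI)
    qed
  qed (use v \<open>\<epsilon> > 0\<close> in auto)
  then show ?thesis using that by auto
qed

end

section \<open>Frequencies of characters and analytic trigonometric polynomials\<close>

text \<open>Averaging the functional equation over an interval on which \<open>\<phi>\<close> has nonzero integral \<open>c\<close> expresses
  \<open>\<phi>\<close> by its antiderivative \<open>\<Phi>\<close>, so that \<open>\<phi>\<close> is differentiable. The equation then becomes
  \<open>\<phi>' = d \<phi>\<close>, and \<open>d\<close> is imaginary because \<open>\<phi>\<close> is unimodular.\<close>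

lemma continuous_character_real:
  fixes \<phi> :: "real \<Rightarrow> complex"
  assumes cont: "continuous_on UNIV \<phi>" and add: "\<And>s t. \<phi> (s + t) = \<phi> s * \<phi> t"
    and norm: "\<And>t. cmod (\<phi> t) = 1"
  obtains l where "\<And>t. \<phi> t = exp (- (\<i> * of_real (l * t)))"
proof -
  have nz: "\<phi> t \<noteq> 0" for t using norm[of t] by auto
  have \<phi>0: "\<phi> 0 = 1" using add[of 0 0] nz[of 0] by simp
  define \<Phi> where "\<Phi> u = integral {-1..u} \<phi>" for u
  have \<Phi>': "(\<Phi> has_vector_derivative \<phi> u) (at u)" if "-1 < u" for u
  proof -
    have "(\<Phi> has_vector_derivative \<phi> u) (at u within {-1..u+1})"
      unfolding \<Phi>_def using that
      by (intro integral_has_vector_derivative continuous_on_subset[OF cont]) auto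
    moreover have "at u within {-1..u+1} = at u"
      using that by (intro at_within_interior) auto
    ultimately show ?thesis by simp
  qed
  have "\<exists>a>0. \<Phi> a \<noteq> \<Phi> 0"
  proof (rule ccontr)
    assume "\<not> ?thesis"
    then have eq: "\<Phi> 0 = \<Phi> y" if "y \<in> {0<..}" for y using that by auto
    have "((\<lambda>_. \<Phi> 0) has_vector_derivative 0) (at (1::real))" by simp
    then have "(\<Phi> has_vector_derivative 0) (at 1)"
      by (rule has_vector_derivative_transform_within_open[where S = "{0<..}"]) (auto intro: eq)
    moreover have "(\<Phi> has_vector_derivative \<phi> 1) (at 1)" by (rule \<Phi>') simp
    ultimately show False using vector_derivative_unique_at nz by metis
  qed
  then obtain a where a: "0 < a" "\<Phi> a \<noteq> \<Phi> 0" by blast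
  define c where "c = \<Phi> a - \<Phi> 0"
  have c: "c \<noteq> 0" using a by (simp add: c_def)
  have \<phi>_eq: "(\<Phi> (t + a) - \<Phi> t) / c = \<phi> t" if "t \<in> {-1<..}" for t
  proof -
    have int: "\<phi> integrable_on {x..y}" for x y
      by (intro integrable_continuous_real continuous_on_subset[OF cont]) auto
    have diff: "\<Phi> (s + a) - \<Phi> s = integral {s..s + a} \<phi>" if "-1 < s" for s
      unfolding \<Phi>_def using Henstock_Kurzweil_Integration.integral_combine[of "-1" s "s + a" \<phi>] int that a(1)
      by (simp add: algebra_simps)
    have "\<Phi> (t + a) - \<Phi> t = integral {t..t + a} \<phi>" using that by (intro diff) simp
    also have "\<dots> = integral {0..a} (\<phi> \<circ> (+) t)"
      using integral_shift_Icc_real[of 0 a \<phi> t] by (simp add: add.commute)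
    also have "\<phi> \<circ> (+) t = (\<lambda>s. \<phi> t * \<phi> s)" by (auto simp: add)
    also have "integral {0..a} (\<lambda>s. \<phi> t * \<phi> s) = \<phi> t * integral {0..a} \<phi>" by simp
    also have "integral {0..a} \<phi> = c" using diff[of 0] by (simp add: c_def)
    finally show ?thesis using c by simp
  qed
  define d where "d = (\<phi> a - \<phi> 0) / c"
  have d0: "(\<phi> has_vector_derivative d) (at 0)"
  proof (rule has_vector_derivative_transform_within_open[where S = "{-1<..}"])
    have sh: "((\<lambda>t. \<Phi> (t + a)) has_vector_derivative \<phi> a) (at 0)"
    proof -
      have "((\<lambda>t. t + a) has_vector_derivative 1) (at 0)"
        by (auto intro!: derivative_eq_intros)
      moreover have "(\<Phi> has_vector_derivative \<phi> a) (at (0 + a))" using \<Phi>'[of a] a by simp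
      ultimately have "(\<Phi> \<circ> (\<lambda>t. t + a) has_vector_derivative 1 *\<^sub>R \<phi> a) (at 0)"
        by (rule vector_diff_chain_at)
      then show ?thesis by (simp add: o_def)
    qed
    have "((\<lambda>t. \<Phi> (t + a) - \<Phi> t) has_vector_derivative \<phi> a - \<phi> 0) (at 0)"
      using sh \<Phi>'[of 0] by (intro has_vector_derivative_diff) auto
    then show "((\<lambda>t. (\<Phi> (t + a) - \<Phi> t) / c) has_vector_derivative d) (at 0)"
      unfolding d_def by (rule has_vector_derivative_divide)
  qed (auto intro: \<phi>_eq)
  have d: "(\<phi> has_vector_derivative \<phi> t * d) (at t)" for t
  proof -
    have "((\<lambda>s. s - t) has_vector_derivative 1) (at t)" by (auto intro!: derivative_eq_intros)
    moreover have "(\<phi> has_vector_derivative d) (at (t - t))" using d0 by simp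
    ultimately have "(\<phi> \<circ> (\<lambda>s. s - t) has_vector_derivative 1 *\<^sub>R d) (at t)"
      by (rule vector_diff_chain_at)
    then have "((\<lambda>s. \<phi> t * \<phi> (s - t)) has_vector_derivative \<phi> t * d) (at t)"
      by (intro has_vector_derivative_mult_right) (simp add: o_def)
    then show ?thesis by (simp add: add[symmetric])
  qed
  have e: "((\<lambda>t. exp (- d * of_real t)) has_vector_derivative exp (- d * of_real t) * (- d)) (at t)" for t
    by (rule has_vector_derivative_real_field) (auto intro!: derivative_eq_intros)
  have "((\<lambda>t. \<phi> t * exp (- d * of_real t)) has_vector_derivative 0) (at t within UNIV)" for t
    using has_vector_derivative_mult[OF d[of t] e[of t]] by (simp add: algebra_simps)
  then obtain k where k: "\<And>t. \<phi> t * exp (- d * of_real t) = k"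
    using has_vector_derivative_zero_constant[of UNIV "\<lambda>t. \<phi> t * exp (- d * of_real t)"] by auto
  have "k = 1" using k[of 0] \<phi>0 by simp
  then have \<phi>: "\<phi> t = exp (d * of_real t)" for t
    using k[of t] by (simp add: exp_minus field_simps)
  have "exp (Re d) = 1" using norm[of 1] by (simp add: \<phi>)
  then have "Re d = 0" by simp
  then have "d = \<i> * of_real (Im d)" by (simp add: complex_eq_iff)
  then have "\<phi> t = exp (- (\<i> * of_real ((- Im d) * t)))" for t
    unfolding \<phi> by (metis mult.assoc mult_minus_left mult_minus_right of_real_minus of_real_mult minus_minus)
  then show ?thesis by (rule that)
qed

lemma exp_frequency_unique:
  assumes "\<And>t. exp (- (\<i> * complex_of_real (l * t))) = exp (- (\<i> * of_real (l' * t)))"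
  shows "l = l'"
proof (rule ccontr)
  assume ne: "l \<noteq> l'"
  define t where "t = pi / (l - l')"
  have "exp (- (\<i> * of_real (l * t))) * exp (\<i> * of_real (l' * t)) = 1"
    unfolding assms by (simp add: exp_minus field_simps)
  then have "exp (- (\<i> * of_real ((l - l') * t))) = 1"
    by (simp add: exp_add[symmetric] algebra_simps)
  moreover have "(l - l') * t = pi" using ne by (simp add: t_def)
  ultimately show False by (simp add: exp_minus)
qed

lemma extends_exp_char: "extends_exp \<beta> l \<gamma> \<Longrightarrow> \<gamma> \<in> characters"
  by (simp add: extends_exp_def)

lemma extends_exp_freq_unique: "extends_exp \<beta> l \<gamma> \<Longrightarrow> extends_exp \<beta> l' \<gamma> \<Longrightarrow> l = l'"
  by (rule exp_frequency_unique) (metis extends_exp_def)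

lemma extends_exp_one: "extends_exp \<beta> 0 (\<lambda>_. 1)"
  by (simp add: extends_exp_def characters_one)

lemma extends_exp_mult:
  "extends_exp \<beta> l \<gamma> \<Longrightarrow> extends_exp \<beta> l' \<eta> \<Longrightarrow> extends_exp \<beta> (l + l') (\<lambda>x. \<gamma> x * \<eta> x)"
  by (auto simp: extends_exp_def characters_mult exp_add[symmetric] algebra_simps)

lemma extends_exp_cnj: "extends_exp \<beta> l \<gamma> \<Longrightarrow> extends_exp \<beta> (- l) (\<lambda>x. cnj (\<gamma> x))"
  by (auto simp: extends_exp_def characters_cnj exp_cnj)

locale compact_flow = compact_haar_group m
  for m :: "'g::{topological_ab_group_add,t2_space} measure" +
  fixes \<beta> :: "real \<Rightarrow> 'g"
  assumes dirichlet: "dirichlet_group \<beta>"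
begin

lemma extends_exp_ex:
  assumes \<gamma>: "\<gamma> \<in> characters" obtains l where "extends_exp \<beta> l \<gamma>"
proof -
  have c: "continuous_on UNIV \<beta>" using dirichlet by (simp add: dirichlet_group_def)
  obtain l where "\<And>t. \<gamma> (\<beta> t) = exp (- (\<i> * of_real (l * t)))"
  proof (rule continuous_character_real[of "\<lambda>t. \<gamma> (\<beta> t)"])
    show "continuous_on UNIV (\<lambda>t. \<gamma> (\<beta> t))"
      by (intro continuous_on_o[OF characters_cont[OF \<gamma>]] c)
    show "\<gamma> (\<beta> (s + t)) = \<gamma> (\<beta> s) * \<gamma> (\<beta> t)" for s t
      using dirichlet by (simp add: dirichlet_group_def characters_add[OF \<gamma>])
  qed (auto simp: characters_norm[OF \<gamma>])
  then show ?thesis using \<gamma> that by (auto simp: extends_exp_def)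
qed

text \<open>A character is determined by its restriction to the dense subgroup \<open>range \<beta>\<close>.\<close>

lemma extends_exp_unique:
  assumes "extends_exp \<beta> l \<gamma>" "extends_exp \<beta> l \<eta>" shows "\<gamma> = \<eta>"
proof
  fix x
  have "closed {x. \<gamma> x = \<eta> x}"
    using assms by (intro closed_Collect_eq) (auto intro: characters_cont extends_exp_char)
  moreover have "range \<beta> \<subseteq> {x. \<gamma> x = \<eta> x}" using assms by (auto simp: extends_exp_def)
  ultimately have "closure (range \<beta>) \<subseteq> {x. \<gamma> x = \<eta> x}" by (rule closure_minimal[rotated])
  then show "\<gamma> x = \<eta> x" using dirichlet by (auto simp: dirichlet_group_def)
qed

lemma h_char_eq: "extends_exp \<beta> l \<gamma> \<Longrightarrow> h_char \<beta> l = \<gamma>"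
  unfolding h_char_def using extends_exp_unique by (intro the_equality)

definition nonneg :: "('g \<Rightarrow> complex) set" where
  "nonneg = {\<gamma>. \<exists>l\<ge>0. extends_exp \<beta> l \<gamma>}"

lemma nonneg_cont: "\<gamma> \<in> nonneg \<Longrightarrow> continuous_on UNIV \<gamma>"
  by (auto simp: nonneg_def intro: characters_cont extends_exp_char)

lemma nonneg_one: "(\<lambda>_. 1) \<in> nonneg"
  using extends_exp_one by (auto simp: nonneg_def)

lemma nonneg_mult: "\<gamma> \<in> nonneg \<Longrightarrow> \<eta> \<in> nonneg \<Longrightarrow> (\<lambda>x. \<gamma> x * \<eta> x) \<in> nonneg"
  unfolding nonneg_def using extends_exp_mult add_nonneg_nonneg by blast

lemma trig_nonneg_cont: "P \<in> trig nonneg \<Longrightarrow> cont P"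
  using trig_cont nonneg_cont by blast

lemma trig_nonneg_const: "(\<lambda>_. c) \<in> trig nonneg"
  using trig.char[OF nonneg_one, of c] by simp

lemma trig_nonneg_power: "P \<in> trig nonneg \<Longrightarrow> (\<lambda>x. P x ^ n) \<in> trig nonneg"
proof (induction n)
  case 0
  show ?case using trig_nonneg_const[of 1] by simp
next
  case (Suc n)
  then show ?case by (auto intro: trig_mult[OF _ _ nonneg_mult])
qed

text \<open>A term of negative frequency may be replaced by its complex conjugate, which has the same real
  part.\<close>

lemma analytic_completion:
  assumes "Q \<in> trig characters"
  shows "\<exists>P\<in>trig nonneg. \<forall>x. Re (P x) = Re (Q x)"
  using assms
proof (induction rule: trig.induct)
  case (char \<gamma> c)
  obtain l where l: "extends_exp \<beta> l \<gamma>" using extends_exp_ex[OF char] by blast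
  show ?case
  proof (cases "l \<ge> 0")
    case True
    then have "\<gamma> \<in> nonneg" using l by (auto simp: nonneg_def)
    then show ?thesis by (intro bexI[OF _ trig.char]) auto
  next
    case False
    then have "(\<lambda>x. cnj (\<gamma> x)) \<in> nonneg" using extends_exp_cnj[OF l]
      unfolding nonneg_def by (intro CollectI exI[of _ "- l"]) auto
    then have "(\<lambda>x. cnj c * cnj (\<gamma> x)) \<in> trig nonneg" by (rule trig.char)
    then show ?thesis by (rule rev_bexI) simp
  qed
next
  case (add P Q)
  then obtain P' Q' where "P' \<in> trig nonneg" "Q' \<in> trig nonneg"
    "\<forall>x. Re (P' x) = Re (P x)" "\<forall>x. Re (Q' x) = Re (Q x)" by blast
  then show ?case by (intro bexI[OF _ trig.add[of P' _ Q']]) auto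
qed

text \<open>Nonnegative frequencies add up to 0 only if both are 0, so the mean of a product of two nontrivial
  characters of this kind is 0, like the means of the factors.\<close>

lemma integral_nonneg_mult_char:
  assumes "\<gamma> \<in> nonneg" "\<eta> \<in> nonneg"
  shows "(\<integral>x. \<gamma> x * \<eta> x \<partial>m) = (\<integral>x. \<gamma> x \<partial>m) * (\<integral>x. \<eta> x \<partial>m)"
proof -
  obtain l l' where l: "l \<ge> 0" "extends_exp \<beta> l \<gamma>" "l' \<ge> 0" "extends_exp \<beta> l' \<eta>"
    using assms by (auto simp: nonneg_def)
  consider "\<gamma> = (\<lambda>_. 1)" | "\<eta> = (\<lambda>_. 1)" | "\<gamma> \<noteq> (\<lambda>_. 1)" "\<eta> \<noteq> (\<lambda>_. 1)" by blast
  then show ?thesis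
  proof cases
    case 3
    have "(\<lambda>x. \<gamma> x * \<eta> x) \<noteq> (\<lambda>_. 1)"
    proof
      assume "(\<lambda>x. \<gamma> x * \<eta> x) = (\<lambda>_. 1)"
      then have "l + l' = 0"
        using extends_exp_freq_unique[OF extends_exp_mult[OF l(2,4)]] extends_exp_one by auto
      then have "l = 0" using l by linarith
      then show False using 3(1) extends_exp_unique[OF l(2)] extends_exp_one by blast
    qed
    then have "(\<integral>x. \<gamma> x * \<eta> x \<partial>m) = 0"
      using extends_exp_mult[OF l(2,4)] by (intro integral_character) (auto intro: extends_exp_char)
    moreover have "(\<integral>x. \<gamma> x \<partial>m) = 0"
      using 3(1) l(2) by (intro integral_character) (auto intro: extends_exp_char)
    ultimately show ?thesis by simp
  qed auto
qed

lemma integral_trig_nonneg_mult: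
  assumes "P \<in> trig nonneg" "Q \<in> trig nonneg"
  shows "(\<integral>x. P x * Q x \<partial>m) = (\<integral>x. P x \<partial>m) * (\<integral>x. Q x \<partial>m)"
  using assms(1)
proof (induction rule: trig.induct)
  case (char \<gamma> c)
  show ?case using assms(2)
  proof (induction rule: trig.induct)
    case (char \<eta> d)
    have "(\<integral>x. c * \<gamma> x * (d * \<eta> x) \<partial>m) = (\<integral>x. (c * d) * (\<gamma> x * \<eta> x) \<partial>m)"
      by (simp add: ac_simps)
    then show ?case using integral_nonneg_mult_char[OF \<open>\<gamma> \<in> nonneg\<close> \<open>\<eta> \<in> nonneg\<close>] by simp
  next
    case (add P Q)
    have i: "integrable m P" "integrable m Q" "integrable m (\<lambda>x. c * \<gamma> x * P x)"
      "integrable m (\<lambda>x. c * \<gamma> x * Q x)"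
      using add.hyps \<open>\<gamma> \<in> nonneg\<close>
      by (auto intro!: integrable_cont continuous_intros intro: trig_nonneg_cont nonneg_cont)
    show ?case using i add.IH by (simp add: distrib_left)
  qed
next
  case (add P P')
  have i: "integrable m P" "integrable m P'" "integrable m (\<lambda>x. P x * Q x)"
    "integrable m (\<lambda>x. P' x * Q x)"
    using add.hyps assms(2)
    by (auto intro!: integrable_cont continuous_intros intro: trig_nonneg_cont)
  show ?case using i add.IH by (simp add: distrib_right)
qed

lemma integral_trig_nonneg_power:
  assumes "P \<in> trig nonneg"
  shows "(\<integral>x. P x ^ n \<partial>m) = (\<integral>x. P x \<partial>m) ^ n"
  by (induction n)
    (simp_all add: integral_trig_nonneg_mult[OF assms trig_nonneg_power[OF assms]])

end

text \<open>Integration of the exponential series, dominated by \<open>\<bar>k\<bar> exp B\<close> for a bound \<open>B\<close> of \<open>\<bar>P\<bar>\<close>.\<close>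

lemma integral_exp_sums:
  fixes P :: "'g::topological_space \<Rightarrow> complex"
  assumes sets: "sets \<rho> = sets borel" and k: "integrable \<rho> k"
    and P: "continuous_on UNIV P" and c: "compact (UNIV :: 'g set)"
  shows "(\<lambda>n. (\<integral>x. k x * P x ^ n \<partial>\<rho>) / fact n) sums (\<integral>x. k x * exp (P x) \<partial>\<rho>)"
proof -
  obtain B where B: "\<And>x. cmod (P x) \<le> B"
    using continuous_on_compact_bounded[OF c P] by blast
  have B0: "0 \<le> B" using B norm_ge_zero order_trans by blast
  have [measurable]: "P \<in> borel_measurable \<rho>" "k \<in> borel_measurable \<rho>"
    using borel_measurable_continuous_onI[OF P] measurable_cong_sets[OF sets refl] k by auto
  have i: "integrable \<rho> (\<lambda>x. k x * P x ^ n)" for n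
    using B by (intro integrable_mult_bounded[where C = "B ^ n"] k)
      (auto simp: norm_power power_mono)
  have "(\<lambda>N. \<integral>x. (\<Sum>n<N. k x * (P x ^ n /\<^sub>R fact n)) \<partial>\<rho>) \<longlonglongrightarrow> (\<integral>x. k x * exp (P x) \<partial>\<rho>)"
  proof (rule integral_dominated_convergence[where w = "\<lambda>x. cmod (k x) * exp B"])
    show "AE x in \<rho>. (\<lambda>N. \<Sum>n<N. k x * (P x ^ n /\<^sub>R fact n)) \<longlonglongrightarrow> k x * exp (P x)"
      using sums_mult[OF exp_converges] by (intro AE_I2) (simp add: sums_def)
    show "AE x in \<rho>. cmod (\<Sum>n<N. k x * (P x ^ n /\<^sub>R fact n)) \<le> cmod (k x) * exp B" for N
    proof (intro AE_I2)
      fix x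
      have "cmod (\<Sum>n<N. k x * (P x ^ n /\<^sub>R fact n)) \<le> (\<Sum>n<N. cmod (k x * (P x ^ n /\<^sub>R fact n)))"
        by (rule norm_sum)
      also have "\<dots> \<le> (\<Sum>n<N. cmod (k x) * (B ^ n /\<^sub>R fact n))"
        using B by (intro sum_mono) (simp add: norm_mult norm_power mult_left_mono power_mono divide_right_mono divide_inverse mult_right_mono)
      also have "\<dots> = cmod (k x) * (\<Sum>n<N. B ^ n /\<^sub>R fact n)" by (simp add: sum_distrib_left)
      also have "\<dots> \<le> cmod (k x) * exp B"
        using B0 sum_le_suminf[of "\<lambda>n. B ^ n /\<^sub>R fact n" "{..<N}"] exp_converges[of B]
        by (intro mult_left_mono) (auto simp: sums_iff)
      finally show "cmod (\<Sum>n<N. k x * (P x ^ n /\<^sub>R fact n)) \<le> cmod (k x) * exp B" .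
    qed
  qed (use k in auto)
  moreover have "(\<integral>x. (\<Sum>n<N. k x * (P x ^ n /\<^sub>R fact n)) \<partial>\<rho>)
      = (\<Sum>n<N. (\<integral>x. k x * P x ^ n \<partial>\<rho>) / fact n)" for N
  proof -
    have "(\<integral>x. (\<Sum>n<N. k x * (P x ^ n /\<^sub>R fact n)) \<partial>\<rho>) = (\<integral>x. (\<Sum>n<N. (k x * P x ^ n) / fact n) \<partial>\<rho>)"
      by (simp add: scaleR_conv_of_real divide_inverse ac_simps)
    then show ?thesis using i by simp
  qed
  ultimately show ?thesis by (simp add: sums_def)
qed

section \<open>Uniqueness of Fourier coefficients and the singular part of an analytic measure\<close>

lemma compact_borel: "compact K \<Longrightarrow> (K :: 'g::t2_space set) \<in> sets borel"
  by (intro borel_closed compact_imp_closed)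

lemma inner_approx:
  fixes \<kappa> :: "'g::t2_space measure"
  assumes \<kappa>: "finite_measure \<kappa>" and inner: "emeasure \<kappa> A = (SUP K\<in>{K. compact K \<and> K \<subseteq> A}. emeasure \<kappa> K)"
    and e: "0 < e"
  obtains K where "compact K" "K \<subseteq> A" "measure \<kappa> A - e < measure \<kappa> K"
proof (cases "measure \<kappa> A - e < 0")
  case True
  then show ?thesis by (intro that[of "{}"]) auto
next
  case False
  interpret finite_measure \<kappa> by fact
  have "ennreal (measure \<kappa> A - e) < emeasure \<kappa> A"
    unfolding emeasure_eq_measure using False e by (intro ennreal_lessI) auto
  then obtain K where K: "compact K" "K \<subseteq> A" "ennreal (measure \<kappa> A - e) < emeasure \<kappa> K"
    unfolding inner less_SUP_iff by blast
  then have "measure \<kappa> A - e < measure \<kappa> K"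
    unfolding emeasure_eq_measure using False by (simp add: ennreal_less_iff)
  with K that show ?thesis by blast
qed

text \<open>Finite unions of compact sets that exhaust \<open>A\<close> up to \<open>1 / (n + 1)\<close>.\<close>

lemma inner_sequence:
  fixes \<kappa> :: "'g::t2_space measure"
  assumes \<kappa>: "finite_measure \<kappa>" "sets \<kappa> = sets borel"
    and A: "A \<in> sets borel"
    and inner: "emeasure \<kappa> A = (SUP K\<in>{K. compact K \<and> K \<subseteq> A}. emeasure \<kappa> K)"
  obtains K :: "nat \<Rightarrow> 'g set" where "incseq K" "\<And>n. compact (K n)" "\<And>n. K n \<subseteq> A"
    "emeasure \<kappa> (A - (\<Union>n. K n)) = 0"
proof -
  interpret finite_measure \<kappa> by fact
  have "\<exists>K. compact K \<and> K \<subseteq> A \<and> measure \<kappa> A - inverse (real (Suc n)) < measure \<kappa> K" for n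
    using inner_approx[OF \<kappa>(1) inner, of "inverse (real (Suc n))"] by auto
  then obtain H where H: "\<And>n. compact (H n)" "\<And>n. H n \<subseteq> A"
    "\<And>n. measure \<kappa> A - inverse (real (Suc n)) < measure \<kappa> (H n)" by metis
  define K where "K n = (\<Union>i\<le>n. H i)" for n
  have b: "H n \<in> sets \<kappa>" "A \<in> sets \<kappa>" for n using compact_borel[OF H(1)] A \<kappa>(2) by auto
  have KH: "(\<Union>n. K n) = (\<Union>n. H n)" by (auto simp: K_def)
  have le: "measure \<kappa> (A - (\<Union>n. H n)) \<le> inverse (real (Suc n))" for n
  proof -
    have "measure \<kappa> (A - (\<Union>n. H n)) \<le> measure \<kappa> (A - H n)"
      using b by (intro finite_measure_mono) auto
    also have "\<dots> = measure \<kappa> A - measure \<kappa> (H n)"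
      using b H(2) by (intro finite_measure_Diff) auto
    also have "\<dots> \<le> inverse (real (Suc n))" using H(3)[of n] by linarith
    finally show ?thesis .
  qed
  have "measure \<kappa> (A - (\<Union>n. H n)) \<le> 0"
    by (rule LIMSEQ_le_const[OF LIMSEQ_inverse_real_of_nat]) (use le in blast)
  then have "emeasure \<kappa> (A - (\<Union>n. K n)) = 0"
    unfolding KH by (simp add: emeasure_eq_measure measure_le_0_iff)
  moreover have "incseq K" unfolding K_def by (auto simp: incseq_def intro: order_trans)
  moreover have "compact (K n)" "K n \<subseteq> A" for n using H(1,2) by (auto simp: K_def intro!: compact_UN)
  ultimately show ?thesis using that by blast
qed

text \<open>Regularity is a property of a set function on Borel sets, such as a total variation; here it is used
  through a measure \<open>\<kappa>\<close> that agrees with it there.\<close>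

lemma regular_approx:
  fixes \<kappa> :: "'g::t2_space measure"
  assumes \<kappa>: "finite_measure \<kappa>" "sets \<kappa> = sets borel"
    and A: "A \<in> sets borel" and e: "0 < e"
    and reg: "borel_regular \<nu>" and \<nu>: "\<And>A. A \<in> sets borel \<Longrightarrow> \<nu> A = emeasure \<kappa> A"
  obtains K U where "compact K" "open U" "K \<subseteq> A" "A \<subseteq> U" "measure \<kappa> (U - K) < e"
proof -
  interpret finite_measure \<kappa> by fact
  have "emeasure \<kappa> A = (SUP K\<in>{K. compact K \<and> K \<subseteq> A}. \<nu> K)"
    using reg A unfolding borel_regular_def \<nu>[OF A, symmetric] by blast
  also have "\<dots> = (SUP K\<in>{K. compact K \<and> K \<subseteq> A}. emeasure \<kappa> K)"
    by (intro SUP_cong refl \<nu> compact_borel) simp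
  finally obtain K where K: "compact K" "K \<subseteq> A" "measure \<kappa> A - e / 2 < measure \<kappa> K"
    by (rule inner_approx[OF \<kappa>(1), of A "e / 2"]) (use e in auto)
  have "(INF U\<in>{U. open U \<and> A \<subseteq> U}. emeasure \<kappa> U) = (INF U\<in>{U. open U \<and> A \<subseteq> U}. \<nu> U)"
    by (intro INF_cong refl \<nu>[symmetric] borel_open) simp
  also have "\<dots> = emeasure \<kappa> A"
    using reg A unfolding borel_regular_def \<nu>[OF A, symmetric] by metis
  also have "\<dots> < ennreal (measure \<kappa> A + e / 2)"
    unfolding emeasure_eq_measure using e by (intro ennreal_lessI) (auto intro: add_nonneg_pos)
  finally obtain U where U: "open U" "A \<subseteq> U" "emeasure \<kappa> U < ennreal (measure \<kappa> A + e / 2)"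
    unfolding INF_less_iff by blast
  then have "measure \<kappa> U < measure \<kappa> A + e / 2"
    unfolding emeasure_eq_measure by (simp add: ennreal_less_iff)
  moreover have "measure \<kappa> (U - K) = measure \<kappa> U - measure \<kappa> K"
    using U(1,2) K(1,2) \<kappa>(2) compact_borel[OF K(1)] by (intro finite_measure_Diff) auto
  ultimately have "measure \<kappa> (U - K) < e" using K(3) by linarith
  with K U that show ?thesis by blast
qed

context compact_haar_group
begin

lemma integrable_mult_cont:
  fixes k f :: "'g \<Rightarrow> complex"
  assumes "sets \<rho> = sets borel" "integrable \<rho> k" "cont f"
  shows "integrable \<rho> (\<lambda>x. k x * f x)"
proof -
  obtain B where "\<And>x. cmod (f x) \<le> B"
    using continuous_on_compact_bounded[OF compact_UNIV assms(3)] by blast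
  moreover have "f \<in> borel_measurable \<rho>"
    using borel_measurable_continuous_onI[OF assms(3)] measurable_cong_sets[OF assms(1) refl] by auto
  ultimately show ?thesis using assms(2) by (intro integrable_mult_bounded)
qed

text \<open>Trigonometric polynomials are uniformly dense, so the hypothesis passes to all continuous functions
  in place of \<open>\<gamma>\<close>. Regularity of \<open>\<bar>k\<bar> \<rho>\<close>, which dominates \<open>\<bar>k'\<bar> \<rho>\<close>, passes it on to indicator
  functions of Borel sets. The bound by \<open>k\<close> allows \<open>k'\<close> to be a restriction of the density of a
  regular measure.\<close>

lemma fourier_unique:
  fixes k k' :: "'g \<Rightarrow> complex"
  assumes \<rho>: "finite_measure \<rho>" "sets \<rho> = sets borel" and k: "integrable \<rho> k"
    and reg: "borel_regular \<nu>"
    and \<nu>: "\<And>A. A \<in> sets borel \<Longrightarrow> \<nu> A = emeasure (density \<rho> (\<lambda>x. ennreal (cmod (k x)))) A"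
    and k': "integrable \<rho> k'" "\<And>x. cmod (k' x) \<le> cmod (k x)"
    and zero: "\<And>\<gamma>. \<gamma> \<in> characters \<Longrightarrow> (\<integral>x. k' x * \<gamma> x \<partial>\<rho>) = 0"
  shows "AE x in \<rho>. k' x = 0"
proof -
  define \<kappa> where "\<kappa> = density \<rho> (\<lambda>x. ennreal (cmod (k x)))"
  interpret \<kappa>: finite_measure \<kappa>
    unfolding \<kappa>_def using k by (intro finite_measure_density_integrable) auto
  have sets\<kappa>: "sets \<kappa> = sets borel" using \<rho>(2) by (simp add: \<kappa>_def)
  note ik = integrable_mult_cont[OF \<rho>(2) k'(1)]
  have trig0: "(\<integral>x. k' x * Q x \<partial>\<rho>) = 0" if "Q \<in> trig characters" for Q
    using that
  proof (induction rule: trig.induct)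
    case (char \<gamma> c)
    have "(\<integral>x. k' x * (c * \<gamma> x) \<partial>\<rho>) = (\<integral>x. c * (k' x * \<gamma> x) \<partial>\<rho>)" by (simp add: ac_simps)
    then show ?case using zero[OF char] by simp
  next
    case (add P Q)
    have "cont P" "cont Q" using add.hyps trig_cont characters_cont by blast+
    then show ?case using add.IH ik by (simp add: distrib_left)
  qed
  have cont0: "(\<integral>x. k' x * of_real (v x) \<partial>\<rho>) = 0" if v: "continuous_on UNIV v" for v :: "'g \<Rightarrow> real"
  proof -
    define I where "I = (\<integral>x. cmod (k' x) \<partial>\<rho>)"
    have I: "0 \<le> I" by (simp add: I_def)
    have "cmod (\<integral>x. k' x * of_real (v x) \<partial>\<rho>) \<le> 0 + e" if e: "0 < e" for e
    proof -
      define d where "d = e / (I + 1)"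
      have d: "0 < d" using e I by (simp add: d_def)
      obtain Q where Q: "Q \<in> trig characters" "\<And>x. \<bar>v x - Re (Q x)\<bar> < d"
        using trig_dense[OF v d] by blast
      have R: "(\<lambda>x. (1 / 2) * (Q x + cnj (Q x))) \<in> trig characters"
        by (intro trig_scale trig.add Q(1) trig_cnj characters_cnj)
      have Re: "(1 / 2) * (Q x + cnj (Q x)) = of_real (Re (Q x))" for x
        by (simp add: complex_eq_iff)
      have cQ: "cont Q" using Q(1) trig_cont characters_cont by blast
      have i: "integrable \<rho> (\<lambda>x. k' x * of_real (v x))" "integrable \<rho> (\<lambda>x. k' x * of_real (Re (Q x)))"
        by (intro ik continuous_intros v cQ)+
      have "(\<integral>x. k' x * of_real (v x) \<partial>\<rho>)
          = (\<integral>x. k' x * of_real (v x) \<partial>\<rho>) - (\<integral>x. k' x * of_real (Re (Q x)) \<partial>\<rho>)"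
        using trig0[OF R] unfolding Re by simp
      also have "\<dots> = (\<integral>x. k' x * of_real (v x - Re (Q x)) \<partial>\<rho>)"
        using i by (simp add: right_diff_distrib)
      also have "cmod \<dots> \<le> (\<integral>x. cmod (k' x * of_real (v x - Re (Q x))) \<partial>\<rho>)"
        by (rule integral_norm_bound)
      also have "\<dots> \<le> (\<integral>x. d * cmod (k' x) \<partial>\<rho>)"
      proof (rule integral_mono)
        show "integrable \<rho> (\<lambda>x. cmod (k' x * of_real (v x - Re (Q x))))"
          using i by (auto simp: right_diff_distrib)
        show "cmod (k' x * of_real (v x - Re (Q x))) \<le> d * cmod (k' x)" for x
          using mult_right_mono[OF less_imp_le[OF Q(2)[of x]], of "cmod (k' x)"]
          unfolding norm_mult norm_of_real by (simp add: mult.commute)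
      qed (use k'(1) in auto)
      also have "\<dots> = d * I" by (simp add: I_def)
      also have "\<dots> \<le> d * (I + 1)" using d by simp
      also have "\<dots> = e" using I by (simp add: d_def)
      finally show ?thesis by simp
    qed
    then have "cmod (\<integral>x. k' x * of_real (v x) \<partial>\<rho>) \<le> 0" by (rule field_le_epsilon)
    then show ?thesis by simp
  qed
  have A0: "(LINT x:A|\<rho>. k' x) = 0" if A: "A \<in> sets borel" for A
  proof -
    have "cmod (LINT x:A|\<rho>. k' x) \<le> 0 + e" if e: "0 < e" for e
    proof -
      obtain K U where KU: "compact K" "open U" "K \<subseteq> A" "A \<subseteq> U" "measure \<kappa> (U - K) < e"
        using regular_approx[OF \<kappa>.finite_measure_axioms sets\<kappa> A e reg] \<nu> unfolding \<kappa>_def by blast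
      obtain v :: "'g \<Rightarrow> real" where v: "continuous_on UNIV v" "\<And>x. 0 \<le> v x" "\<And>x. v x \<le> 1"
        "\<And>x. x \<in> - U \<Longrightarrow> v x = 0" "\<And>x. x \<in> K \<Longrightarrow> v x = 1"
        by (rule urysohn_compact[OF compact_UNIV, of "- U" K])
          (use KU in \<open>auto intro: compact_imp_closed\<close>)
      have cv: "continuous_on UNIV (\<lambda>x. complex_of_real (v x))" by (intro continuous_intros v(1))
      have UK: "U - K \<in> sets \<rho>"
        unfolding \<rho>(2) by (intro sets.Diff borel_open compact_borel KU)
      have iA: "integrable \<rho> (\<lambda>x. indicator A x *\<^sub>R k' x)"
        using k'(1) A \<rho>(2) by (intro integrable_mult_indicator) auto
      have iUK: "integrable \<rho> (\<lambda>x. indicator (U - K) x *\<^sub>R cmod (k x))"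
        using k UK by (intro integrable_mult_indicator) auto
      have "(LINT x:A|\<rho>. k' x) = (\<integral>x. indicator A x *\<^sub>R k' x \<partial>\<rho>) - (\<integral>x. k' x * of_real (v x) \<partial>\<rho>)"
        using cont0[OF v(1)] by (simp add: set_lebesgue_integral_def)
      also have "\<dots> = (\<integral>x. indicator A x *\<^sub>R k' x - k' x * of_real (v x) \<partial>\<rho>)"
        using iA ik[OF cv] by simp
      also have "cmod \<dots> \<le> (\<integral>x. cmod (indicator A x *\<^sub>R k' x - k' x * of_real (v x)) \<partial>\<rho>)"
        by (rule integral_norm_bound)
      also have "\<dots> \<le> (\<integral>x. indicator (U - K) x *\<^sub>R cmod (k x) \<partial>\<rho>)"
      proof (rule integral_mono[OF _ iUK])
        show "integrable \<rho> (\<lambda>x. cmod (indicator A x *\<^sub>R k' x - k' x * of_real (v x)))"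
          using iA ik[OF cv] by auto
        fix x
        have "indicator A x *\<^sub>R k' x - k' x * of_real (v x) = of_real (indicator A x - v x) * k' x"
          by (simp add: scaleR_conv_of_real algebra_simps)
        then have "cmod (indicator A x *\<^sub>R k' x - k' x * of_real (v x)) = \<bar>indicator A x - v x\<bar> * cmod (k' x)"
          by (simp only: norm_mult norm_of_real)
        also have "\<dots> \<le> indicator (U - K) x * cmod (k x)"
          using v(2,3)[of x] v(4,5)[of x] KU(3,4) k'(2)[of x]
          by (intro mult_mono) (auto split: split_indicator)
        finally show "cmod (indicator A x *\<^sub>R k' x - k' x * of_real (v x)) \<le> indicator (U - K) x *\<^sub>R cmod (k x)"
          by simp
      qed
      also have "\<dots> = measure \<kappa> (U - K)"
        unfolding \<kappa>_def using k UK by (subst measure_density_real) (auto simp: set_lebesgue_integral_def)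
      finally show ?thesis using KU(5) by simp
    qed
    then have "cmod (LINT x:A|\<rho>. k' x) \<le> 0" by (rule field_le_epsilon)
    then show ?thesis by simp
  qed
  \<comment> \<open>A density whose integrals all vanish has total variation 0.\<close>
  have "emeasure (density \<rho> (\<lambda>x. ennreal (cmod (k' x)))) UNIV = total_variation (\<lambda>A. LINT x:A|\<rho>. k' x) UNIV"
    by (rule total_variation_density[OF \<rho>(1) k'(1) \<rho>(2), symmetric]) auto
  also have "\<dots> = 0"
    unfolding total_variation_def
    by (intro antisym SUP_least) (auto simp: A0 image_subset_iff)
  finally have z: "emeasure (density \<rho> (\<lambda>x. ennreal (cmod (k' x)))) UNIV = 0" .
  have [measurable]: "k' \<in> borel_measurable \<rho>" using k'(1) by simp
  have "UNIV \<in> sets \<rho>" using \<rho>(2) by simp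
  with z have "(\<integral>\<^sup>+x. ennreal (cmod (k' x)) \<partial>\<rho>) = 0"
    by (simp add: emeasure_density)
  then have "AE x in \<rho>. ennreal (cmod (k' x)) = 0"
    by (subst (asm) nn_integral_0_iff_AE) auto
  then show ?thesis by simp
qed

end

context compact_flow
begin

lemma integral_exp_trig_nonneg:
  assumes P: "P \<in> trig nonneg"
  shows "(\<integral>x. exp (P x) \<partial>m) = exp (\<integral>x. P x \<partial>m)"
proof -
  have "(\<lambda>n. (\<integral>x. 1 * P x ^ n \<partial>m) / fact n) sums (\<integral>x. 1 * exp (P x) \<partial>m)"
    by (rule integral_exp_sums[OF sets_m _ trig_nonneg_cont[OF P] compact_UNIV]) simp
  then have "(\<lambda>n. (\<integral>x. P x \<partial>m) ^ n / fact n) sums (\<integral>x. exp (P x) \<partial>m)"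
    by (simp add: integral_trig_nonneg_power[OF P])
  moreover have "(\<lambda>n. (\<integral>x. P x \<partial>m) ^ n / fact n) sums exp (\<integral>x. P x \<partial>m)"
    using exp_converges[of "\<integral>x. P x \<partial>m"] by (simp add: scaleR_conv_of_real divide_inverse mult.commute)
  ultimately show ?thesis by (rule sums_unique2)
qed

text \<open>If \<open>k \<rho>\<close> annihilates all frequencies above \<open>b\<close>, then so does its product with a function that
  has only nonnegative frequencies; the exponential of an analytic polynomial is such a
  function.\<close>

lemma annihilates_exp:
  assumes \<rho>: "sets \<rho> = sets borel" and k: "integrable \<rho> k"
    and zero: "\<And>\<gamma> l. extends_exp \<beta> l \<gamma> \<Longrightarrow> b < l \<Longrightarrow> (\<integral>x. k x * \<gamma> x \<partial>\<rho>) = 0"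
    and P: "P \<in> trig nonneg" and \<gamma>: "extends_exp \<beta> l \<gamma>" "b < l"
  shows "(\<integral>x. k x * \<gamma> x * exp (P x) \<partial>\<rho>) = 0"
proof -
  have c\<gamma>: "cont \<gamma>" using \<gamma>(1) by (intro characters_cont extends_exp_char)
  note k\<gamma> = integrable_mult_cont[OF \<rho> k c\<gamma>]
  have Q: "(\<integral>x. k x * \<gamma> x * Q x \<partial>\<rho>) = 0" if "Q \<in> trig nonneg" for Q
    using that
  proof (induction rule: trig.induct)
    case (char \<eta> c)
    then obtain l' where l': "0 \<le> l'" "extends_exp \<beta> l' \<eta>" by (auto simp: nonneg_def)
    have "(\<integral>x. k x * \<gamma> x * (c * \<eta> x) \<partial>\<rho>) = (\<integral>x. c * (k x * (\<gamma> x * \<eta> x)) \<partial>\<rho>)"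
      by (simp add: ac_simps)
    then show ?case using zero[OF extends_exp_mult[OF \<gamma>(1) l'(2)]] \<gamma>(2) l'(1) by simp
  next
    case (add P Q)
    then show ?case
      using integrable_mult_cont[OF \<rho> k\<gamma> trig_nonneg_cont] by (simp add: distrib_left)
  qed
  have "(\<lambda>n. (\<integral>x. k x * \<gamma> x * P x ^ n \<partial>\<rho>) / fact n) sums (\<integral>x. k x * \<gamma> x * exp (P x) \<partial>\<rho>)"
    by (rule integral_exp_sums[OF \<rho> k\<gamma> trig_nonneg_cont[OF P] compact_UNIV])
  then have "(\<lambda>n. 0) sums (\<integral>x. k x * \<gamma> x * exp (P x) \<partial>\<rho>)"
    by (simp add: Q[OF trig_nonneg_power[OF P]])
  then show ?thesis by (simp add: sums_iff)
qed

text \<open>A continuous function that is \<open>n + \<epsilon>\<close> on \<open>K\<close> and vanishes outside a neighbourhood of measure at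
  most \<open>\<delta>\<close> is approximated by the real part of a trigonometric polynomial, after adding \<open>\<epsilon>\<close> to
  keep the approximation nonnegative. The analytic completion has a real mean once an imaginary
  constant is subtracted.\<close>

lemma peak_polynomial:
  fixes n :: nat
  assumes K: "compact K" "emeasure m K = 0" and n: "0 < n"
  obtains P c where "P \<in> trig nonneg" "\<And>x. 0 \<le> Re (P x)" "\<And>x. x \<in> K \<Longrightarrow> real n \<le> Re (P x)"
    "(\<integral>x. P x \<partial>m) = of_real c" "0 \<le> c" "c \<le> 1 / real n"
proof -
  \<comment> \<open>Chosen such that \<open>(n + 1) * \<delta> + 2 * \<epsilon> = 1 / n\<close>.\<close>
  define \<epsilon> where "\<epsilon> = 1 / (4 * real n)"
  define \<delta> where "\<delta> = 1 / (2 * real n * (real n + 1))"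
  have pos: "0 < \<epsilon>" "\<epsilon> \<le> 1" "0 < \<delta>" using n by (simp_all add: \<epsilon>_def \<delta>_def)
  have reg: "borel_regular (emeasure m)" using haar by (simp add: normalized_haar_def)
  obtain K' U where U: "compact K'" "open U" "K' \<subseteq> K" "K \<subseteq> U" "measure m (U - K') < \<delta>"
    by (rule regular_approx[OF m.finite_measure_axioms sets_m compact_borel[OF K(1)] pos(3) reg refl])
  have mU: "measure m U < \<delta>"
  proof -
    have "measure m K' \<le> measure m K"
      using U(3) K(1) sets_m by (intro m.finite_measure_mono) (auto intro: compact_borel)
    then have "measure m K' = 0" using K(2) measure_nonneg[of m K'] by (simp add: measure_def[of m K])
    moreover have "measure m (U - K') = measure m U - measure m K'"
      using U(1-4) sets_m by (intro m.finite_measure_Diff) (auto intro: compact_borel)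
    ultimately show ?thesis using U(5) by simp
  qed
  obtain v :: "'g \<Rightarrow> real" where v: "continuous_on UNIV v" "\<And>x. 0 \<le> v x" "\<And>x. v x \<le> 1"
    "\<And>x. x \<in> - U \<Longrightarrow> v x = 0" "\<And>x. x \<in> K \<Longrightarrow> v x = 1"
    by (rule urysohn_compact[OF compact_UNIV, of "- U" K])
      (use U(2,4) K(1) in \<open>auto intro: compact_imp_closed\<close>)
  define u where "u x = (real n + \<epsilon>) * v x + \<epsilon>" for x
  have cu: "continuous_on UNIV u" unfolding u_def by (intro continuous_intros v(1))
  obtain Q where Q: "Q \<in> trig characters" "\<And>x. \<bar>u x - Re (Q x)\<bar> < \<epsilon>"
    using trig_dense[OF cu pos(1)] by blast
  obtain P where P: "P \<in> trig nonneg" "\<And>x. Re (P x) = Re (Q x)"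
    using analytic_completion[OF Q(1)] by blast
  note cP = trig_nonneg_cont[OF P(1)]
  define z where "z = (\<integral>x. P x \<partial>m)"
  define P' where "P' x = P x + (- \<i> * of_real (Im z))" for x
  have "P' \<in> trig nonneg" unfolding P'_def by (intro trig.add P(1) trig_nonneg_const)
  moreover have Re: "Re (P' x) = Re (Q x)" for x by (simp add: P'_def P(2))
  have ge: "0 \<le> Re (P' x)" for x
  proof -
    have "0 \<le> (real n + \<epsilon>) * v x" using v(2) pos by simp
    then show ?thesis using Q(2)[of x] unfolding Re u_def by linarith
  qed
  moreover have "real n \<le> Re (P' x)" if "x \<in> K" for x
    using Q(2)[of x] pos(1) unfolding Re u_def v(5)[OF that] mult_1_right abs_less_iff by linarith
  moreover have int: "(\<integral>x. P' x \<partial>m) = of_real (Re z)"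
  proof -
    have "(\<integral>x. P' x \<partial>m) = z - \<i> * of_real (Im z)"
      unfolding P'_def using integrable_cont[OF cP] by (simp add: z_def)
    then show ?thesis by (simp add: complex_eq_iff)
  qed
  moreover have Rez: "Re z = (\<integral>x. Re (P' x) \<partial>m)"
    unfolding z_def P'_def using integrable_cont[OF cP] by simp
  then have "0 \<le> Re z" using ge by simp
  moreover have "Re z \<le> 1 / real n"
  proof -
    have iv: "integrable m v" by (rule integrable_cont[OF v(1)])
    have "Re z \<le> (\<integral>x. u x + \<epsilon> \<partial>m)"
      unfolding Rez
    proof (rule integral_mono)
      show "integrable m (\<lambda>x. Re (P' x))"
        unfolding P'_def by (intro integrable_cont continuous_intros cP)
      show "integrable m (\<lambda>x. u x + \<epsilon>)" by (intro integrable_cont continuous_intros cu)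
      show "Re (P' x) \<le> u x + \<epsilon>" for x using Q(2)[of x] unfolding Re by linarith
    qed
    also have "\<dots> = (real n + \<epsilon>) * (\<integral>x. v x \<partial>m) + 2 * \<epsilon>"
      using iv by (simp add: u_def)
    also have "(\<integral>x. v x \<partial>m) \<le> (\<integral>x. indicator U x \<partial>m)"
    proof (rule integral_mono[OF iv])
      show "integrable m (indicator U :: 'g \<Rightarrow> real)"
        using U(2) sets_m by (intro integrable_real_indicator) (auto simp: less_top[symmetric])
      show "v x \<le> indicator U x" for x using v(3,4)[of x] by (auto split: split_indicator)
    qed
    also have "(\<integral>x. indicator U x \<partial>m) = measure m U" by simp
    also have "(real n + \<epsilon>) * measure m U + 2 * \<epsilon> \<le> (real n + 1) * \<delta> + 2 * \<epsilon>"
      using mU pos by (intro add_mono mult_mono) auto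
    also have "(real n + 1) * \<delta> = 1 / (2 * real n)"
      unfolding \<delta>_def by (subst mult.commute, subst times_divide_eq_left, subst mult_1_left)
        (rule nonzero_divide_mult_cancel_right, simp)
    also have "1 / (2 * real n) + 2 * \<epsilon> = 1 / real n" by (simp add: \<epsilon>_def field_simps)
    finally show ?thesis using pos by (simp add: mult_left_mono)
  qed
  ultimately show ?thesis by (rule that)
qed

text \<open>The heart of the argument. The functions \<open>g n = exp (- P n)\<close> are bounded by 1, tend to 0 on the
  union of the sets \<open>K n\<close>, and tend to 1 in \<open>L\<^sub>2(m)\<close>, as
  \<open>\<integral> \<bar>g - 1\<bar>\<^sup>2 dm \<le> 2 - 2 Re (\<integral> g dm) = 2 - 2 exp (- \<integral> P dm)\<close>. Along a subsequence they tend to 1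
  almost everywhere with respect to \<open>m\<close>, that is, \<open>\<rho>\<close>-almost everywhere on \<open>{w \<noteq> 0}\<close>. So
  \<open>k \<gamma> g\<close>, whose integral is 0, tends to \<open>k \<gamma>\<close> replaced by 0 on \<open>{w = 0}\<close>. The absolutely continuous part
  thus annihilates \<open>\<gamma>\<close>, and so does the difference.\<close>

lemma singular_part_annihilates:
  fixes k :: "'g \<Rightarrow> complex"
  assumes \<rho>: "finite_measure \<rho>" "sets \<rho> = sets borel" and k: "integrable \<rho> k"
    and w: "\<And>x. 0 \<le> w x" "integrable \<rho> w" "m = density \<rho> (\<lambda>x. ennreal (w x))"
    and K: "incseq K" "\<And>n. compact (K n)" "\<And>n. K n \<subseteq> {x. w x = 0}"
    and supp: "AE x in \<rho>. w x = 0 \<longrightarrow> k x \<noteq> 0 \<longrightarrow> x \<in> (\<Union>n. K n)"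
    and zero: "\<And>\<gamma> l. extends_exp \<beta> l \<gamma> \<Longrightarrow> b < l \<Longrightarrow> (\<integral>x. k x * \<gamma> x \<partial>\<rho>) = 0"
    and \<gamma>: "extends_exp \<beta> l \<gamma>" "b < l"
  shows "(\<integral>x. (if w x = 0 then k x else 0) * \<gamma> x \<partial>\<rho>) = 0"
proof -
  have [measurable]: "w \<in> borel_measurable \<rho>" "k \<in> borel_measurable \<rho>" using w(2) k by auto
  have c\<gamma>: "cont \<gamma>" using \<gamma>(1) by (intro characters_cont extends_exp_char)
  have m\<gamma>[measurable]: "\<gamma> \<in> borel_measurable \<rho>"
    using borel_measurable_continuous_onI[OF c\<gamma>] measurable_cong_sets[OF \<rho>(2) refl] by auto
  have mK: "emeasure m (K n) = 0" for n
  proof -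
    have "emeasure m (K n) = (\<integral>\<^sup>+x. ennreal (w x) * indicator (K n) x \<partial>\<rho>)"
      unfolding w(3) using \<rho>(2) compact_borel[OF K(2)] by (intro emeasure_density) auto
    also have "\<dots> = (\<integral>\<^sup>+x. 0 \<partial>\<rho>)"
      using K(3)[of n] by (intro nn_integral_cong) (auto split: split_indicator)
    finally show ?thesis by simp
  qed
  have "\<exists>P. P \<in> trig nonneg \<and> (\<forall>x. 0 \<le> Re (P x)) \<and> (\<forall>x\<in>K n. real (Suc n) \<le> Re (P x)) \<and>
    (\<exists>c. (\<integral>x. P x \<partial>m) = of_real c \<and> 0 \<le> c \<and> c \<le> 1 / real (Suc n))" for n
    by (rule peak_polynomial[OF K(2) mK, of "Suc n" n]) auto
  then obtain P where P: "\<And>n. P n \<in> trig nonneg" "\<And>n x. 0 \<le> Re (P n x)"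
    "\<And>n x. x \<in> K n \<Longrightarrow> real (Suc n) \<le> Re (P n x)"
    "\<And>n. \<exists>c. (\<integral>x. P n x \<partial>m) = of_real c \<and> 0 \<le> c \<and> c \<le> 1 / real (Suc n)" by metis
  have mP: "(\<lambda>x. - P n x) \<in> trig nonneg" for n using trig_scale[OF P(1)[of n], of "-1"] by simp
  define g where "g n x = exp (- P n x)" for n x
  have cg: "cont (g n)" for n unfolding g_def by (intro continuous_intros trig_nonneg_cont P(1))
  have g1: "cmod (g n x) \<le> 1" for n x using P(2)[of n x] by (simp add: g_def)
  have gK: "cmod (g n x) \<le> inverse (real (Suc n))" if "x \<in> K n" for n x
  proof -
    have "cmod (g n x) \<le> exp (- real (Suc n))" using P(3)[OF that] by (simp add: g_def)
    also have "\<dots> = inverse (exp (real (Suc n)))" by (rule exp_minus)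
    also have "\<dots> \<le> inverse (real (Suc n))"
    proof (rule le_imp_inverse_le)
      show "real (Suc n) \<le> exp (real (Suc n))" using exp_ge_add_one_self[of "real (Suc n)"] by linarith
    qed simp
    finally show ?thesis .
  qed
  define u where "u n x = (cmod (g n x - 1))\<^sup>2" for n x
  have iu: "integrable m (u n)" for n
    unfolding u_def by (intro integrable_cont continuous_intros cg)
  have u: "(\<integral>x. norm (u n x) \<partial>m) \<le> 2 * inverse (real (Suc n))" for n
  proof -
    obtain c where c: "(\<integral>x. P n x \<partial>m) = of_real c" "0 \<le> c" "c \<le> 1 / real (Suc n)" using P(4) by blast
    have ig: "integrable m (g n)" by (rule integrable_cont[OF cg])
    have "(\<integral>x. g n x \<partial>m) = of_real (exp (- c))"
      unfolding g_def integral_exp_trig_nonneg[OF mP] exp_of_real[symmetric] using c(1) by simp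
    then have Re: "(\<integral>x. Re (g n x) \<partial>m) = exp (- c)" using ig by simp
    have "(\<integral>x. norm (u n x) \<partial>m) \<le> (\<integral>x. 2 - 2 * Re (g n x) \<partial>m)"
    proof (rule integral_mono)
      show "integrable m (\<lambda>x. norm (u n x))" using iu by auto
      show "integrable m (\<lambda>x. 2 - 2 * Re (g n x))" using ig by auto
      fix x
      have "norm (u n x) = (cmod (g n x))\<^sup>2 + 1 - 2 * Re (g n x)"
        unfolding u_def by (simp add: cmod_power2) (simp add: power2_eq_square algebra_simps)
      also have "(cmod (g n x))\<^sup>2 \<le> 1" using g1[of n x] by (simp add: power_le_one)
      finally show "norm (u n x) \<le> 2 - 2 * Re (g n x)" by simp
    qed
    also have "\<dots> = 2 - 2 * exp (- c)" using ig Re by simp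
    also have "\<dots> \<le> 2 * c" using exp_ge_add_one_self[of "- c"] by linarith
    finally show ?thesis using c(3) by (simp add: inverse_eq_divide)
  qed
  have "(\<lambda>n. \<integral>x. norm (u n x) \<partial>m) \<longlonglongrightarrow> 0"
  proof (rule tendsto_sandwich[of "\<lambda>_. 0" _ _ "\<lambda>n. 2 * inverse (real (Suc n))"])
    show "(\<lambda>n. 2 * inverse (real (Suc n))) \<longlonglongrightarrow> 0"
      using tendsto_mult_right_zero[OF LIMSEQ_inverse_real_of_nat] by simp
  qed (use u in \<open>auto intro!: always_eventually\<close>)
  then obtain r :: "nat \<Rightarrow> nat" where r: "strict_mono r" "AE x in m. (\<lambda>n. u (r n) x) \<longlonglongrightarrow> 0"
    using tendsto_L1_AE_subseq[of m u, OF iu] by blast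
  have "AE x in \<rho>. 0 < ennreal (w x) \<longrightarrow> (\<lambda>n. u (r n) x) \<longlonglongrightarrow> 0"
    using r(2) unfolding w(3) by (subst (asm) AE_density) auto
  with supp have lim: "AE x in \<rho>. (\<lambda>n. k x * \<gamma> x * g (r n) x)
      \<longlonglongrightarrow> (if w x = 0 then 0 else k x) * \<gamma> x"
  proof eventually_elim
    case (elim x)
    consider "k x = 0" | "w x \<noteq> 0" | "w x = 0" "k x \<noteq> 0" by blast
    then show ?case
    proof cases
      case 2
      then have "0 < w x" using w(1)[of x] by simp
      then have "(\<lambda>n. u (r n) x) \<longlonglongrightarrow> 0" using elim(2) by simp
      then have "(\<lambda>n. sqrt (u (r n) x)) \<longlonglongrightarrow> sqrt 0" by (rule tendsto_real_sqrt)
      then have "(\<lambda>n. g (r n) x) \<longlonglongrightarrow> 1"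
        by (subst LIM_zero_iff[symmetric], subst tendsto_norm_zero_iff[symmetric]) (simp add: u_def)
      from tendsto_mult_left[OF this, of "k x * \<gamma> x"] show ?thesis using 2 by simp
    next
      case 3
      then obtain j where j: "x \<in> K j" using elim(1) by blast
      have "(\<lambda>n. g (r n) x) \<longlonglongrightarrow> 0"
      proof (rule tendsto_norm_zero_cancel, rule tendsto_sandwich[of "\<lambda>_. 0" _ _ "\<lambda>n. inverse (real (Suc n))"])
        show "\<forall>\<^sub>F n in sequentially. norm (g (r n) x) \<le> inverse (real (Suc n))"
          using eventually_ge_at_top[of j]
        proof eventually_elim
          case (elim n)
          have rn: "n \<le> r n" using r(1) by (rule strict_mono_imp_increasing)
          then have "x \<in> K (r n)" using j elim incseqD[OF K(1), of j "r n"] by auto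
          then have "norm (g (r n) x) \<le> inverse (real (Suc (r n)))" by (rule gK)
          also have "\<dots> \<le> inverse (real (Suc n))" using rn by (intro le_imp_inverse_le) auto
          finally show ?case .
        qed
      qed (use LIMSEQ_inverse_real_of_nat in auto)
      from tendsto_mult_left[OF this, of "k x * \<gamma> x"] show ?thesis using 3 by simp
    qed simp
  qed
  have ik\<gamma>: "integrable \<rho> (\<lambda>x. k x * \<gamma> x)" by (rule integrable_mult_cont[OF \<rho>(2) k c\<gamma>])
  have mg[measurable]: "g n \<in> borel_measurable \<rho>" for n
    using borel_measurable_continuous_onI[OF cg] measurable_cong_sets[OF \<rho>(2) refl] by auto
  have "(\<lambda>n. \<integral>x. k x * \<gamma> x * g (r n) x \<partial>\<rho>) \<longlonglongrightarrow> (\<integral>x. (if w x = 0 then 0 else k x) * \<gamma> x \<partial>\<rho>)"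
  proof (rule integral_dominated_convergence[where w = "\<lambda>x. cmod (k x * \<gamma> x)"])
    show "AE x in \<rho>. cmod (k x * \<gamma> x * g (r n) x) \<le> cmod (k x * \<gamma> x)" for n
      using g1 by (intro AE_I2) (simp add: norm_mult mult_left_le)
  qed (use ik\<gamma> lim in auto)
  moreover have "(\<integral>x. k x * \<gamma> x * g n x \<partial>\<rho>) = 0" for n
    unfolding g_def by (rule annihilates_exp[OF \<rho>(2) k zero mP \<gamma>])
  ultimately have ac: "(\<integral>x. (if w x = 0 then 0 else k x) * \<gamma> x \<partial>\<rho>) = 0"
    by (simp add: LIMSEQ_const_iff)
  have i2: "integrable \<rho> (\<lambda>x. (if w x = 0 then 0 else k x) * \<gamma> x)"
    by (rule Bochner_Integration.integrable_bound[OF ik\<gamma>]) auto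
  have "(\<integral>x. (if w x = 0 then k x else 0) * \<gamma> x \<partial>\<rho>)
      = (\<integral>x. k x * \<gamma> x - (if w x = 0 then 0 else k x) * \<gamma> x \<partial>\<rho>)"
    by (intro Bochner_Integration.integral_cong) auto
  also have "\<dots> = (\<integral>x. k x * \<gamma> x \<partial>\<rho>) - (\<integral>x. (if w x = 0 then 0 else k x) * \<gamma> x \<partial>\<rho>)"
    using ik\<gamma> i2 by simp
  also have "\<dots> = 0" using zero[OF \<gamma>] ac by simp
  finally show ?thesis .
qed

end

section \<open>The map from functions to measures\<close>

text \<open>Compact sets that exhaust a Borel set up to a null set of \<open>m\<close> exhaust it up to a null set of
  \<open>\<bar>f\<bar> m\<close>. Outer regularity follows by taking complements, as closed sets are compact.\<close>

lemma borel_regular_density: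
  fixes m :: "'g::t2_space measure" and f :: "'g \<Rightarrow> complex"
  assumes m: "finite_measure m" "sets m = sets borel" "borel_regular (emeasure m)"
    and f: "integrable m f" and cpt: "compact (UNIV :: 'g set)"
    and \<nu>: "\<And>A. A \<in> sets borel \<Longrightarrow> \<nu> A = emeasure (density m (\<lambda>x. ennreal (cmod (f x)))) A"
  shows "borel_regular \<nu>"
proof -
  define \<kappa> where "\<kappa> = density m (\<lambda>x. ennreal (cmod (f x)))"
  interpret \<kappa>: finite_measure \<kappa>
    unfolding \<kappa>_def using f by (intro finite_measure_density_integrable) auto
  have sets\<kappa>: "sets \<kappa> = sets borel" using m(2) by (simp add: \<kappa>_def)
  have space\<kappa>: "space \<kappa> = UNIV" using sets_eq_imp_space_eq[OF sets\<kappa>] by simp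
  have [measurable]: "f \<in> borel_measurable m" using f by simp
  have inner: "emeasure \<kappa> A = (SUP K\<in>{K. compact K \<and> K \<subseteq> A}. emeasure \<kappa> K)" if A: "A \<in> sets borel" for A
  proof (rule antisym)
    obtain K :: "nat \<Rightarrow> 'g set" where K: "incseq K" "\<And>n. compact (K n)" "\<And>n. K n \<subseteq> A"
      "emeasure m (A - (\<Union>n. K n)) = 0"
      using inner_sequence[OF m(1,2) A] m(3) A unfolding borel_regular_def by blast
    have UK: "(\<Union>n. K n) \<in> sets borel" using compact_borel[OF K(2)] by auto
    have "A - (\<Union>n. K n) \<in> null_sets m" using K(4) A UK m(2) by (auto simp: null_sets_def)
    then have "A - (\<Union>n. K n) \<in> null_sets \<kappa>"
      using absolutely_continuousI_density[of "\<lambda>x. ennreal (cmod (f x))" m]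
      unfolding \<kappa>_def absolutely_continuous_def by auto
    then have "emeasure \<kappa> (A - (\<Union>n. K n)) = 0" by auto
    then have "emeasure \<kappa> A = emeasure \<kappa> (\<Union>n. K n)"
      using emeasure_Diff_null_set[of "A - (\<Union>n. K n)" \<kappa> A] \<open>A - (\<Union>n. K n) \<in> null_sets \<kappa>\<close>
        A sets\<kappa> K(3) by (simp add: Diff_Diff_Int Int_absorb1 UN_least)
    also have "\<dots> = (SUP n. emeasure \<kappa> (K n))"
      using K(1,2) sets\<kappa> by (intro SUP_emeasure_incseq[symmetric]) (auto intro: compact_borel)
    also have "\<dots> \<le> (SUP K\<in>{K. compact K \<and> K \<subseteq> A}. emeasure \<kappa> K)"
      using K(2,3) by (intro SUP_least SUP_upper) auto
    finally show "emeasure \<kappa> A \<le> (SUP K\<in>{K. compact K \<and> K \<subseteq> A}. emeasure \<kappa> K)" .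
    show "(SUP K\<in>{K. compact K \<and> K \<subseteq> A}. emeasure \<kappa> K) \<le> emeasure \<kappa> A"
      using A sets\<kappa> by (intro SUP_least emeasure_mono) auto
  qed
  have outer: "emeasure \<kappa> A = (INF U\<in>{U. open U \<and> A \<subseteq> U}. emeasure \<kappa> U)" if A: "A \<in> sets borel" for A
  proof (rule antisym)
    show "emeasure \<kappa> A \<le> (INF U\<in>{U. open U \<and> A \<subseteq> U}. emeasure \<kappa> U)"
      using sets\<kappa> by (intro INF_greatest emeasure_mono) auto
    show "(INF U\<in>{U. open U \<and> A \<subseteq> U}. emeasure \<kappa> U) \<le> emeasure \<kappa> A"
    proof (rule ennreal_le_epsilon)
      fix e :: real assume e: "0 < e"
      have "- A \<in> sets borel" using A by (simp add: borel_comp)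
      from inner[OF this] obtain K where K: "compact K" "K \<subseteq> - A" "measure \<kappa> (- A) - e < measure \<kappa> K"
        by (rule inner_approx[OF \<kappa>.finite_measure_axioms _ e])
      have Kb: "K \<in> sets \<kappa>" "A \<in> sets \<kappa>" using compact_borel[OF K(1)] A sets\<kappa> by auto
      have "measure \<kappa> (- K) = measure \<kappa> UNIV - measure \<kappa> K" "measure \<kappa> (- A) = measure \<kappa> UNIV - measure \<kappa> A"
        using \<kappa>.finite_measure_compl[OF Kb(1)] \<kappa>.finite_measure_compl[OF Kb(2)]
        by (simp_all add: space\<kappa> Compl_eq_Diff_UNIV)
      then have "measure \<kappa> (- K) \<le> measure \<kappa> A + e" using K(3) by linarith
      then have "emeasure \<kappa> (- K) \<le> emeasure \<kappa> A + ennreal e"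
        using e by (simp add: \<kappa>.emeasure_eq_measure ennreal_plus[symmetric] ennreal_leI del: ennreal_plus)
      moreover have "open (- K)" using compact_imp_closed[OF K(1)] by auto
      ultimately show "(INF U\<in>{U. open U \<and> A \<subseteq> U}. emeasure \<kappa> U) \<le> emeasure \<kappa> A + ennreal e"
        using K(2) by (intro INF_lower2[of "- K"]) auto
    qed
  qed
  show ?thesis
    unfolding borel_regular_def
  proof (intro ballI conjI)
    fix A :: "'g set" assume A: "A \<in> sets borel"
    show "\<nu> A = (SUP K\<in>{K. compact K \<and> K \<subseteq> A}. \<nu> K)"
      unfolding \<nu>[OF A] \<kappa>_def[symmetric] inner[OF A]
      by (intro SUP_cong refl) (simp add: \<nu>[OF compact_borel] \<kappa>_def)
    show "\<nu> A = (INF U\<in>{U. open U \<and> A \<subseteq> U}. \<nu> U)"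
      unfolding \<nu>[OF A] \<kappa>_def[symmetric] outer[OF A]
      by (intro INF_cong refl) (simp add: \<nu>[OF borel_open] \<kappa>_def)
  qed
qed

text \<open>Whichever representative \<open>rep\<close> chooses, it agrees almost everywhere with the given one.\<close>

lemma rep_L1_class:
  assumes "integrable m f"
  shows "integrable m (rep (L1_class m f))" "AE x in m. rep (L1_class m f) x = f x"
proof -
  have "f \<in> L1_class m f" using assms by (simp add: L1_class_def L1_rel_def)
  then have "rep (L1_class m f) \<in> L1_class m f" 
    unfolding rep_def by (rule someI[of "\<lambda>g. g \<in> L1_class m f"])
  then show "integrable m (rep (L1_class m f))" "AE x in m. rep (L1_class m f) x = f x"
    by (auto simp: L1_class_def L1_rel_def)
qed

lemma L1_class_in_L1: "integrable m f \<Longrightarrow> L1_class m f \<in> L1 m"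
  unfolding L1_def L1_class_def by (rule quotientI) simp

lemma rep_integrable:
  assumes "F \<in> L1 m" shows "integrable m (rep F)"
proof -
  obtain f where f: "integrable m f" "F = L1_class m f"
    using assms unfolding L1_def L1_class_def by (rule quotientE) simp
  show ?thesis unfolding f(2) by (rule rep_L1_class(1)[OF f(1)])
qed

lemma dens_measure_class:
  assumes "integrable m f" "sets m = sets borel"
  shows "dens_measure m (L1_class m f) = (\<lambda>A. if A \<in> sets borel then (LINT x:A|m. f x) else 0)"
proof
  fix A
  have [measurable]: "rep (L1_class m f) \<in> borel_measurable m" "f \<in> borel_measurable m"
    using rep_L1_class(1)[OF assms(1)] assms(1) by auto
  have "(LINT x:A|m. rep (L1_class m f) x) = (LINT x:A|m. f x)" if "A \<in> sets borel"
  proof -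
    have [measurable]: "A \<in> sets m" using that assms(2) by simp
    show ?thesis unfolding set_lebesgue_integral_def
      using rep_L1_class(2)[OF assms(1)] by (intro integral_cong_AE) auto
  qed
  then show "dens_measure m (L1_class m f) A = (if A \<in> sets borel then (LINT x:A|m. f x) else 0)"
    by (simp add: dens_measure_def)
qed

lemma M_fourier_density:
  assumes k: "integrable \<rho> k" "sets \<rho> = sets borel"
    and \<mu>: "\<And>A. A \<in> sets borel \<Longrightarrow> \<mu> A = (LINT x:A|\<rho>. k x)" and \<gamma>: "\<gamma> \<in> characters"
  shows "M_fourier \<mu> \<gamma> = (LINT x|\<rho>. k x * cnj (\<gamma> x))"
  unfolding M_fourier_def
proof (rule complex_measure_integral_density[OF k \<mu>])
  show "(\<lambda>x. cnj (\<gamma> x)) \<in> borel_measurable borel"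
    by (intro borel_measurable_continuous_onI characters_cont characters_cnj \<gamma>)
  show "cmod (cnj (\<gamma> x)) \<le> 1" for x using characters_norm[OF \<gamma>] by simp
qed

context compact_haar_group
begin

lemma dens_measure_eq: "A \<in> sets borel \<Longrightarrow> dens_measure m F A = (LINT x:A|m. rep F x)"
  by (simp add: dens_measure_def)

lemma total_variation_dens_measure:
  assumes "F \<in> L1 m" "A \<in> sets borel"
  shows "total_variation (dens_measure m F) A = emeasure (density m (\<lambda>x. ennreal (cmod (rep F x)))) A"
  by (rule total_variation_density[OF m.finite_measure_axioms rep_integrable[OF assms(1)] sets_m dens_measure_eq assms(2)])

lemma dens_measure_in_M:
  assumes F: "F \<in> L1 m" shows "dens_measure m F \<in> M"
  unfolding M_def
proof (intro CollectI conjI)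
  note f = rep_integrable[OF F]
  have "borel_charge (dens_measure m F)"
    by (rule borel_charge_density[OF f sets_m dens_measure_eq])
  then show "complex_borel_measure (dens_measure m F)"
    by (auto simp: complex_borel_measure_def borel_charge_def dens_measure_def)
  have "finite_measure (density m (\<lambda>x. ennreal (cmod (rep F x))))"
    using f by (intro finite_measure_density_integrable) auto
  then show "total_variation (dens_measure m F) UNIV < \<infinity>"
    using total_variation_dens_measure[OF F, of UNIV]
    by (simp add: finite_measure.emeasure_eq_measure)
  show "borel_regular (total_variation (dens_measure m F))"
    by (rule borel_regular_density[OF m.finite_measure_axioms sets_m _ f compact_UNIV
        total_variation_dens_measure[OF F]]) (use haar in \<open>simp add: normalized_haar_def\<close>)
qed

lemma M_norm_dens_measure:
  assumes F: "F \<in> L1 m" shows "M_norm (dens_measure m F) = L1_norm m F"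
proof -
  have "measure (density m (\<lambda>x. ennreal (cmod (rep F x)))) UNIV = (LINT x:UNIV|m. cmod (rep F x))"
    using rep_integrable[OF F] by (intro measure_density_real) (auto simp: sets_m)
  then show ?thesis
    using total_variation_dens_measure[OF F, of UNIV]
    by (simp add: M_norm_def L1_norm_def measure_def set_lebesgue_integral_def)
qed

lemma M_fourier_dens_measure:
  assumes F: "F \<in> L1 m" and \<gamma>: "\<gamma> \<in> characters"
  shows "M_fourier (dens_measure m F) \<gamma> = L1_fourier m F \<gamma>"
  unfolding L1_fourier_def
  by (rule M_fourier_density[OF rep_integrable[OF F] sets_m dens_measure_eq \<gamma>])

lemma dens_measure_add:
  assumes "F \<in> L1 m" "G \<in> L1 m"
  shows "dens_measure m (L1_add m F G) = (\<lambda>A. dens_measure m F A + dens_measure m G A)"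
proof -
  note f = rep_integrable[OF assms(1)] and g = rep_integrable[OF assms(2)]
  have "(LINT x:A|m. rep F x + rep G x) = (LINT x:A|m. rep F x) + (LINT x:A|m. rep G x)"
    if "A \<in> sets borel" for A
    using that by (intro set_integral_add set_integrable_of_integrable f g) (auto simp: sets_m)
  then show ?thesis
    using f g unfolding L1_add_def
    by (subst dens_measure_class) (auto simp: sets_m dens_measure_def)
qed

lemma dens_measure_scale:
  assumes "F \<in> L1 m"
  shows "dens_measure m (L1_scale m c F) = (\<lambda>A. c * dens_measure m F A)"
  unfolding L1_scale_def dens_measure_class[OF integrable_mult_right[OF rep_integrable[OF assms]] sets_m]
  by (simp add: dens_measure_def fun_eq_iff)

end

text \<open>The theorem of F. and M. Riesz. For each character \<open>\<gamma>\<close>, of frequency \<open>l\<close>, choose \<open>j\<close> with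
  \<open>lam j > - l\<close> and subtract from \<open>k \<rho>\<close> the measure \<open>T m\<close>, where \<open>T\<close> is the part of the Fourier series
  of \<open>\<mu>\<close> below \<open>lam j\<close>. The difference \<open>k' \<rho>\<close> has spectrum in \<open>[lam j, \<infinity>)\<close> and the same singular part
  as \<open>\<mu>\<close>, since \<open>m\<close> has density 0 there. By \<open>singular_part_annihilates\<close> the singular part has no
  Fourier coefficient below \<open>lam j\<close>, in particular at the conjugate of \<open>\<gamma>\<close>.\<close>

lemma (in compact_flow) M_lambda_density:
  assumes lam: "frequency lam" and h: "\<And>n. \<exists>h. extends_exp \<beta> (lam n) h"
    and \<mu>: "\<mu> \<in> M_lambda lam \<beta>"
  obtains f where "integrable m f" "\<And>A. A \<in> sets borel \<Longrightarrow> \<mu> A = (LINT x:A|m. f x)"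
proof -
  have \<mu>M: "\<mu> \<in> M" using \<mu> by (simp add: M_lambda_def)
  obtain \<rho> w k where \<rho>: "finite_measure \<rho>" "sets \<rho> = sets borel"
    and w': "\<forall>x. 0 \<le> w x" and w2: "integrable \<rho> w" "m = density \<rho> (\<lambda>x. ennreal (w x))"
    and k: "integrable \<rho> k" and k': "\<forall>A\<in>sets borel. \<mu> A = (LINT x:A|\<rho>. k x)"
    by (rule M_density_ex[OF \<mu>M m.finite_measure_axioms sets_m])
  have w: "0 \<le> w x" "integrable \<rho> w" "m = density \<rho> (\<lambda>x. ennreal (w x))" for x
    using w' w2 by auto
  have \<mu>k: "\<mu> A = (LINT x:A|\<rho>. k x)" if "A \<in> sets borel" for A
    using k' that by blast
  have [measurable]: "w \<in> borel_measurable \<rho>" "k \<in> borel_measurable \<rho>" using w(2) k by auto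
  define N where "N = {x. w x = 0}"
  have N: "N \<in> sets borel"
  proof -
    have "{x \<in> space \<rho>. w x = 0} \<in> sets \<rho>" by measurable
    then show ?thesis using sets_eq_imp_space_eq[OF \<rho>(2)] \<rho>(2) by (simp add: N_def)
  qed
  define \<kappa> where "\<kappa> = density \<rho> (\<lambda>x. ennreal (cmod (k x)))"
  interpret \<kappa>: finite_measure \<kappa>
    unfolding \<kappa>_def using k by (intro finite_measure_density_integrable) auto
  have sets\<kappa>: "sets \<kappa> = sets borel" using \<rho>(2) by (simp add: \<kappa>_def)
  have tv: "total_variation \<mu> A = emeasure \<kappa> A" if "A \<in> sets borel" for A
    unfolding \<kappa>_def by (rule total_variation_density[OF \<rho>(1) k \<rho>(2) \<mu>k that])
  have reg: "borel_regular (total_variation \<mu>)" using \<mu>M by (simp add: M_def)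
  have "emeasure \<kappa> N = (SUP K\<in>{K. compact K \<and> K \<subseteq> N}. total_variation \<mu> K)"
    using reg N unfolding borel_regular_def tv[OF N, symmetric] by blast
  also have "\<dots> = (SUP K\<in>{K. compact K \<and> K \<subseteq> N}. emeasure \<kappa> K)"
    by (intro SUP_cong refl tv compact_borel) simp
  finally have inner: "emeasure \<kappa> N = (SUP K\<in>{K. compact K \<and> K \<subseteq> N}. emeasure \<kappa> K)" .
  \<comment> \<open>Regularity of the total variation provides compact sets that carry the singular part.\<close>
  obtain K :: "nat \<Rightarrow> 'g set" where K: "incseq K" "\<And>n. compact (K n)" "\<And>n. K n \<subseteq> N"
      "emeasure \<kappa> (N - (\<Union>n. K n)) = 0"
    using inner_sequence[OF \<kappa>.finite_measure_axioms sets\<kappa> N inner] by blast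
  have UK: "N - (\<Union>n. K n) \<in> sets \<rho>" using N compact_borel[OF K(2)] \<rho>(2) by auto
  have "N - (\<Union>n. K n) \<in> null_sets (density \<rho> (\<lambda>x. ennreal (cmod (k x))))"
    using K(4) UK by (auto simp: null_sets_def \<kappa>_def)
  then have "AE x in \<rho>. x \<in> N - (\<Union>n. K n) \<longrightarrow> ennreal (cmod (k x)) = 0"
    by (subst (asm) null_sets_density_iff) auto
  then have supp: "AE x in \<rho>. w x = 0 \<longrightarrow> k x \<noteq> 0 \<longrightarrow> x \<in> (\<Union>n. K n)"
    by eventually_elim (auto simp: N_def)
  define c where "c n = M_fourier \<mu> (h_char \<beta> (lam n))" for n
  have H: "extends_exp \<beta> (lam n) (h_char \<beta> (lam n))" for n
    using h[of n] h_char_eq by metis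
  have fourier: "M_fourier \<mu> \<gamma> = (\<integral>x. k x * cnj (\<gamma> x) \<partial>\<rho>)" if \<gamma>: "\<gamma> \<in> characters" for \<gamma>
    by (rule M_fourier_density[OF k \<rho>(2) \<mu>k \<gamma>])
  have sing0: "(\<integral>x. (if w x = 0 then k x else 0) * \<gamma> x \<partial>\<rho>) = 0" if \<gamma>: "\<gamma> \<in> characters" for \<gamma>
  proof -
    obtain l where l: "extends_exp \<beta> l \<gamma>" using extends_exp_ex[OF \<gamma>] by blast
    have "filterlim lam at_top sequentially" using lam by (simp add: frequency_def)
    then have "\<forall>\<^sub>F n in sequentially. - l < lam n" by (simp add: filterlim_at_top_dense)
    then obtain j where j: "- l < lam j" by (auto simp: eventually_sequentially)
    define T where "T x = (\<Sum>n<j. c n * h_char \<beta> (lam n) x)" for x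
    have cT: "cont T" unfolding T_def
      by (intro continuous_intros characters_cont extends_exp_char[OF H])
    have iwT: "integrable \<rho> (\<lambda>x. of_real (w x) * T x)"
      by (intro integrable_mult_cont \<rho>(2) cT integrable_of_real w(2))
    define k' where "k' x = k x - of_real (w x) * T x" for x
    have ik': "integrable \<rho> k'" unfolding k'_def using k iwT by simp
    have wm: "(\<integral>x. of_real (w x) * f x \<partial>\<rho>) = (\<integral>x. f x \<partial>m)" if f: "cont f" for f
    proof -
      have [measurable]: "f \<in> borel_measurable \<rho>"
        using borel_measurable_continuous_onI[OF f] measurable_cong_sets[OF \<rho>(2) refl] by auto
      show ?thesis unfolding w(3) using w(1)
        by (subst integral_density) (auto simp: scaleR_conv_of_real)
    qed
    have zero: "(\<integral>x. k' x * \<eta> x \<partial>\<rho>) = 0" if \<eta>: "extends_exp \<beta> l' \<eta>" "- lam j < l'" for \<eta> l'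
    proof -
      \<comment> \<open>Integration against \<open>\<eta>\<close> is the Fourier coefficient at its conjugate, of frequency
        \<open>- l' < lam j\<close>.\<close>
      define \<eta>' where "\<eta>' = (\<lambda>x. cnj (\<eta> x))"
      have \<eta>': "extends_exp \<beta> (- l') \<eta>'" unfolding \<eta>'_def by (rule extends_exp_cnj[OF \<eta>(1)])
      have ce: "cont \<eta>" by (intro characters_cont extends_exp_char[OF \<eta>(1)])
      have i1: "integrable \<rho> (\<lambda>x. k x * \<eta> x)" by (rule integrable_mult_cont[OF \<rho>(2) k ce])
      have i2: "integrable \<rho> (\<lambda>x. of_real (w x) * T x * \<eta> x)" by (rule integrable_mult_cont[OF \<rho>(2) iwT ce])
      have orth: "(\<integral>x. h_char \<beta> (lam n) x * \<eta> x \<partial>m) = (if \<eta>' = h_char \<beta> (lam n) then 1 else 0)" for n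
      proof (cases "\<eta>' = h_char \<beta> (lam n)")
        case True
        have "h_char \<beta> (lam n) x * \<eta> x = 1" for x
          unfolding True[symmetric] \<eta>'_def
          using characters_norm[OF extends_exp_char[OF \<eta>(1)], of x] complex_norm_square[of "\<eta> x"]
          by (simp add: mult.commute)
        then show ?thesis using True by simp
      next
        case False
        have e: "extends_exp \<beta> (lam n + l') (\<lambda>x. h_char \<beta> (lam n) x * \<eta> x)"
          by (rule extends_exp_mult[OF H \<eta>(1)])
        have "(\<lambda>x. h_char \<beta> (lam n) x * \<eta> x) \<noteq> (\<lambda>_. 1)"
        proof
          assume "(\<lambda>x. h_char \<beta> (lam n) x * \<eta> x) = (\<lambda>_. 1)"
          then have "lam n + l' = 0" using extends_exp_freq_unique[OF e] extends_exp_one by auto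
          then have "- l' = lam n" by simp
          then show False using False extends_exp_unique[OF \<eta>' ] H[of n] by simp
        qed
        then show ?thesis using False integral_character[OF extends_exp_char[OF e]] by simp
      qed
      have "(\<integral>x. k x * \<eta> x \<partial>\<rho>) = M_fourier \<mu> \<eta>'"
        using fourier[OF extends_exp_char[OF \<eta>']] by (simp add: \<eta>'_def)
      moreover have "(\<integral>x. of_real (w x) * T x * \<eta> x \<partial>\<rho>) = (\<Sum>n<j. c n * (if \<eta>' = h_char \<beta> (lam n) then 1 else 0))"
      proof -
        have "(\<integral>x. of_real (w x) * T x * \<eta> x \<partial>\<rho>) = (\<integral>x. T x * \<eta> x \<partial>m)"
          using wm[of "\<lambda>x. T x * \<eta> x"] continuous_on_mult[OF cT ce] by (simp add: mult.assoc)
        also have "\<dots> = (\<integral>x. (\<Sum>n<j. c n * (h_char \<beta> (lam n) x * \<eta> x)) \<partial>m)"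
          by (simp add: T_def sum_distrib_right mult.assoc)
        also have "\<dots> = (\<Sum>n<j. c n * (\<integral>x. h_char \<beta> (lam n) x * \<eta> x \<partial>m))"
          by (subst Bochner_Integration.integral_sum)
            (auto intro!: integrable_cont continuous_intros ce characters_cont[OF extends_exp_char[OF H]])
        finally show ?thesis unfolding orth .
      qed
      moreover have "M_fourier \<mu> \<eta>' = (\<Sum>n<j. c n * (if \<eta>' = h_char \<beta> (lam n) then 1 else 0))"
      proof (cases "\<exists>n<j. \<eta>' = h_char \<beta> (lam n)")
        case True
        then obtain n where n: "n < j" "\<eta>' = h_char \<beta> (lam n)" by blast
        have inj: "\<eta>' = h_char \<beta> (lam i) \<longleftrightarrow> i = n" for i
        proof
          assume "\<eta>' = h_char \<beta> (lam i)"
          then have "lam i = lam n" using extends_exp_freq_unique H[of i] H[of n] n(2) by metis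
          then show "i = n" using lam by (auto simp: frequency_def dest!: strict_mono_eq)
        qed (use n in simp)
        show ?thesis unfolding inj using n by (simp add: c_def if_distrib cong: if_cong)
      next
        case False
        have "M_fourier \<mu> \<eta>' = 0"
        proof (rule ccontr)
          assume "M_fourier \<mu> \<eta>' \<noteq> 0"
          then obtain i where i: "\<eta>' = h_char \<beta> (lam i)"
            using \<mu> extends_exp_char[OF \<eta>'] by (auto simp: M_lambda_def)
          then have "- l' = lam i" using extends_exp_freq_unique[OF \<eta>'] H[of i] by simp
          then have "lam i < lam j" using \<eta>(2) by simp
          then have "i < j" using lam by (auto simp: frequency_def strict_mono_less)
          with i False show False by blast
        qed
        moreover have "(\<Sum>n<j. c n * (if \<eta>' = h_char \<beta> (lam n) then 1 else 0)) = 0"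
          using False by (intro sum.neutral) auto
        ultimately show ?thesis by simp
      qed
      ultimately have "(\<integral>x. k x * \<eta> x \<partial>\<rho>) - (\<integral>x. of_real (w x) * T x * \<eta> x \<partial>\<rho>) = 0" by simp
      then show ?thesis using i1 i2 by (simp add: k'_def left_diff_distrib)
    qed
    have supp': "AE x in \<rho>. w x = 0 \<longrightarrow> k' x \<noteq> 0 \<longrightarrow> x \<in> (\<Union>n. K n)"
      using supp by eventually_elim (auto simp: k'_def)
    have "(\<integral>x. (if w x = 0 then k' x else 0) * \<gamma> x \<partial>\<rho>) = 0"
      by (rule singular_part_annihilates[OF \<rho> ik' w K(1,2) K(3)[unfolded N_def] supp' zero l])
        (use j in auto)
    moreover have "(if w x = 0 then k' x else 0) = (if w x = 0 then k x else 0)" for x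
      by (simp add: k'_def)
    ultimately show ?thesis by simp
  qed
  have iks: "integrable \<rho> (\<lambda>x. if w x = 0 then k x else 0)"
    by (rule Bochner_Integration.integrable_bound[OF k]) auto
  have "AE x in \<rho>. (if w x = 0 then k x else 0) = 0"
    by (rule fourier_unique[OF \<rho> k reg _ iks _ sing0]) (auto simp: tv \<kappa>_def)
  then have kN: "AE x in \<rho>. w x = 0 \<longrightarrow> k x = 0" by eventually_elim (auto split: if_splits)
  \<comment> \<open>On \<open>{w = 0}\<close> the quotient is 0, which is harmless because \<open>k\<close> vanishes there almost everywhere.\<close>
  define f where "f x = k x / of_real (w x)" for x
  have [measurable]: "f \<in> borel_measurable \<rho>" unfolding f_def by measurable
  have wf: "AE x in \<rho>. w x *\<^sub>R f x = k x"
    using kN by eventually_elim (auto simp: f_def scaleR_conv_of_real)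
  have "integrable \<rho> (\<lambda>x. w x *\<^sub>R f x)"
  proof (rule integrable_cong_AE_imp[OF k])
    show "AE x in \<rho>. k x = w x *\<^sub>R f x" using wf by eventually_elim simp
  qed measurable
  then have "integrable m f"
    unfolding w(3) using w(1) by (subst integrable_density) auto
  moreover have "\<mu> A = (LINT x:A|m. f x)" if A: "A \<in> sets borel" for A
  proof -
    have [measurable]: "A \<in> sets \<rho>" using A \<rho>(2) by simp
    have "(LINT x:A|m. f x) = (\<integral>x. w x *\<^sub>R (indicator A x *\<^sub>R f x) \<partial>\<rho>)"
      unfolding w(3) set_lebesgue_integral_def using w(1) by (subst integral_density) auto
    also have "\<dots> = (\<integral>x. indicator A x *\<^sub>R k x \<partial>\<rho>)"
    proof (rule integral_cong_AE)
      show "AE x in \<rho>. w x *\<^sub>R (indicator A x *\<^sub>R f x) = indicator A x *\<^sub>R k x"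
        using wf by eventually_elim (metis scaleR_left_commute)
    qed measurable
    finally show ?thesis using \<mu>k[OF A] by (simp add: set_lebesgue_integral_def)
  qed
  ultimately show ?thesis by (rule that)
qed

theorem theorem4p25:
  fixes lam :: "nat \<Rightarrow> real"
    and \<beta> :: "real \<Rightarrow> 'g::{topological_ab_group_add,t2_space}"
    and m :: "'g measure"
  assumes "frequency lam"
    and "lambda_dirichlet_group lam \<beta>"
    and "normalized_haar m"
  shows
    "dens_measure m ` H1 lam \<beta> m = M_lambda lam \<beta> \<and>
     (\<forall>F\<in>H1 lam \<beta> m. \<forall>G\<in>H1 lam \<beta> m.
        dens_measure m (L1_add m F G) = (\<lambda>A. dens_measure m F A + dens_measure m G A)) \<and>
     (\<forall>c. \<forall>F\<in>H1 lam \<beta> m.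
        dens_measure m (L1_scale m c F) = (\<lambda>A. c * dens_measure m F A)) \<and>
     (\<forall>F\<in>H1 lam \<beta> m. M_norm (dens_measure m F) = L1_norm m F) \<and>
     (\<forall>F\<in>H1 lam \<beta> m. \<forall>\<gamma>\<in>characters.
        M_fourier (dens_measure m F) \<gamma> = L1_fourier m F \<gamma>)"
proof -
  have dir: "dirichlet_group \<beta>" and h: "\<exists>h. extends_exp \<beta> (lam n) h" for n
    using assms(2) by (auto simp: lambda_dirichlet_group_def)
  interpret compact_flow m \<beta>
    using dir assms(3) by unfold_locales (auto simp: dirichlet_group_def)
  have H1: "F \<in> L1 m" if "F \<in> H1 lam \<beta> m" for F using that by (simp add: H1_def)
  have "dens_measure m ` H1 lam \<beta> m = M_lambda lam \<beta>"
  proof (intro equalityI subsetI)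
    fix \<mu> assume "\<mu> \<in> dens_measure m ` H1 lam \<beta> m"
    then obtain F where F: "F \<in> H1 lam \<beta> m" "\<mu> = dens_measure m F" by blast
    then show "\<mu> \<in> M_lambda lam \<beta>"
      using dens_measure_in_M[OF H1[OF F(1)]] M_fourier_dens_measure[OF H1[OF F(1)]]
      by (auto simp: M_lambda_def H1_def)
  next
    fix \<mu> assume \<mu>: "\<mu> \<in> M_lambda lam \<beta>"
    obtain f where f: "integrable m f" "\<And>A. A \<in> sets borel \<Longrightarrow> \<mu> A = (LINT x:A|m. f x)"
      using M_lambda_density[OF assms(1) h \<mu>] by blast
    define F where "F = L1_class m f"
    have F: "F \<in> L1 m" unfolding F_def by (rule L1_class_in_L1[OF f(1)])
    have "\<mu> A = 0" if "A \<notin> sets borel" for A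
      using \<mu> that by (simp add: M_lambda_def M_def complex_borel_measure_def)
    then have \<mu>_eq: "\<mu> = dens_measure m F"
      unfolding F_def dens_measure_class[OF f(1) sets_m] using f(2) by auto
    have "F \<in> H1 lam \<beta> m"
      using \<mu> F M_fourier_dens_measure[OF F] unfolding \<mu>_eq by (auto simp: M_lambda_def H1_def)
    then show "\<mu> \<in> dens_measure m ` H1 lam \<beta> m" using \<mu>_eq by blast
  qed
  then show ?thesis
    by (intro conjI ballI allI dens_measure_add dens_measure_scale M_norm_dens_measure
        M_fourier_dens_measure H1)
qed

end
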